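(* Let $C\subset\mathbb{R}^n$ be a polyhedral proper cone (so $\operatorname{lin}C=\{0\}$), $q\in\mathbb{R}^n$, and let $M\in\mathbb{R}^{n\times n}$ be copositive with respect to $C$. Suppose that the following implication holds: $$z\in\operatorname{rec}C,\quad Mz\in(\operatorname{rec}C)^D,\quad z^TMz=0\quad\Longrightarrow\quad z^Tq\ge0.$$ Then the $\mathrm{AVI}(C,q,M)$ has a solution and PathAVI finds it.
   Context: $\mathrm{AVI}(C,q,M)$: find $z\in C$ with $\langle Mz+q,y-z\rangle\ge 0$ for all $y\in C$. A proper cone is a closed convex pointed cone with nonempty interior. $\operatorname{rec} C$ is the recession cone (equal to $C$ for a closed convex cone), $\operatorname{lin} C=\operatorname{rec}C\cap(-\operatorname{rec}C)$, and $(K')^D=\{y:\langle y,k\rangle\ge0\ \forall k\in K'\}$ for a closed convex cone $K'$. $M$ is copositive with respect to $C$ if $\langle x,Mx\rangle\ge0$ for all $x\in C$. PathAVI (when $\operatorname{lin}C=\{0\}$). Write $C=\{z\in\mathbb{R}^n: Az-b\in K,\ l\le z\le u\}$, with $A\in\mathbb{R}^{m\times n}$ having nonzero rows, $b\in\mathbb{R}^m$, $l_j,u_j\in\mathbb{R}\cup\{\pm\infty\}$, and $K$ a Cartesian product of copies of $\mathbb{R}_+,\{0\},\mathbb{R}_-$. Normal cone: $N_C(z)=\{y:\langle y,z'-z\rangle\le0\ \forall z'\in C\}$ for $z\in C$. $\pi_C$ is the Euclidean projection onto $C$. For a vector $r$, $G_C(x,t)=M\pi_C(x)+q+x-\pi_C(x)-tr$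 on $\mathbb{R}^n\times\mathbb{R}_+$. For each nonempty face $F$ of $C$ let $N_F$ be the constant value of $N_C$ on $\operatorname{ri}F$ and $\sigma_F=F+N_F$; the sets $\sigma_F\times\mathbb{R}_+$ are the $(n+1)$-cells of the manifold $\mathcal{M}_C$; $G_C$ is affine on each. The method chooses an extreme point $\bar z$ of $C$ and a vector $r\in\operatorname{ri}(N_C(\bar z))$ (here $N_C(\bar z)$ is full-dimensional). For all large $t$ there is a point $x(t)$ with $\pi_C(x(t))=\bar z$ and $G_C(x(t),t)=0$ (the starting ray). Starting from this ray (with $t$ decreasing), it follows the piecewise linear path in $G_C^{-1}(0)$ by complementary pivoting on the system $Mz+q-A^T\lambda-w+v=tr$, $Az-b=s$, with $K\ni s\perp\lambda\in K^D$, $0\le z-l\perp w\ge0$, $0\le u-z\perp v\ge0$, $t\ge0$ (here $x=z-A^T\lambda-w+v$; components of $w$, $v$ attached to infinite bounds are absent): the variable $t$ is pivoted into a complementary basis at $\bar z$, and then repeatedly the complement of the variable that just left the basis enters, the leaving variable being chosen by the lexicographic ratio test. Each pivot traverses one $(n+1)$-cell and no cell is traversed twice. The method terminates either when $t=0$, in which case $z=\pi_C(x)$ solves the AVI ("PathAVI finds a solution"), or when the path leaves along an unbounded ray other than the starting ray (a "secondary ray"). *)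

theory Defs
  imports "HOL-Analysis.Analysis"
begin

definition recession_cone :: "'a::real_vector set \<Rightarrow> 'a set" where
  "recession_cone S = {d. \<forall>x\<in>S. \<forall>t\<ge>0. x + t *\<^sub>R d \<in> S}"

definition dual_cone :: "'a::real_inner set \<Rightarrow> 'a set" where
  "dual_cone K = {y. \<forall>k\<in>K. y \<bullet> k \<ge> 0}"

definition normal_cone :: "'a::real_inner set \<Rightarrow> 'a \<Rightarrow> 'a set" where
  "normal_cone C z = {y. \<forall>z'\<in>C. y \<bullet> (z' - z) \<le> 0}"

definition proper_cone :: "'a::euclidean_space set \<Rightarrow> bool" where
  "proper_cone C \<longleftrightarrow> closed C \<and> convex C \<and> cone C \<and> C \<inter> uminus ` C = {0} \<and> interior C \<noteq> {}"

definition copositive_on :: "(real^'n) set \<Rightarrow> real^'n^'n \<Rightarrow> bool" where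
  "copositive_on C M \<longleftrightarrow> (\<forall>x\<in>C. x \<bullet> (M *v x) \<ge> 0)"

definition solves_AVI :: "(real^'n) set \<Rightarrow> real^'n \<Rightarrow> real^'n^'n \<Rightarrow> real^'n \<Rightarrow> bool" where
  "solves_AVI C q M z \<longleftrightarrow> z \<in> C \<and> (\<forall>y\<in>C. (M *v z + q) \<bullet> (y - z) \<ge> 0)"

definition G_map ::
  "(real^'n) set \<Rightarrow> real^'n^'n \<Rightarrow> real^'n \<Rightarrow> real^'n \<Rightarrow> real^'n \<Rightarrow> real \<Rightarrow> real^'n" where
  "G_map C M q r x t = M *v closest_point C x + q + x - closest_point C x - t *\<^sub>R r"


section \<open>Polyhedral representations\<close>

datatype factor = Rplus | Rzero | Rminus

fun factor_set :: "factor \<Rightarrow> real set" where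
  "factor_set Rplus = {0..}"
| "factor_set Rzero = {0}"
| "factor_set Rminus = {..0}"

lemma dual_cone_Rplus: "dual_cone {0::real..} = {0..}"
proof (intro equalityI subsetI)
  fix x :: real
  assume "x \<in> dual_cone {0..}"
  then have "\<forall>k\<in>{0..}. x * k \<ge> 0"
    unfolding dual_cone_def inner_real_def by (rule CollectD)
  then have "x * 1 \<ge> 0"
    by (rule bspec) simp
  then show "x \<in> {0..}" by simp
next
  fix x :: real
  assume "x \<in> {0..}"
  then show "x \<in> dual_cone {0..}"
    unfolding dual_cone_def inner_real_def by (intro CollectI ballI mult_nonneg_nonneg) simp_all
qed

lemma dual_cone_Rzero: "dual_cone {0::real} = UNIV"
  by (simp add: dual_cone_def)

lemma dual_cone_Rminus: "dual_cone {..0::real} = {..0}"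
proof (intro equalityI subsetI)
  fix x :: real
  assume "x \<in> dual_cone {..0}"
  then have "\<forall>k\<in>{..0}. x * k \<ge> 0"
    unfolding dual_cone_def inner_real_def by (rule CollectD)
  then have "x * (-1) \<ge> 0"
    by (rule bspec) simp
  then show "x \<in> {..0}" by simp
next
  fix x :: real
  assume "x \<in> {..0}"
  then show "x \<in> dual_cone {..0}"
    unfolding dual_cone_def inner_real_def by (intro CollectI ballI mult_nonpos_nonpos) simp_all
qed

text \<open>The rows of the constraint matrix are those with index in \<open>R\<close>, so that the number of
  rows is \<open>card R\<close>, which may be zero; the remaining rows of \<open>A\<close> and \<open>b\<close> are zero padding.\<close>

definition representation_of ::
  "(real^'n) set \<Rightarrow> 'm::finite set \<Rightarrow> real^'n^'m \<Rightarrow> real^'m \<Rightarrow> ('m \<Rightarrow> factor)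
    \<Rightarrow> ('n \<Rightarrow> ereal) \<Rightarrow> ('n \<Rightarrow> ereal) \<Rightarrow> bool" where
  "representation_of C R A b K l u \<longleftrightarrow>
     (\<forall>i\<in>R. row i A \<noteq> 0) \<and>
     (\<forall>i. i \<notin> R \<longrightarrow> row i A = 0 \<and> b $ i = 0) \<and>
     C = {z. (\<forall>i\<in>R. (A *v z - b) $ i \<in> factor_set (K i)) \<and>
             (\<forall>j. l j \<le> ereal (z $ j) \<and> ereal (z $ j) \<le> u j)}"


section \<open>Complementary pivoting\<close>

text \<open>The variables of the system
    \<open>M z + q - A\<^sup>T \<lambda> - w + v = t r\<close>, \<open>A z - b = s\<close>.\<close>

datatype ('n, 'm) var = Zvar 'n | Wvar 'n | Vvar 'n | Svar 'm | Lvar 'm | Tvar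

text \<open>In a state the variables outside \<open>basis\<close> have the values \<open>nbval\<close> (the values of \<open>nbval\<close>
  on \<open>basis\<close> are irrelevant), and the variable \<open>entering\<close> is about to enter the basis, increasing
  if \<open>dir = 1\<close> and decreasing if \<open>dir = -1\<close>.\<close>

record ('n, 'm) state =
  basis :: "('n, 'm) var set"
  nbval :: "('n, 'm) var \<Rightarrow> real"
  entering :: "('n, 'm) var"
  dir :: real

locale pathavi =
  fixes M :: "real^'n^'n"
    and q :: "real^'n"
    and R :: "'m::finite set"
    and A :: "real^'n^'m"
    and b :: "real^'m"
    and K :: "'m \<Rightarrow> factor"
    and l u :: "'n \<Rightarrow> ereal"
    and r :: "real^'n"
begin

definition vars :: "('n, 'm) var set" where
  "vars = range Zvar \<union> Wvar ` {j. l j \<noteq> -\<infinity>} \<union> Vvar ` {j. u j \<noteq> \<infinity>}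
          \<union> Svar ` R \<union> Lvar ` R \<union> {Tvar}"

text \<open>Bounds of the variables.  Those of \<open>Svar i\<close> describe the \<open>i\<close>-th factor of \<open>K\<close>, those of
  \<open>Lvar i\<close> the \<open>i\<close>-th factor of its dual cone (see \<open>bounds_Svar\<close> and \<open>bounds_Lvar\<close> below).\<close>

fun lo :: "('n, 'm) var \<Rightarrow> ereal" where
  "lo (Zvar j) = l j"
| "lo (Wvar j) = 0"
| "lo (Vvar j) = 0"
| "lo (Svar i) = (case K i of Rplus \<Rightarrow> 0 | Rzero \<Rightarrow> 0 | Rminus \<Rightarrow> -\<infinity>)"
| "lo (Lvar i) = (case K i of Rplus \<Rightarrow> 0 | Rzero \<Rightarrow> -\<infinity> | Rminus \<Rightarrow> -\<infinity>)"
| "lo Tvar = 0"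

fun hi :: "('n, 'm) var \<Rightarrow> ereal" where
  "hi (Zvar j) = u j"
| "hi (Wvar j) = \<infinity>"
| "hi (Vvar j) = \<infinity>"
| "hi (Svar i) = (case K i of Rplus \<Rightarrow> \<infinity> | Rzero \<Rightarrow> 0 | Rminus \<Rightarrow> 0)"
| "hi (Lvar i) = (case K i of Rplus \<Rightarrow> \<infinity> | Rzero \<Rightarrow> \<infinity> | Rminus \<Rightarrow> 0)"
| "hi Tvar = \<infinity>"

lemma bounds_Svar: "{x. lo (Svar i) \<le> ereal x \<and> ereal x \<le> hi (Svar i)} = factor_set (K i)"
  by (cases "K i") (simp_all add: atLeast_def atMost_def set_eq_iff, force)

lemma bounds_Lvar:
  "{x. lo (Lvar i) \<le> ereal x \<and> ereal x \<le> hi (Lvar i)} = dual_cone (factor_set (K i))"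
proof (cases "K i")
  case Rplus
  then show ?thesis by (simp only: lo.simps hi.simps factor_set.simps dual_cone_Rplus) auto
next
  case Rzero
  then show ?thesis by (simp only: lo.simps hi.simps factor_set.simps dual_cone_Rzero) auto
next
  case Rminus
  then show ?thesis by (simp only: lo.simps hi.simps factor_set.simps dual_cone_Rminus) auto
qed

fun col :: "('n, 'm) var \<Rightarrow> (real^'n) \<times> (real^'m)" where
  "col (Zvar j) = (column j M, column j A)"
| "col (Wvar j) = (- axis j 1, 0)"
| "col (Vvar j) = (axis j 1, 0)"
| "col (Svar i) = (0, - axis i 1)"
| "col (Lvar i) = (- row i A, 0)"
| "col Tvar = (- r, 0)"

definition rhs :: "(real^'n) \<times> (real^'m)" where
  "rhs = (- q, b)"

definition is_basis :: "('n, 'm) var set \<Rightarrow> bool" where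
  "is_basis B \<longleftrightarrow> B \<subseteq> vars \<and> card B = CARD('n) + card R \<and> inj_on col B \<and> independent (col ` B)"

definition coeff :: "('n, 'm) var set \<Rightarrow> (real^'n) \<times> (real^'m) \<Rightarrow> ('n, 'm) var \<Rightarrow> real" where
  "coeff B y x = representation (col ` B) y (col x)"

definition val :: "('n, 'm) state \<Rightarrow> ('n, 'm) var \<Rightarrow> real" where
  "val s x = (if x \<in> basis s
              then coeff (basis s) (rhs - (\<Sum>y\<in>vars - basis s. nbval s y *\<^sub>R col y)) x
              else nbval s x)"

definition z_of :: "('n, 'm) state \<Rightarrow> real^'n" where
  "z_of s = (\<chi> j. val s (Zvar j))"

definition x_of :: "('n, 'm) state \<Rightarrow> real^'n" where
  "x_of s = z_of s - transpose A *v (\<chi> i. val s (Lvar i)) - (\<chi> j. val s (Wvar j))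
            + (\<chi> j. val s (Vvar j))"

text \<open>Lexicographic order: the right-hand side is perturbed to
  \<open>rhs + \<epsilon> p\<^sub>1 + \<epsilon>\<^sup>2 p\<^sub>2 + \<dots>\<close>, where \<open>ps = [p\<^sub>1, p\<^sub>2, \<dots>]\<close> is a basis of the space of the
  equations, and values are compared for infinitesimal \<open>\<epsilon> > 0\<close>.  A perturbed value is
  represented by its list of coefficients, the unperturbed value first.  The first \<open>n\<close> of
  the \<open>p\<^sub>k\<close> perturb \<open>G\<^sub>C(x, t) = 0\<close> only, and the perturbation of \<open>A z - b = s\<close> is of lower
  order, so that it resolves degeneracies of the representation of \<open>C\<close> without affecting the path
  through the cells \<open>\<sigma>\<^sub>F \<times> \<real>\<^sub>+\<close>.  Without this priority, pivoting on a degenerate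
  representation may lead back to the starting ray.\<close>

definition lex_order :: "((real^'n) \<times> (real^'m)) list \<Rightarrow> bool" where
  "lex_order ps \<longleftrightarrow> length ps = CARD('n) + card R \<and> distinct ps \<and> independent (set ps) \<and>
     (\<forall>p\<in>set ps. \<forall>i. i \<notin> R \<longrightarrow> snd p $ i = 0) \<and>
     (\<forall>k<CARD('n). snd (ps ! k) = 0)"

definition lexval ::
  "((real^'n) \<times> (real^'m)) list \<Rightarrow> ('n, 'm) state \<Rightarrow> ('n, 'm) var \<Rightarrow> real list" where
  "lexval ps s x =
     val s x # map (\<lambda>p. if x \<in> basis s then coeff (basis s) p x else 0) ps"

definition lexreal :: "((real^'n) \<times> (real^'m)) list \<Rightarrow> real \<Rightarrow> real list" where
  "lexreal ps \<beta> = \<beta> # map (\<lambda>_. 0) ps"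

definition lex_feasible :: "((real^'n) \<times> (real^'m)) list \<Rightarrow> ('n, 'm) state \<Rightarrow> bool" where
  "lex_feasible ps s \<longleftrightarrow> (\<forall>x\<in>basis s. \<forall>\<beta>.
     (lo x = ereal \<beta> \<longrightarrow> lexordp_eq (lexreal ps \<beta>) (lexval ps s x)) \<and>
     (hi x = ereal \<beta> \<longrightarrow> lexordp_eq (lexval ps s x) (lexreal ps \<beta>)))"

text \<open>Rate of change of \<open>x\<close> per unit step of the entering variable.\<close>

definition rate :: "('n, 'm) state \<Rightarrow> ('n, 'm) var \<Rightarrow> real" where
  "rate s x = (if x = entering s then dir s
               else - dir s * coeff (basis s) (col (entering s)) x)"

text \<open>The variable \<open>x\<close> moves towards its finite bound \<open>\<beta>\<close>.  The entering variable itself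
  may block the step.\<close>

definition blocking :: "('n, 'm) state \<Rightarrow> ('n, 'm) var \<Rightarrow> real \<Rightarrow> bool" where
  "blocking s x \<beta> \<longleftrightarrow> x \<in> insert (entering s) (basis s) \<and>
     (rate s x < 0 \<and> lo x = ereal \<beta> \<or> rate s x > 0 \<and> hi x = ereal \<beta>)"

definition ratio ::
  "((real^'n) \<times> (real^'m)) list \<Rightarrow> ('n, 'm) state \<Rightarrow> ('n, 'm) var \<Rightarrow> real \<Rightarrow> real list" where
  "ratio ps s x \<beta> = map2 (\<lambda>c a. (c - a) / rate s x) (lexreal ps \<beta>) (lexval ps s x)"

definition leaving ::
  "((real^'n) \<times> (real^'m)) list \<Rightarrow> ('n, 'm) state \<Rightarrow> ('n, 'm) var \<Rightarrow> real \<Rightarrow> bool" where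
  "leaving ps s x \<beta> \<longleftrightarrow> blocking s x \<beta> \<and>
     (\<forall>x' \<beta>'. blocking s x' \<beta>' \<longrightarrow> lexordp_eq (ratio ps s x \<beta>) (ratio ps s x' \<beta>'))"

text \<open>The complement of a variable that left the basis at its lower (\<open>low\<close>) or upper bound,
  together with the direction in which it enters.  If \<open>Tvar\<close> leaves, then \<open>t = 0\<close> and no
  further pivot takes place.\<close>

fun complement :: "('n, 'm) var \<Rightarrow> bool \<Rightarrow> ('n, 'm) var \<times> real" where
  "complement (Zvar j) low = (if low then Wvar j else Vvar j, 1)"
| "complement (Wvar j) low = (Zvar j, 1)"
| "complement (Vvar j) low = (Zvar j, -1)"
| "complement (Svar i) low = (Lvar i, if low then 1 else -1)"
| "complement (Lvar i) low = (Svar i, if low then 1 else -1)"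
| "complement Tvar low = (Tvar, -1)"

definition pivot :: "((real^'n) \<times> (real^'m)) list \<Rightarrow> ('n, 'm) state \<Rightarrow> ('n, 'm) state \<Rightarrow> bool" where
  "pivot ps s s' \<longleftrightarrow> val s Tvar \<noteq> 0 \<and>
     (\<exists>x \<beta>. leaving ps s x \<beta> \<and>
        s' = \<lparr> basis = insert (entering s) (basis s) - {x},
               nbval = (nbval s)(x := \<beta>),
               entering = fst (complement x (rate s x < 0)),
               dir = snd (complement x (rate s x < 0)) \<rparr>)"

definition complementary_basis :: "('n, 'm) var set \<Rightarrow> bool" where
  "complementary_basis B \<longleftrightarrow> is_basis B \<and> Tvar \<notin> B \<and>
     (\<forall>j. card (B \<inter> {Zvar j, Wvar j, Vvar j}) = 1) \<and>
     (\<forall>i\<in>R. card (B \<inter> {Svar i, Lvar i}) = 1)"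

fun start_val :: "('n, 'm) var set \<Rightarrow> real \<Rightarrow> ('n, 'm) var \<Rightarrow> real" where
  "start_val B t (Zvar j) = (if Wvar j \<in> B then real_of_ereal (l j)
                             else if Vvar j \<in> B then real_of_ereal (u j) else 0)"
| "start_val B t Tvar = t"
| "start_val B t _ = 0"

definition start_state :: "('n, 'm) var set \<Rightarrow> real \<Rightarrow> ('n, 'm) state" where
  "start_state B t = \<lparr> basis = B, nbval = start_val B t, entering = Tvar, dir = -1 \<rparr>"

text \<open>A complementary basis at \<open>zbar\<close> whose basic solutions for \<open>t \<ge> \<tau>\<close> form the starting ray.\<close>

definition start ::
  "(real^'n) set \<Rightarrow> real^'n \<Rightarrow> ((real^'n) \<times> (real^'m)) list \<Rightarrow> ('n, 'm) state \<Rightarrow> bool" where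
  "start C zbar ps s \<longleftrightarrow> lex_order ps \<and>
     (\<exists>B \<tau>. complementary_basis B \<and> \<tau> > 0 \<and> s = start_state B \<tau> \<and>
        (\<forall>t\<ge>\<tau>. lex_feasible ps (start_state B t) \<and>
               z_of (start_state B t) = zbar \<and>
               closest_point C (x_of (start_state B t)) = zbar \<and>
               G_map C M q r (x_of (start_state B t)) t = 0))"

text \<open>A secondary ray is a final state with \<open>t \<noteq> 0\<close> (no variable blocks the step), so the
  second conjunct excludes it.\<close>

definition finds_solution_from ::
  "(real^'n) set \<Rightarrow> ((real^'n) \<times> (real^'m)) list \<Rightarrow> ('n, 'm) state \<Rightarrow> bool" where
  "finds_solution_from C ps s0 \<longleftrightarrow>
     (\<nexists>f. f 0 = s0 \<and> (\<forall>k. pivot ps (f k) (f (Suc k)))) \<and>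
     (\<forall>s. (pivot ps)\<^sup>*\<^sup>* s0 s \<and> (\<nexists>s'. pivot ps s s') \<longrightarrow>
        val s Tvar = 0 \<and> z_of s = closest_point C (x_of s) \<and> solves_AVI C q M (z_of s))"

text \<open>The method can be started at \<open>zbar\<close>, and it succeeds for every choice of the complementary
  basis at \<open>zbar\<close> and of the lexicographic order.\<close>

definition finds_solution :: "(real^'n) set \<Rightarrow> real^'n \<Rightarrow> bool" where
  "finds_solution C zbar \<longleftrightarrow>
     (\<exists>ps s. start C zbar ps s) \<and>
     (\<forall>ps s. start C zbar ps s \<longrightarrow> finds_solution_from C ps s)"

end

text \<open>The extreme point and the covering vector are free choices of the method.\<close>

definition PathAVI_finds_solution ::
  "(real^'n) set \<Rightarrow> real^'n \<Rightarrow> real^'n^'n \<Rightarrow> 'm::finite set \<Rightarrow> real^'n^'m \<Rightarrow> real^'m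
    \<Rightarrow> ('m \<Rightarrow> factor) \<Rightarrow> ('n \<Rightarrow> ereal) \<Rightarrow> ('n \<Rightarrow> ereal) \<Rightarrow> bool" where
  "PathAVI_finds_solution C q M R A b K l u \<longleftrightarrow>
     (\<exists>zbar. zbar extreme_point_of C) \<and>
     (\<forall>zbar r. zbar extreme_point_of C \<and> r \<in> rel_interior (normal_cone C zbar) \<longrightarrow>
        pathavi.finds_solution M q R A b K l u r C zbar)"

end

theory Submission
  imports Defs
begin

text \<open>
  Because \<open>C\<close> is pointed, its only extreme point is 0, and \<open>r\<close> in the interior of the polar cone
  means \<open>r \<bullet> x < 0\<close> for nonzero \<open>x\<close> in \<open>C\<close>. Replacing the lexicographic order by a real
  perturbation parameter \<open>\<epsilon>\<close> that tends to 0 from above, every basic variable lies strictly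
  between its bounds, so that a vertex of the perturbed problem lies on exactly two edges and an
  edge has at most two endpoints; hence no edge is visited twice and the method stops. If it stops
  on a ray with \<open>t > 0\<close>, let \<open>d\<close> be the direction of \<open>z\<close> and \<open>\<tau> \<ge> 0\<close> that of \<open>t\<close>. Complementarity
  gives \<open>d \<bullet> M d = \<tau> (r \<bullet> d)\<close>, and copositivity and the hypothesis on \<open>q\<close> exclude \<open>d \<noteq> 0\<close>. Then \<open>\<tau> > 0\<close>
  since \<open>C\<close> has an interior point, \<open>z = 0\<close>, and the ray emanates from a complementary basis
  at 0. As the perturbation of the first equation dominates that of the constraints, there is only
  one such basis, so that the ray is the starting one, a contradiction.

  Solvability does not follow from this argument, because the index type of the rows may be too
  small for a representation of \<open>C\<close>. It is obtained from solutions on the slices \<open>- (r \<bullet> x) \<le> k\<close>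
  (Brouwer): if none of them solves the problem, infinitely many of them lie in the same piece of
  the polyhedral complex, and the limit of their directions leads to the same contradiction.
\<close>

section \<open>Infinitesimal perturbations\<close>

text \<open>A path of finitely many pivots involves only finitely many eventual inequalities, so a
  single small \<epsilon> satisfies all of them, and the statements about vertices and edges become
  geometry at that \<epsilon>; the starting ray alone needs an \<epsilon> that is uniform along its
  infinite length. The delicate point is that there is only one complementary basis at 0: the
  representation may be degenerate, and two bases may have slightly different perturbed vertices.
  Perturbing only the first equation leaves z at 0, so these vertices differ at order n + 1 in
  \<epsilon>, n being the dimension, whereas each multiplier has a nonzero coefficient of order at
  most n. The multipliers of one basis can therefore be corrected so that both bases carry the same
  normal vector, and complementary slackness compares them. That the method can start is a separate
  matter: \<open>t *\<^sub>R r - q\<close> has to stay in one simplicial cone of normals for all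
  large t, and the lexicographic order has to be chosen so that the perturbation points into the
  feasible region.\<close>

primrec lexpoly :: "real list \<Rightarrow> real \<Rightarrow> real" where
  "lexpoly [] \<epsilon> = 0"
| "lexpoly (x # xs) \<epsilon> = x + \<epsilon> * lexpoly xs \<epsilon>"

lemma lexpoly_replicate_zero [simp]: "lexpoly (replicate n 0) \<epsilon> = 0"
  by (induction n) simp_all

lemma lexpoly_tendsto:
  "((\<lambda>\<epsilon>::real. lexpoly (x # xs) \<epsilon>) \<longlongrightarrow> x) (at_right 0)"
proof -
  have "continuous_on UNIV (\<lambda>\<epsilon>::real. lexpoly ys \<epsilon>)" for ys
    by (induction ys) (auto intro!: continuous_intros)
  then have "isCont (lexpoly (x # xs)) 0"
    by (simp only: continuous_on_eq_continuous_at[OF open_UNIV] UNIV_I ball_simps)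
  then have "(lexpoly (x # xs) \<longlongrightarrow> lexpoly (x # xs) 0) (at 0)"
    by (simp only: isCont_def)
  then have "(lexpoly (x # xs) \<longlongrightarrow> x) (at 0)"
    by (simp only: lexpoly.simps mult_zero_left add_0_right)
  then show ?thesis
    by (rule filterlim_mono) (auto simp: at_within_le_at)
qed

text \<open>At the first position where the lists differ, both remaining polynomials tend to their
  entries there, and a number strictly between these entries separates them; a common prefix only
  contributes positive powers of \<epsilon>.\<close>

lemma lexordp_imp_eventually_less:
  assumes "ord_class.lexordp a b" "length a = length b"
  shows "\<forall>\<^sub>F \<epsilon> in at_right (0::real). lexpoly a \<epsilon> < lexpoly b \<epsilon>"
  using assms
proof (induction rule: lexordp_induct)
  case (Cons x xs y ys)
  then obtain c where "x < c" "c < y"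
    using dense by blast
  have "\<forall>\<^sub>F \<epsilon> in at_right 0. lexpoly (x # xs) \<epsilon> < c"
    using \<open>x < c\<close> lexpoly_tendsto order_tendstoD(2) by blast
  moreover have "\<forall>\<^sub>F \<epsilon> in at_right 0. c < lexpoly (y # ys) \<epsilon>"
    using \<open>c < y\<close> lexpoly_tendsto order_tendstoD(1) by blast
  ultimately show ?case
    by eventually_elim linarith
next
  case (Cons_eq x xs ys)
  then have "\<forall>\<^sub>F \<epsilon> in at_right 0. lexpoly xs \<epsilon> < lexpoly ys \<epsilon>"
    by simp
  with eventually_at_right_less[of "0::real"] show ?case
    by eventually_elim simp
qed simp

text \<open>The converse rests on linearity of the order: the reversed strict comparison would hold
  eventually as well. Ratio tests and feasibility are translated into real inequalities by this
  equivalence.\<close>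

lemma lexordp_eq_iff_eventually:
  assumes "length a = length b"
  shows "lexordp_eq a b \<longleftrightarrow>
    (\<forall>\<^sub>F \<epsilon> in at_right (0::real). lexpoly a \<epsilon> \<le> lexpoly b \<epsilon>)"
proof
  assume "lexordp_eq a b"
  then have "ord_class.lexordp a b \<or> a = b"
    using lexordp_eq_antisym lexordp_linear lexordp_into_lexordp_eq by blast
  then show "\<forall>\<^sub>F \<epsilon> in at_right 0. lexpoly a \<epsilon> \<le> lexpoly b \<epsilon>"
    using eventually_mono[OF lexordp_imp_eventually_less[OF _ assms] less_imp_le] by auto
next
  assume ev: "\<forall>\<^sub>F \<epsilon> in at_right 0. lexpoly a \<epsilon> \<le> lexpoly b \<epsilon>"
  have "\<not> ord_class.lexordp b a"
  proof
    assume "ord_class.lexordp b a"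
    then have "\<forall>\<^sub>F \<epsilon> in at_right 0. lexpoly b \<epsilon> < lexpoly a \<epsilon>"
      using assms by (intro lexordp_imp_eventually_less) auto
    with ev have "\<forall>\<^sub>F \<epsilon> in at_right (0::real). False"
      by eventually_elim linarith
    then show False
      by (simp add: eventually_False trivial_limit_at_right_real)
  qed
  then show "lexordp_eq a b"
    using lexordp_linear[of a b] lexordp_into_lexordp_eq[of a b] lexordp_eq_refl[of a] by auto
qed

lemma eventually_le_imp_less:
  assumes "length a = length b" "a \<noteq> b"
    and "\<forall>\<^sub>F \<epsilon> in at_right (0::real). lexpoly a \<epsilon> \<le> lexpoly b \<epsilon>"
  shows "\<forall>\<^sub>F \<epsilon> in at_right (0::real). lexpoly a \<epsilon> < lexpoly b \<epsilon>"
  using assms lexordp_eq_iff_eventually lexordp_imp_eventually_less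
  by (metis lexordp_conv_lexordp_eq lexordp_eq_antisym)

text \<open>Comparison with the zero list in both directions, then antisymmetry; no counting of
  roots.\<close>

lemma eventually_lexpoly_zero:
  assumes "\<forall>\<^sub>F \<epsilon> in at_right (0::real). lexpoly a \<epsilon> = 0"
  shows "a = replicate (length a) 0"
proof -
  have "lexordp_eq a (replicate (length a) 0)" "lexordp_eq (replicate (length a) 0) a"
    using assms by (simp_all add: lexordp_eq_iff_eventually eventually_mono)
  then show ?thesis
    by (rule lexordp_eq_antisym)
qed

lemma lexordp_eq_take:
  "lexordp_eq a b \<Longrightarrow> lexordp_eq (take k a) (take k b)"
  by (induction a b arbitrary: k rule: lexordp_eq.induct) (case_tac k; auto)+

text \<open>The first nonzero coefficient belongs to a power of \<epsilon> below
  \<open>length a\<close>, so a term of order \<open>\<epsilon> ^ length a\<close> with a convergent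
  factor cannot change the sign. In the uniqueness argument this lets multipliers outweigh
  displacements of the vertex.\<close>

lemma lex_positive_dominates:
  assumes "ord_class.lexordp (replicate (length a) 0) a"
    and "(g \<longlongrightarrow> L) (at_right (0::real))"
  shows "\<forall>\<^sub>F \<epsilon> in at_right (0::real). lexpoly a \<epsilon> + \<epsilon> ^ length a * g \<epsilon> > 0"
  using assms(1)
proof (induction a rule: list.induct)
  case (Cons x a)
  show ?case
  proof (cases "x > 0")
    case True
    have "((\<lambda>\<epsilon>. lexpoly (x # a) \<epsilon> + \<epsilon> ^ length (x # a) * g \<epsilon>) \<longlongrightarrow> x + 0 ^ length (x # a) * L)
      (at_right 0)"
      by (intro tendsto_intros lexpoly_tendsto assms(2))
    from order_tendstoD(1)[OF this, of 0] show ?thesis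
      using True by (simp only: power_Suc length_Cons mult_zero_left add_0_right)
  next
    case False
    then have "x = 0" "ord_class.lexordp (replicate (length a) 0) a"
      using Cons.prems by auto
    from Cons.IH[OF this(2)] eventually_at_right_less[of "0::real"] show ?thesis
    proof eventually_elim
      case (elim \<epsilon>)
      then have "0 < \<epsilon> * (lexpoly a \<epsilon> + \<epsilon> ^ length a * g \<epsilon>)"
        by simp
      then show ?case
        using \<open>x = 0\<close> by (simp add: algebra_simps)
    qed
  qed
qed simp

lemma lexpoly_zero [simp]: "lexpoly (map (\<lambda>_. 0) xs) \<epsilon> = 0"
  by (induction xs) simp_all

lemma lexpoly_map2_diff_divide:
  "length a = length b \<Longrightarrow>
    lexpoly (map2 (\<lambda>c a. (c - a) / k) a b) \<epsilon> = (lexpoly a \<epsilon> - lexpoly b \<epsilon>) / k"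
  by (induction a b rule: list_induct2)
    (simp_all add: diff_divide_distrib add_divide_distrib right_diff_distrib)

lemma lexpoly_uminus: "lexpoly (map uminus a) \<epsilon> = - lexpoly a \<epsilon>"
  by (induction a) simp_all

lemma lexordp_zeros_uminus:
  "ord_class.lexordp (a :: real list) (replicate (length a) 0) \<Longrightarrow>
    ord_class.lexordp (replicate (length (map uminus a)) 0) (map uminus a)"
  by (induction a) auto

lemma lexpoly_split:
  "lexpoly a \<epsilon> = lexpoly (take k a) \<epsilon> + \<epsilon> ^ k * lexpoly (drop k a) \<epsilon>"
proof (induction a arbitrary: k)
  case (Cons x a)
  show ?case
  proof (cases k)
    case (Suc k')
    then show ?thesis
      using arg_cong[OF Cons.IH[of k'], of "(*) \<epsilon>"] by (simp add: algebra_simps)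
  qed simp
qed simp

lemma lexpoly_bounded: "\<exists>L. (lexpoly a \<longlongrightarrow> L) (at_right (0::real))"
proof (cases a)
  case Nil
  then have "lexpoly a = (\<lambda>_. 0)" by auto
  then show ?thesis by auto
next
  case (Cons x xs)
  then show ?thesis using lexpoly_tendsto by blast
qed

lemma lexordp_eq_finite_minimum:
  fixes f :: "'a \<Rightarrow> real list"
  assumes "finite P" "P \<noteq> {}"
  shows "\<exists>p\<in>P. \<forall>p'\<in>P. lexordp_eq (f p) (f p')"
  using assms
proof (induction rule: finite_ne_induct)
  case (insert x F)
  then obtain p where p: "p \<in> F" "\<forall>p'\<in>F. lexordp_eq (f p) (f p')" by blast
  consider "lexordp_eq (f p) (f x)" | "lexordp_eq (f x) (f p)"
    using lexordp_linear[of "f p" "f x"] lexordp_into_lexordp_eq lexordp_eq_refl by metis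
  then show ?case
  proof cases
    case 1
    then show ?thesis using p by (intro bexI[of _ p]) auto
  next
    case 2
    then show ?thesis
      using p lexordp_eq_trans[OF 2] by (intro bexI[of _ x]) (auto simp: lexordp_eq_refl)
  qed
qed (simp add: lexordp_eq_refl)

lemma lexordp_eq_zeros_pos:
  "a > 0 \<Longrightarrow> lexordp_eq (replicate (n + Suc k) (0::real)) (replicate n 0 @ a # xs)"
  "a < 0 \<Longrightarrow> lexordp_eq (replicate n 0 @ a # xs) (replicate (n + Suc k) (0::real))"
  by (induction n) auto

section \<open>Existence of solutions\<close>

lemma recession_cone_of_convex_cone:
  assumes "convex C" "cone C" "0 \<in> C"
  shows "recession_cone C = C"
proof
  show "recession_cone C \<subseteq> C"
  proof
    fix d assume "d \<in> recession_cone C"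
    then have "0 + 1 *\<^sub>R d \<in> C"
      using assms(3) unfolding recession_cone_def by (metis (no_types, lifting) mem_Collect_eq zero_le_one)
    then show "d \<in> C" by simp
  qed
  show "C \<subseteq> recession_cone C"
    using assms convex_cone[of C] unfolding recession_cone_def by blast
qed

lemma convex_normal_cone: "convex (normal_cone C z)"
  unfolding normal_cone_def convex_def
  by (auto simp: inner_add_left intro!: add_nonpos_nonpos mult_nonneg_nonpos)

lemma closest_point_normal:
  fixes C :: "'a::euclidean_space set"
  assumes "closed C" "convex C" "z \<in> C" "y \<in> normal_cone C z"
  shows "closest_point C (z + y) = z"
proof -
  have "dist (z + y) z \<le> dist (z + y) c" if "c \<in> C" for c
  proof -
    have "(norm (z + y - c))\<^sup>2 = (norm y)\<^sup>2 + (norm (c - z))\<^sup>2 - 2 * (y \<bullet> (c - z))"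
      unfolding power2_norm_eq_inner
      by (simp add: inner_diff_left inner_diff_right inner_add_left inner_add_right inner_commute)
    moreover have "y \<bullet> (c - z) \<le> 0"
      using assms(4) that unfolding normal_cone_def by blast
    moreover have "(norm (c - z))\<^sup>2 \<ge> 0"
      by simp
    ultimately have "(norm y)\<^sup>2 \<le> (norm (z + y - c))\<^sup>2"
      by linarith
    then have "norm y \<le> norm (z + y - c)"
      by (rule power2_le_imp_le) simp
    then show ?thesis
      by (simp add: dist_norm)
  qed
  then show ?thesis
    using closest_point_unique[OF assms(2,1,3), of "z + y"] by simp
qed

text \<open>Separating \<open>- x\<close> from \<open>C\<close>, which is possible by pointedness,
  yields a vector \<open>- a\<close> of the polar cone that is strictly negative at
  \<open>x\<close>. The segment from \<open>- a\<close> to \<open>r\<close> can be prolonged beyond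
  \<open>r\<close> inside the polar cone, and this forces \<open>r\<close> to be strictly negative
  at \<open>x\<close> too.\<close>

lemma rel_interior_polar_negative:
  fixes C :: "'a::euclidean_space set"
  assumes C: "closed C" "convex C" "cone C" "C \<inter> uminus ` C = {0}"
    and r: "r \<in> rel_interior (normal_cone C 0)" and x: "x \<in> C" "x \<noteq> 0"
  shows "r \<bullet> x < 0"
proof -
  have "0 \<in> C" "- x \<notin> C"
    using C(4) x by (force simp: set_eq_iff image_iff)+
  then obtain a b where ab: "a \<bullet> (- x) < b" "\<And>c. c \<in> C \<Longrightarrow> a \<bullet> c > b"
    using separating_hyperplane_closed_point[OF C(2,1) \<open>- x \<notin> C\<close>] by blast
  have "b < 0"
    using ab(2)[OF \<open>0 \<in> C\<close>] by simp
  have "a \<bullet> c \<ge> 0" if "c \<in> C" for c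
  proof (rule ccontr)
    assume neg: "\<not> a \<bullet> c \<ge> 0"
    then have "(b / (a \<bullet> c)) *\<^sub>R c \<in> C"
      using \<open>b < 0\<close> C(3) that by (intro mem_cone) (auto simp: divide_nonpos_neg)
    from ab(2)[OF this] neg show False
      by simp
  qed
  then have a: "- a \<in> normal_cone C 0"
    by (simp add: normal_cone_def)
  from convex_rel_interior_if[OF convex_normal_cone r] a obtain m where m: "m > 1"
    "\<And>e. 1 < e \<and> e \<le> m \<Longrightarrow> (1 - e) *\<^sub>R (- a) + e *\<^sub>R r \<in> normal_cone C 0"
    using hull_inc[OF a] by blast
  have "((1 - m) *\<^sub>R (- a) + m *\<^sub>R r) \<bullet> x \<le> 0"
    using m(2)[of m] m(1) x(1) unfolding normal_cone_def by auto
  moreover have "(1 - m) * (- a \<bullet> x) > 0"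
    using m(1) ab(1) \<open>b < 0\<close> by (intro mult_neg_neg) auto
  ultimately have "m * (r \<bullet> x) < 0"
    by (simp add: inner_add_left algebra_simps)
  then show ?thesis
    using m(1) by (simp add: mult_less_0_iff)
qed

text \<open>Along \<open>z + s *\<^sub>R d\<close> the quadratic form is affine in \<open>s\<close>,
  so a negative slope would make it negative on \<open>C\<close>.\<close>

lemma copositive_flat_direction:
  assumes "copositive_on C M" "convex C" "cone C" "z \<in> C" "d \<in> C"
    and "d \<bullet> (M *v d) = 0" "z \<bullet> (M *v d) = 0"
  shows "d \<bullet> (M *v z) \<ge> 0"
proof (rule ccontr)
  assume "\<not> d \<bullet> (M *v z) \<ge> 0"
  then have neg: "d \<bullet> (M *v z) < 0" by simp
  \<comment> \<open>The value of \<open>s\<close> at which the affine function equals -1.\<close>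
  define s where "s = (z \<bullet> (M *v z) + 1) / - (d \<bullet> (M *v z))"
  have "z \<bullet> (M *v z) \<ge> 0"
    using assms unfolding copositive_on_def by blast
  then have "s \<ge> 0"
    using neg unfolding s_def by (intro divide_nonneg_nonneg) auto
  then have "z + s *\<^sub>R d \<in> C"
    using assms by (metis convex_cone mem_cone)
  then have "(z + s *\<^sub>R d) \<bullet> (M *v (z + s *\<^sub>R d)) \<ge> 0"
    using assms unfolding copositive_on_def by blast
  then have "z \<bullet> (M *v z) + s * (d \<bullet> (M *v z)) \<ge> 0"
    using assms(6,7)
    by (simp add: matrix_vector_right_distrib matrix_vector_mult_scaleR inner_add_left
        inner_add_right)
  moreover have "s * (d \<bullet> (M *v z)) = - (z \<bullet> (M *v z) + 1)"
    using neg unfolding s_def by (simp add: field_simps)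
  ultimately show False by linarith
qed

text \<open>Compactness of the unit vectors of \<open>C\<close> bounds \<open>a \<bullet> x\<close>
  from below by a positive multiple of \<open>norm x\<close>; the case split treats a cone without
  unit vectors.\<close>

lemma bounded_slice_of_cone:
  fixes C :: "'a::euclidean_space set"
  assumes "closed C" "cone C" and pos: "\<And>x. x \<in> C \<Longrightarrow> x \<noteq> 0 \<Longrightarrow> a \<bullet> x > 0"
  shows "bounded (C \<inter> {x. a \<bullet> x \<le> k})"
proof (cases "C \<inter> sphere 0 1 = {}")
  case True
  have "C \<subseteq> {0}"
  proof
    fix x assume "x \<in> C"
    then have "(1 / norm x) *\<^sub>R x \<in> C"
      using assms(2) by (simp add: mem_cone)
    moreover have "(1 / norm x) *\<^sub>R x \<in> sphere 0 1" if "x \<noteq> 0"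
      using that by simp
    ultimately show "x \<in> {0}"
      using True by blast
  qed
  then show ?thesis
    using bounded_subset[of "{0}"] by auto
next
  case False
  have "compact (C \<inter> sphere 0 1)"
    using assms(1) by (simp add: closed_Int_compact)
  then obtain x0 where x0: "x0 \<in> C \<inter> sphere 0 1" "\<And>x. x \<in> C \<inter> sphere 0 1 \<Longrightarrow> a \<bullet> x0 \<le> a \<bullet> x"
    using continuous_attains_inf[OF _ False, of "(\<bullet>) a"]
      continuous_on_inner[OF continuous_on_const continuous_on_id]
    by blast
  have m: "a \<bullet> x0 > 0"
    using x0(1) by (intro pos) auto
  have "norm x \<le> k / (a \<bullet> x0)" if "x \<in> C" "a \<bullet> x \<le> k" for x
  proof -
    have "norm x * (a \<bullet> x0) \<le> a \<bullet> x"
    proof (cases "x = 0")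
      case False
      then have "(1 / norm x) *\<^sub>R x \<in> C \<inter> sphere 0 1"
        using assms(2) that by (simp add: mem_cone)
      from x0(2)[OF this] False show ?thesis
        by (simp add: field_simps)
    qed simp
    then show ?thesis
      using that m by (simp add: field_simps)
  qed
  then show ?thesis
    unfolding bounded_iff by blast
qed

text \<open>The theorem of Hartman and Stampacchia: projecting \<open>x - f x\<close> back onto
  \<open>T\<close> has a fixed point by Brouwer, and a fixed point is a solution.\<close>

lemma variational_inequality_compact:
  fixes T :: "'a::euclidean_space set" and f :: "'a \<Rightarrow> 'a"
  assumes "compact T" "convex T" "T \<noteq> {}" "continuous_on T f"
  obtains z where "z \<in> T" "\<And>y. y \<in> T \<Longrightarrow> f z \<bullet> (y - z) \<ge> 0"
proof -
  let ?g = "\<lambda>x. closest_point T (x - f x)"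
  have "closed T"
    using assms(1) by (rule compact_imp_closed)
  have "continuous_on T ?g"
    using continuous_on_compose2[OF continuous_on_closest_point[OF assms(2) \<open>closed T\<close> assms(3)]
        continuous_on_diff[OF continuous_on_id assms(4)], of UNIV] by simp
  moreover have "?g \<in> T \<rightarrow> T"
    using closest_point_in_set[OF \<open>closed T\<close> assms(3)] by auto
  ultimately obtain z where z: "z \<in> T" "?g z = z"
    using brouwer[OF assms(1-3)] by blast
  have "f z \<bullet> (y - z) \<ge> 0" if "y \<in> T" for y
    using closest_point_dot[OF assms(2) \<open>closed T\<close> that, of "z - f z"] z(2) by simp
  with z(1) show ?thesis
    using that by blast
qed

text \<open>\<open>t\<close> is the Lagrange multiplier of the extra constraint
  \<open>a \<bullet> x \<le> k\<close> for a solution on the slice; if it vanished, that solution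
  would be valid on all of \<open>C\<close>.\<close>

lemma AVI_solution_or_ray_point:
  assumes "closed C" "convex C" "cone C" "0 \<in> C"
    and pos: "\<And>x. x \<in> C \<Longrightarrow> x \<noteq> 0 \<Longrightarrow> a \<bullet> x > 0"
    and nosol: "\<nexists>z. solves_AVI C q M z" and k: "k > 0"
  obtains z t where "z \<in> C" "a \<bullet> z = k" "t > 0" "(M *v z + q + t *\<^sub>R a) \<bullet> z = 0"
    "\<And>x. x \<in> C \<Longrightarrow> (M *v z + q + t *\<^sub>R a) \<bullet> x \<ge> 0"
proof -
  let ?T = "C \<inter> {x. a \<bullet> x \<le> k}"
  have "compact ?T"
    using assms(1) bounded_slice_of_cone[OF assms(1,3) pos, of k]
    by (simp add: compact_eq_bounded_closed closed_Int closed_halfspace_le)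
  moreover have "convex ?T" "0 \<in> ?T"
    using assms by (auto simp: convex_Int convex_halfspace_le)
  moreover have "continuous_on ?T (\<lambda>x. M *v x + q)"
    by (intro continuous_intros)
  ultimately obtain z where z: "z \<in> ?T" "\<And>y. y \<in> ?T \<Longrightarrow> (M *v z + q) \<bullet> (y - z) \<ge> 0"
    using variational_inequality_compact[of ?T "\<lambda>x. M *v x + q"] by blast
  define y where "y = M *v z + q"
  have yz: "y \<bullet> z \<le> 0"
    using z(2)[OF \<open>0 \<in> ?T\<close>] unfolding y_def by simp
  have inC: "c *\<^sub>R x \<in> C" if "x \<in> C" "c \<ge> 0" for x c
    using assms(3) that by (simp add: mem_cone)
  have scaled: "y \<bullet> (s *\<^sub>R x) \<ge> y \<bullet> z" if "x \<in> C" "s \<ge> 0" "s * (a \<bullet> x) \<le> k" for x s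
    using z(2)[of "s *\<^sub>R x"] that inC unfolding y_def by (simp add: inner_diff_right)
  define t where "t = - (y \<bullet> z) / k"
  have "t \<ge> 0"
    using yz k unfolding t_def by (simp add: divide_nonpos_pos)
  \<comment> \<open>The ray through \<open>x\<close> is cut at the hyperplane where \<open>a\<close>
    takes the value \<open>k\<close>; there the inequality on the slice applies.\<close>
  have nonneg: "(y + t *\<^sub>R a) \<bullet> x \<ge> 0" if "x \<in> C" for x
  proof (cases "x = 0")
    case False
    define s where "s = k / (a \<bullet> x)"
    have ax: "a \<bullet> x > 0" using pos that False by blast
    then have s: "s > 0" "s * (a \<bullet> x) = k"
      unfolding s_def using k by auto
    have "s * (y \<bullet> x) \<ge> y \<bullet> z"
      using scaled[OF that, of s] s by simp
    moreover have "y \<bullet> z = - t * (s * (a \<bullet> x))"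
      using k unfolding t_def s(2) by simp
    ultimately have "s * (y \<bullet> x + t * (a \<bullet> x)) \<ge> 0"
      by (simp add: algebra_simps)
    then show ?thesis
      using s(1) by (simp add: inner_add_left zero_le_mult_iff)
  qed simp
  have "t \<noteq> 0"
  proof
    assume "t = 0"
    then have "y \<bullet> z = 0" using k unfolding t_def by simp
    then have "solves_AVI C q M z"
      using z(1) nonneg \<open>t = 0\<close> unfolding solves_AVI_def y_def by (auto simp: inner_diff_right)
    then show False using nosol by blast
  qed
  \<comment> \<open>If the constraint were slack, \<open>z\<close> could be scaled up to the
    hyperplane, which strictly lowers the negative number \<open>y \<bullet> z\<close>.\<close>
  have az: "a \<bullet> z = k"
  proof (rule ccontr)
    assume "a \<bullet> z \<noteq> k"
    then have az: "a \<bullet> z < k" using z(1) by simp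
    have "y \<bullet> z \<noteq> 0" using \<open>t \<noteq> 0\<close> unfolding t_def by auto
    with yz have neg: "y \<bullet> z < 0" by simp
    then have "z \<noteq> 0" by auto
    then have "a \<bullet> z > 0" using pos z(1) by blast
    then have "y \<bullet> ((k / (a \<bullet> z)) *\<^sub>R z) \<ge> y \<bullet> z"
      using z(1) k by (intro scaled) auto
    moreover have "k / (a \<bullet> z) > 1"
      using az \<open>a \<bullet> z > 0\<close> by simp
    then have "k / (a \<bullet> z) * (y \<bullet> z) < 1 * (y \<bullet> z)"
      using neg by (rule mult_strict_right_mono_neg)
    ultimately show False
      by simp
  qed
  have "(y + t *\<^sub>R a) \<bullet> z = 0"
    using k az unfolding t_def by (simp add: inner_add_left inner_diff_left)
  then show ?thesis
    using that[of z t] z(1) az \<open>t \<ge> 0\<close> \<open>t \<noteq> 0\<close> nonneg unfolding y_def by auto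
qed

lemma AVI_solution_exists:
  fixes C :: "(real^'n) set"
  assumes poly: "polyhedron C" and C: "closed C" "convex C" "cone C" "0 \<in> C"
    and pos: "\<And>x. x \<in> C \<Longrightarrow> x \<noteq> 0 \<Longrightarrow> a \<bullet> x > 0"
    and cop: "copositive_on C M"
    and imp: "\<And>z. z \<in> C \<Longrightarrow> M *v z \<in> dual_cone C \<Longrightarrow> z \<bullet> (M *v z) = 0 \<Longrightarrow> z \<bullet> q \<ge> 0"
  shows "\<exists>z. solves_AVI C q M z"
proof (rule ccontr)
  assume nosol: "\<nexists>z. solves_AVI C q M z"
  let ?y = "\<lambda>z t. M *v z + q + t *\<^sub>R a"
  have "\<exists>z t. z \<in> C \<and> a \<bullet> z = real (Suc n) \<and> t > 0 \<and> ?y z t \<bullet> z = 0 \<and>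
      (\<forall>x\<in>C. ?y z t \<bullet> x \<ge> 0)" for n
    using AVI_solution_or_ray_point[OF C pos nosol, of "real (Suc n)"]
    by (metis of_nat_0_less_iff zero_less_Suc)
  then obtain z t where zt: "\<And>n. z n \<in> C" "\<And>n. a \<bullet> z n = real (Suc n)" "\<And>n. t n > 0"
      "\<And>n. ?y (z n) (t n) \<bullet> z n = 0" "\<And>n x. x \<in> C \<Longrightarrow> ?y (z n) (t n) \<bullet> x \<ge> 0"
    by metis
  \<comment> \<open>\<open>F n\<close> is the face of \<open>C\<close> on which the n-th dual vector
    vanishes. There are finitely many faces, so infinitely many indices share one, and points of
    different slices become complementary to each other's dual vectors.\<close>
  define F where "F n = C \<inter> {x. ?y (z n) (t n) \<bullet> x = 0}" for n
  have "range F \<subseteq> {F. F face_of C}"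
    using zt(5) C(2) unfolding F_def by (auto intro!: face_of_Int_supporting_hyperplane_ge)
  then have "finite (range F)"
    using finite_polyhedron_faces[OF poly] finite_subset by blast
  then obtain n0 where "infinite {n. F n = F n0}"
    using pigeonhole_infinite[of UNIV F] by auto
  from infinite_enumerate[OF this] obtain \<phi> :: "nat \<Rightarrow> nat"
    where "strict_mono \<phi> \<and> (\<forall>n. \<phi> n \<in> {n. F n = F n0})" ..
  then have \<phi>: "strict_mono \<phi>" "\<And>n. F (\<phi> n) = F n0"
    by auto
  define w where "w n = (1 / real (Suc (\<phi> n))) *\<^sub>R z (\<phi> n)" for n
  have wC: "w n \<in> C" and aw: "a \<bullet> w n = 1" for n
    using C(3) zt(1)[of "\<phi> n"] zt(2)[of "\<phi> n"] unfolding w_def by (simp_all add: mem_cone)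
  have "compact (C \<inter> {x. a \<bullet> x \<le> 1})"
    using C(1) bounded_slice_of_cone[OF C(1,3) pos, of 1]
    by (simp add: compact_eq_bounded_closed closed_Int closed_halfspace_le)
  moreover have "\<forall>n. w n \<in> C \<inter> {x. a \<bullet> x \<le> 1}"
    using wC aw by simp
  ultimately obtain d \<psi> where \<psi>: "d \<in> C" "strict_mono \<psi>" "(w \<circ> \<psi>) \<longlonglongrightarrow> d"
    unfolding compact_eq_seq_compact_metric seq_compact_def by blast
  define k where "k n = real (Suc (\<phi> (\<psi> n)))" for n
  define \<tau> where "\<tau> n = t (\<phi> (\<psi> n))" for n
  define v where "v n = w (\<psi> n)" for n
  have k0: "k n > 0" for n unfolding k_def by simp
  have v: "v \<longlonglongrightarrow> d" "\<And>n. a \<bullet> v n = 1" "\<And>n. z (\<phi> (\<psi> n)) = k n *\<^sub>R v n"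
    using \<psi>(3) unfolding v_def o_def aw by (simp_all add: w_def k_def del: of_nat_Suc)
  have "filterlim k at_top sequentially"
    unfolding k_def using \<phi>(1) \<psi>(2)
    by (intro filterlim_compose[OF filterlim_real_sequentially]
        filterlim_compose[OF filterlim_Suc] filterlim_compose[OF filterlim_subseq[of \<phi>]]
        filterlim_subseq)
  then have ik: "(\<lambda>n. 1 / k n) \<longlonglongrightarrow> 0"
    by (intro tendsto_divide_0[OF tendsto_const] filterlim_at_top_imp_at_infinity)
  have ad: "a \<bullet> d = 1"
    using tendsto_inner[OF tendsto_const v(1), of a] v(2) by (simp add: LIMSEQ_const_iff)
  have Mv: "(\<lambda>n. M *v v n) \<longlonglongrightarrow> M *v d"
    using matrix_vector_mul_bounded_linear[of M] v(1) by (rule bounded_linear.tendsto)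
  \<comment> \<open>Complementarity at the n-th point, divided by the square of
    \<open>k n\<close>.\<close>
  have \<tau>: "\<tau> n / k n = - (v n \<bullet> (M *v v n)) - (1 / k n) * (q \<bullet> v n)" for n
  proof -
    have "k n * (k n * (v n \<bullet> (M *v v n)) + q \<bullet> v n + \<tau> n) = 0"
      using zt(4)[of "\<phi> (\<psi> n)"] v(2)[of n] unfolding v(3) \<tau>_def
      by (simp add: inner_add_left matrix_vector_mult_scaleR algebra_simps inner_commute)
    then have "\<tau> n = - k n * (v n \<bullet> (M *v v n)) - q \<bullet> v n"
      using k0[of n] by simp
    then show ?thesis
      using k0[of n] by (simp add: field_simps)
  qed
  have "(\<lambda>n. - (v n \<bullet> (M *v v n)) - (1 / k n) * (q \<bullet> v n)) \<longlonglongrightarrow> - (d \<bullet> (M *v d)) - 0 * (q \<bullet> d)"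
    by (intro tendsto_intros v(1) Mv ik)
  then have \<tau>_lim: "(\<lambda>n. \<tau> n / k n) \<longlonglongrightarrow> - (d \<bullet> (M *v d))"
    using \<tau> by simp
  \<comment> \<open>These nonnegative ratios tend to minus the copositive form at \<open>d\<close>,
    so both limits are zero.\<close>
  have "\<tau> n / k n \<ge> 0" for n
    using zt(3)[of "\<phi> (\<psi> n)"] k0[of n] unfolding \<tau>_def by simp
  then have "- (d \<bullet> (M *v d)) \<ge> 0"
    using \<tau>_lim by (meson LIMSEQ_le_const)
  moreover have "d \<bullet> (M *v d) \<ge> 0"
    using cop \<psi>(1) unfolding copositive_on_def by blast
  ultimately have dMd: "d \<bullet> (M *v d) = 0" by simp
  have lim: "(\<lambda>n. (1 / k n) * (?y (z (\<phi> (\<psi> n))) (\<tau> n) \<bullet> x)) \<longlonglongrightarrow> (M *v d) \<bullet> x" for x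
  proof -
    have "(\<lambda>n. (M *v v n) \<bullet> x + (1 / k n) * (q \<bullet> x) + (\<tau> n / k n) * (a \<bullet> x))
        \<longlonglongrightarrow> (M *v d) \<bullet> x + 0 * (q \<bullet> x) + - (d \<bullet> (M *v d)) * (a \<bullet> x)"
      by (intro tendsto_intros Mv ik \<tau>_lim)
    moreover have "(1 / k n) * (?y (z (\<phi> (\<psi> n))) (\<tau> n) \<bullet> x)
        = (M *v v n) \<bullet> x + (1 / k n) * (q \<bullet> x) + (\<tau> n / k n) * (a \<bullet> x)" for n
      using k0[of n] unfolding v(3)
      by (simp add: inner_add_left matrix_vector_mult_scaleR field_simps)
    ultimately show ?thesis
      using dMd by simp
  qed
  have "M *v d \<in> dual_cone C"
  proof -
    have "(M *v d) \<bullet> x \<ge> 0" if "x \<in> C" for x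
      using zt(5)[OF that] k0 unfolding \<tau>_def
      by (intro LIMSEQ_le_const[OF lim]) (auto simp: \<tau>_def less_imp_le)
    then show ?thesis
      unfolding dual_cone_def by blast
  qed
  with imp \<psi>(1) dMd have dq: "d \<bullet> q \<ge> 0" by blast
  \<comment> \<open>The common face is used in two directions: later dual vectors vanish at
    \<open>z n0\<close>, which after division by \<open>k n\<close> concerns \<open>M *v d\<close>,
    and the dual vector of \<open>z n0\<close> vanishes at the later points, hence at
    \<open>d\<close>.\<close>
  have mem: "z (\<phi> n) \<in> F n0" for n
  proof -
    have "z (\<phi> n) \<in> F (\<phi> n)"
      using zt(1,4) unfolding F_def by simp
    then show ?thesis
      by (simp only: \<phi>(2))
  qed
  have "z n0 \<in> F n0"
    using zt(1,4) unfolding F_def by simp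
  then have "z n0 \<in> F (\<phi> (\<psi> n))" for n
    by (simp only: \<phi>(2))
  then have "?y (z (\<phi> (\<psi> n))) (\<tau> n) \<bullet> z n0 = 0" for n
    unfolding F_def \<tau>_def by simp
  with lim[of "z n0"] have "(M *v d) \<bullet> z n0 = 0"
    by (simp add: LIMSEQ_const_iff)
  then have zMd: "z n0 \<bullet> (M *v d) = 0"
    by (simp add: inner_commute)
  have "?y (z n0) (t n0) \<bullet> v n = 0" for n
    using mem[of "\<psi> n"] unfolding v_def w_def F_def by simp
  with tendsto_inner[OF tendsto_const v(1), of "?y (z n0) (t n0)"]
  have "?y (z n0) (t n0) \<bullet> d = 0"
    by (simp add: LIMSEQ_const_iff)
  then have "d \<bullet> (M *v z n0) + d \<bullet> q + t n0 * (a \<bullet> d) = 0"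
    by (simp add: inner_add_left inner_commute[of d])
  then have "d \<bullet> (M *v z n0) < 0"
    using dq zt(3)[of n0] ad by simp
  moreover have "d \<bullet> (M *v z n0) \<ge> 0"
    using copositive_flat_direction[OF cop C(2,3) zt(1) \<psi>(1) dMd zMd] .
  ultimately show False by simp
qed

section \<open>Finitely generated cones\<close>

text \<open>The reduction step of Caratheodory's theorem for cones: a dependency with some positive
  coefficient is subtracted with the smallest ratio \<open>c d / w d\<close>, which keeps all
  coefficients nonnegative and makes one vanish.\<close>

lemma nonneg_sum_reduce_dependent:
  fixes D :: "'a::real_vector set"
  assumes D: "finite D" "dependent D" and c: "\<And>d. d \<in> D \<Longrightarrow> c d \<ge> 0"
  shows "\<exists>d0\<in>D. \<exists>c'. (\<forall>d\<in>D - {d0}. c' d \<ge> 0) \<and> (\<Sum>d\<in>D. c d *\<^sub>R d) = (\<Sum>d\<in>D - {d0}. c' d *\<^sub>R d)"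
proof -
  obtain u v where u: "v \<in> D" "u v \<noteq> 0" "(\<Sum>d\<in>D. u d *\<^sub>R d) = 0"
    using D unfolding dependent_finite[OF D(1)] by blast
  obtain w v where w: "v \<in> D" "w v > 0" "(\<Sum>d\<in>D. w d *\<^sub>R d) = 0"
  proof (cases "u v > 0")
    case False
    then show ?thesis
      using that[of v "\<lambda>d. - u d"] u by (simp add: sum_negf)
  qed (use that[of v u] u in blast)
  define P where "P = {d \<in> D. w d > 0}"
  have "finite P" "P \<noteq> {}" using D(1) w unfolding P_def by auto
  then obtain d0 where d0: "d0 \<in> P" "\<And>d. d \<in> P \<Longrightarrow> c d0 / w d0 \<le> c d / w d"
    using arg_min_if_finite(1,2)[of P "\<lambda>d. c d / w d"] by (metis not_less)
  define k where "k = c d0 / w d0"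
  define c' where "c' d = c d - k * w d" for d
  have "k \<ge> 0" using d0(1) c unfolding k_def P_def by auto
  have "c' d \<ge> 0" if "d \<in> D" for d
  proof (cases "w d > 0")
    case True
    then have "k \<le> c d / w d" using d0(2) that unfolding k_def P_def by blast
    then show ?thesis using True unfolding c'_def by (simp add: field_simps)
  next
    case False
    then have "k * w d \<le> 0" using \<open>k \<ge> 0\<close> by (simp add: mult_nonneg_nonpos)
    then show ?thesis using c[OF that] unfolding c'_def by linarith
  qed
  moreover have "c' d0 = 0" using d0(1) unfolding c'_def k_def P_def by simp
  moreover have "(\<Sum>d\<in>D. c d *\<^sub>R d) = (\<Sum>d\<in>D. c' d *\<^sub>R d)"
  proof -
    have "(\<Sum>d\<in>D. c' d *\<^sub>R d) = (\<Sum>d\<in>D. c d *\<^sub>R d) - k *\<^sub>R (\<Sum>d\<in>D. w d *\<^sub>R d)"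
      unfolding c'_def by (simp add: scaleR_diff_left sum_subtractf scaleR_sum_right)
    then show ?thesis using w(3) by simp
  qed
  moreover have "(\<Sum>d\<in>D. c' d *\<^sub>R d) = (\<Sum>d\<in>D - {d0}. c' d *\<^sub>R d)"
    using \<open>c' d0 = 0\<close> D(1) by (intro sum.mono_neutral_right) auto
  ultimately show ?thesis
    using d0(1) unfolding P_def by (intro bexI[of _ d0] exI[of _ c']) auto
qed

lemma convex_cone_hull_finite_sum:
  fixes G :: "'a::real_vector set"
  assumes "finite G" "y \<in> convex_cone hull G"
  shows "\<exists>c. (\<forall>d\<in>G. c d \<ge> 0) \<and> y = (\<Sum>d\<in>G. c d *\<^sub>R d)"
proof -
  let ?S = "{y. \<exists>c. (\<forall>d\<in>G. c d \<ge> 0) \<and> y = (\<Sum>d\<in>G. c d *\<^sub>R d)}"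
  have "G \<subseteq> ?S"
  proof
    fix g assume g: "g \<in> G"
    have "(\<Sum>d\<in>G. (if d = g then 1 else 0) *\<^sub>R d) = (\<Sum>d\<in>G. if d = g then d else 0)"
      by (intro sum.cong) auto
    also have "\<dots> = g" using g assms(1) by simp
    finally show "g \<in> ?S" by (intro CollectI exI[of _ "\<lambda>d. if d = g then 1 else 0"]) auto
  qed
  moreover have "convex_cone ?S"
    unfolding convex_cone_iff
  proof (intro conjI ballI allI impI)
    show "0 \<in> ?S" by (intro CollectI exI[of _ "\<lambda>_. 0"]) simp
    fix x y assume "x \<in> ?S" "y \<in> ?S"
    then obtain c c' where "\<forall>d\<in>G. c d \<ge> 0" "x = (\<Sum>d\<in>G. c d *\<^sub>R d)" "\<forall>d\<in>G. c' d \<ge> 0" "y = (\<Sum>d\<in>G. c' d *\<^sub>R d)"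
      by blast
    then show "x + y \<in> ?S"
      by (intro CollectI exI[of _ "\<lambda>d. c d + c' d"]) (simp add: scaleR_add_left sum.distrib)
  next
    fix x and k :: real assume "x \<in> ?S" "0 \<le> k"
    then obtain c where "\<forall>d\<in>G. c d \<ge> 0" "x = (\<Sum>d\<in>G. c d *\<^sub>R d)" by blast
    then show "k *\<^sub>R x \<in> ?S"
      using \<open>0 \<le> k\<close> by (intro CollectI exI[of _ "\<lambda>d. k * c d"]) (simp add: scaleR_sum_right)
  qed
  ultimately have "convex_cone hull G \<subseteq> ?S" by (rule hull_minimal)
  then show ?thesis using assms(2) by blast
qed

lemma convex_cone_hull_caratheodory:
  fixes G :: "'a::real_vector set"
  assumes "finite G" "y \<in> convex_cone hull G"
  shows "\<exists>D c. D \<subseteq> G \<and> independent D \<and> (\<forall>d\<in>D. c d \<ge> 0) \<and> y = (\<Sum>d\<in>D. c d *\<^sub>R d)"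
proof -
  have "\<exists>D'\<subseteq>D. \<exists>c'. independent D' \<and> (\<forall>d\<in>D'. c' d \<ge> 0) \<and> (\<Sum>d\<in>D. c d *\<^sub>R d) = (\<Sum>d\<in>D'. c' d *\<^sub>R d)"
    if "finite D" "\<forall>d\<in>D. c d \<ge> 0" for D :: "'a set" and c
    using that
  proof (induction "card D" arbitrary: D c rule: less_induct)
    case less
    show ?case
    proof (cases "independent D")
      case False
      then obtain d0 c' where d0: "d0 \<in> D" "\<forall>d\<in>D - {d0}. c' d \<ge> 0"
        "(\<Sum>d\<in>D. c d *\<^sub>R d) = (\<Sum>d\<in>D - {d0}. c' d *\<^sub>R d)"
        using nonneg_sum_reduce_dependent[OF less.prems(1), of c] less.prems(2) by blast
      have "card (D - {d0}) < card D"
        using less.prems(1) d0(1) by (rule card_Diff1_less)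
      from less.hyps[OF this _ d0(2)] less.prems(1) show ?thesis
        unfolding d0(3) by blast
    qed (use less.prems in blast)
  qed
  then show ?thesis
    using convex_cone_hull_finite_sum[OF assms] assms(1) by metis
qed

section \<open>Polyhedral representations of proper cones\<close>

text \<open>Horner form of the perturbation of the right-hand side. Compared with
  \<open>lexpoly\<close> there is one more factor \<epsilon>, because the head of
  \<open>lexval\<close> is the unperturbed value.\<close>

primrec perturbation :: "'a::real_vector list \<Rightarrow> real \<Rightarrow> 'a" where
  "perturbation [] \<epsilon> = 0"
| "perturbation (p # ps) \<epsilon> = \<epsilon> *\<^sub>R (p + perturbation ps \<epsilon>)"

lemma UNIV_var:
  "(UNIV :: ('n, 'm) var set) = range Zvar \<union> range Wvar \<union> range Vvar \<union> range Svar \<union> range Lvar \<union> {Tvar}"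
proof -
  have "x \<in> range Zvar \<union> range Wvar \<union> range Vvar \<union> range Svar \<union> range Lvar \<union> {Tvar}" for x :: "('n, 'm) var"
    by (cases x) auto
  then show ?thesis by blast
qed

lemma finite_UNIV_var: "finite (UNIV :: ('n::finite, 'm::finite) var set)"
  unfolding UNIV_var by simp

lemma sum_var:
  fixes f :: "('n::finite, 'm::finite) var \<Rightarrow> 'a::comm_monoid_add"
  shows "sum f UNIV = (\<Sum>j\<in>UNIV. f (Zvar j)) + (\<Sum>j\<in>UNIV. f (Wvar j)) + (\<Sum>j\<in>UNIV. f (Vvar j))
    + (\<Sum>i\<in>UNIV. f (Svar i)) + (\<Sum>i\<in>UNIV. f (Lvar i)) + f Tvar"
proof -
  have "sum f (range g) = (\<Sum>j\<in>UNIV. f (g j))" if "inj g" for g :: "'k::finite \<Rightarrow> ('n, 'm) var"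
    using that by (simp add: sum.reindex o_def)
  then have "sum f (range Zvar) = (\<Sum>j\<in>UNIV. f (Zvar j))" "sum f (range Wvar) = (\<Sum>j\<in>UNIV. f (Wvar j))"
    "sum f (range Vvar) = (\<Sum>j\<in>UNIV. f (Vvar j))" "sum f (range Svar) = (\<Sum>i\<in>UNIV. f (Svar i))"
    "sum f (range Lvar) = (\<Sum>i\<in>UNIV. f (Lvar i))"
    by (simp_all add: sum.reindex inj_def)
  then show ?thesis
    unfolding UNIV_var by (subst sum.union_disjoint; auto)+
qed

lemma card_Int_two:
  "a \<noteq> b \<Longrightarrow> card (S \<inter> {a, b}) = 1 \<longleftrightarrow> (a \<in> S \<longleftrightarrow> b \<notin> S)"
  by (cases "a \<in> S"; cases "b \<in> S") (simp_all add: Int_insert_right)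

lemma card_Int_three:
  "a \<noteq> b \<Longrightarrow> a \<noteq> c \<Longrightarrow> b \<noteq> c \<Longrightarrow> card (S \<inter> {a, b, c}) = 1 \<longleftrightarrow>
    a \<in> S \<and> b \<notin> S \<and> c \<notin> S \<or> a \<notin> S \<and> b \<in> S \<and> c \<notin> S \<or> a \<notin> S \<and> b \<notin> S \<and> c \<in> S"
  by (cases "a \<in> S"; cases "b \<in> S"; cases "c \<in> S") (simp_all add: Int_insert_right)

text \<open>The normal cone is taken at 0 because 0 is the only extreme point of a pointed cone,
  hence the only vertex at which the method can start.\<close>

locale pathavi_cone = pathavi M q R A b K l u r
  for M :: "real^'n^'n" and q :: "real^'n" and R :: "'m::finite set" and A :: "real^'n^'m"
    and b :: "real^'m" and K :: "'m \<Rightarrow> factor" and l u :: "'n \<Rightarrow> ereal" and r :: "real^'n" +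
  fixes C :: "(real^'n) set"
  assumes rep: "representation_of C R A b K l u"
    and proper: "proper_cone C"
    and r: "r \<in> rel_interior (normal_cone C 0)"
begin

lemma row_zero: "i \<notin> R \<Longrightarrow> row i A = 0" and b_zero: "i \<notin> R \<Longrightarrow> b $ i = 0"
  and row_nonzero: "i \<in> R \<Longrightarrow> row i A \<noteq> 0"
  using rep unfolding representation_of_def by auto

lemma A_nth: "(A *v z) $ i = row i A \<bullet> z"
  by (simp add: matrix_vector_mul_component row_def vec_eq_iff inner_vec_def)

lemma mem_C: "z \<in> C \<longleftrightarrow> (\<forall>i\<in>R. (A *v z - b) $ i \<in> factor_set (K i)) \<and>
    (\<forall>j. l j \<le> ereal (z $ j) \<and> ereal (z $ j) \<le> u j)"
  using rep unfolding representation_of_def by blast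

lemma C_closed: "closed C" and C_convex: "convex C" and C_cone: "cone C"
  and C_pointed: "C \<inter> uminus ` C = {0}" and C_interior: "interior C \<noteq> {}"
  using proper unfolding proper_cone_def by auto

lemma zero_in_C: "0 \<in> C"
  using C_pointed by blast

lemma r_negative: "x \<in> C \<Longrightarrow> x \<noteq> 0 \<Longrightarrow> r \<bullet> x < 0"
  using rel_interior_polar_negative[OF C_closed C_convex C_cone C_pointed r] .

lemma l_le: "l j \<le> 0" and u_ge: "u j \<ge> 0"
  using zero_in_C unfolding mem_C by (auto simp: zero_ereal_def)

lemma l_not_inf: "l j \<noteq> \<infinity>" and u_not_inf: "u j \<noteq> -\<infinity>"
  using l_le[of j] u_ge[of j] by auto

text \<open>Every constraint is a nonzero linear functional, so inside a small ball it changes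
  strictly in both senses along its own gradient. Hence no genuine row has factor
  \<open>Rzero\<close> and no two bounds coincide, which removes equality constraints from all later
  case distinctions.\<close>

lemma interior_point:
  obtains z0 where "z0 \<in> C"
    "\<And>i. i \<in> R \<Longrightarrow> lo (Svar i) < ereal ((A *v z0 - b) $ i) \<and>
      ereal ((A *v z0 - b) $ i) < hi (Svar i)"
    "\<And>j. l j < ereal (z0 $ j) \<and> ereal (z0 $ j) < u j"
proof -
  obtain z0 e where e: "e > 0" "cball z0 e \<subseteq> C"
    using C_interior mem_interior_cball[of _ C] by (metis ex_in_conv)
  have mem: "z0 + s *\<^sub>R d \<in> C" if "\<bar>s\<bar> * norm d \<le> e" for s d
    using e(2) that by (auto simp: dist_norm subset_iff)
  have bnd: "lo (Svar i) < ereal ((A *v z0 - b) $ i) \<and>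
      ereal ((A *v z0 - b) $ i) < hi (Svar i)" if i: "i \<in> R" for i
  proof -
    let ?a = "row i A"
    define s where "s = e / norm ?a"
    have n: "norm ?a > 0" using row_nonzero[OF i] by simp
    then have s: "s > 0" "\<bar>s\<bar> * norm ?a \<le> e" "\<bar>- s\<bar> * norm ?a \<le> e"
      using e(1) unfolding s_def by auto
    have "(A *v (z0 + t *\<^sub>R ?a) - b) $ i = (A *v z0 - b) $ i + t * (?a \<bullet> ?a)" for t
      by (simp add: A_nth inner_add_right)
    then have "(A *v z0 - b) $ i + t * (?a \<bullet> ?a) \<in> factor_set (K i)" if "\<bar>t\<bar> * norm ?a \<le> e" for t
      using mem[OF that] i unfolding mem_C by metis
    from this[OF s(2)] this[OF s(3)]
    have "(A *v z0 - b) $ i + s * (?a \<bullet> ?a) \<in> factor_set (K i)"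
        "(A *v z0 - b) $ i - s * (?a \<bullet> ?a) \<in> factor_set (K i)"
      by auto
    moreover have "s * (?a \<bullet> ?a) > 0"
      using s(1) n by simp
    ultimately show ?thesis
      by (cases "K i") (auto simp: zero_ereal_def)
  qed
  moreover have "l j < ereal (z0 $ j) \<and> ereal (z0 $ j) < u j" for j
  proof -
    have "l j \<le> ereal (z0 $ j - e)" "ereal (z0 $ j + e) \<le> u j"
      using mem[of "-e" "axis j 1"] mem[of e "axis j 1"] e(1) unfolding mem_C
      by (auto simp: norm_axis_1 dest!: spec[of _ j])
    moreover have "ereal (z0 $ j - e) < ereal (z0 $ j)" "ereal (z0 $ j) < ereal (z0 $ j + e)"
      using e(1) by simp_all
    ultimately show ?thesis
      by (meson le_less_trans less_le_trans)
  qed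
  moreover have "z0 \<in> C"
    using e by auto
  ultimately show ?thesis
    using that by blast
qed

lemma K_not_Rzero: "i \<in> R \<Longrightarrow> K i \<noteq> Rzero"
  by (rule interior_point) (force simp: zero_ereal_def)

lemma l_less_u: "l j < u j"
  by (rule interior_point) (meson less_trans)

section \<open>Bases and solutions of the linear system\<close>

definition system :: "(('n, 'm) var \<Rightarrow> real) \<Rightarrow> (real^'n) \<times> (real^'m)" where
  "system X = (\<Sum>x\<in>vars. X x *\<^sub>R col x)"

abbreviation zvec :: "(('n, 'm) var \<Rightarrow> real) \<Rightarrow> real^'n" where
  "zvec X \<equiv> \<chi> j. X (Zvar j)"

abbreviation svec :: "(('n, 'm) var \<Rightarrow> real) \<Rightarrow> real^'m" where
  "svec X \<equiv> \<chi> i. X (Svar i)"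

text \<open>This is \<open>z - x\<close> for the point \<open>x\<close> of the manifold; at a
  complementary solution it is the negative of a normal vector at \<open>z\<close>.\<close>

definition multiplier :: "(('n, 'm) var \<Rightarrow> real) \<Rightarrow> real^'n" where
  "multiplier X = transpose A *v (\<chi> i. X (Lvar i)) + (\<chi> j. X (Wvar j)) - (\<chi> j. X (Vvar j))"

lemma finite_vars: "finite (B :: ('n, 'm) var set)"
  by (rule finite_subset[OF subset_UNIV finite_UNIV_var])

lemma system_eq:
  assumes "\<And>x. x \<notin> vars \<Longrightarrow> X x = 0"
  shows "system X = (M *v zvec X - multiplier X - X Tvar *\<^sub>R r, A *v zvec X - svec X)"
proof -
  have "system X = (\<Sum>x\<in>UNIV. X x *\<^sub>R col x)"
    unfolding system_def using assms by (intro sum.mono_neutral_left finite_vars) auto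
  moreover have "(\<Sum>j\<in>UNIV. X (Zvar j) *\<^sub>R col (Zvar j)) = (M *v zvec X, A *v zvec X)"
    by (simp add: matrix_mult_sum scalar_mult_eq_scaleR prod_eq_iff fst_sum snd_sum)
  moreover have axis_sum: "(\<Sum>j\<in>UNIV. f j *\<^sub>R axis j 1) = (\<chi> j. f j)" for f :: "'k::finite \<Rightarrow> real"
    using basis_expansion[of "\<chi> j. f j"] by (simp add: scalar_mult_eq_scaleR)
  then have "(\<Sum>j\<in>UNIV. X (Wvar j) *\<^sub>R col (Wvar j)) = (- (\<chi> j. X (Wvar j)), 0)"
    "(\<Sum>j\<in>UNIV. X (Vvar j) *\<^sub>R col (Vvar j)) = (\<chi> j. X (Vvar j), 0)"
    "(\<Sum>i\<in>UNIV. X (Svar i) *\<^sub>R col (Svar i)) = (0, - svec X)"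
    by (simp_all add: prod_eq_iff fst_sum snd_sum sum_negf)
  moreover have "(\<Sum>i\<in>UNIV. X (Lvar i) *\<^sub>R col (Lvar i)) = (- (transpose A *v (\<chi> i. X (Lvar i))), 0)"
    by (simp add: prod_eq_iff fst_sum snd_sum sum_negf matrix_mult_sum scalar_mult_eq_scaleR)
  ultimately show ?thesis
    unfolding sum_var multiplier_def by simp
qed

text \<open>Passing to this subspace discards the padding rows, so that
  \<open>CARD('n) + card R\<close> independent columns span it.\<close>

definition equation_space :: "((real^'n) \<times> (real^'m)) set" where
  "equation_space = {y. \<forall>i. i \<notin> R \<longrightarrow> snd y $ i = 0}"

lemma subspace_equation_space: "subspace equation_space"
  unfolding subspace_def equation_space_def by auto

lemma col_in_equation_space: "x \<in> vars \<Longrightarrow> col x \<in> equation_space"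
proof (cases x)
  case (Zvar j)
  have "column j A $ i = 0" if "i \<notin> R" for i
    using row_zero[OF that] by (simp add: column_def row_def vec_eq_iff)
  then show ?thesis
    using Zvar by (simp add: equation_space_def)
qed (auto simp: equation_space_def vars_def axis_def)

lemma rhs_in_equation_space: "rhs \<in> equation_space"
  unfolding rhs_def equation_space_def using b_zero by simp

lemma dim_equation_space: "dim equation_space \<le> CARD('n) + card R"
proof -
  define W where "W = range (\<lambda>j. (axis j 1 :: real^'n, 0 :: real^'m)) \<union> (\<lambda>i. (0, axis i 1)) ` R"
  have axis_sum: "(\<Sum>j\<in>UNIV. (v $ j) *\<^sub>R axis j 1) = v" for v :: "real^'k::finite"
    using basis_expansion[of v] by (simp add: scalar_mult_eq_scaleR)
  have "equation_space \<subseteq> span W"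
  proof
    fix y assume y: "y \<in> equation_space"
    have "snd y = (\<Sum>i\<in>UNIV. (snd y $ i) *\<^sub>R axis i 1)"
      by (simp add: axis_sum)
    also have "\<dots> = (\<Sum>i\<in>R. (snd y $ i) *\<^sub>R axis i 1)"
      using y unfolding equation_space_def by (intro sum.mono_neutral_right) auto
    finally have "y = (\<Sum>j\<in>UNIV. (fst y $ j) *\<^sub>R (axis j 1, 0)) + (\<Sum>i\<in>R. (snd y $ i) *\<^sub>R (0, axis i 1))"
      by (simp add: prod_eq_iff fst_sum snd_sum axis_sum)
    also have "\<dots> \<in> span W"
      unfolding W_def by (intro span_add span_sum span_scale span_base) auto
    finally show "y \<in> span W" .
  qed
  moreover have "finite W" unfolding W_def by simp
  moreover have "card W \<le> CARD('n) + card R"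
    unfolding W_def using card_Un_le card_image_le add_mono
    by (meson finite order_trans)
  ultimately show ?thesis
    using dim_le_card order_trans by blast
qed

lemma is_basis_span:
  assumes "is_basis B"
  shows "span (col ` B) = equation_space"
proof
  have *: "B \<subseteq> vars" "card B = CARD('n) + card R" "inj_on col B" "independent (col ` B)"
    using assms unfolding is_basis_def by auto
  then have sub: "col ` B \<subseteq> equation_space"
    using col_in_equation_space by blast
  then show "span (col ` B) \<subseteq> equation_space"
    using span_minimal subspace_equation_space by blast
  show "equation_space \<subseteq> span (col ` B)"
    using sub *(4) dim_equation_space *(2) card_image[OF *(3)]
    by (intro card_ge_dim_independent) auto
qed

lemma coeff_expand:
  assumes "is_basis B" "y \<in> equation_space"
  shows "(\<Sum>x\<in>B. coeff B y x *\<^sub>R col x) = y"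
proof -
  have *: "inj_on col B" "independent (col ` B)"
    using assms unfolding is_basis_def by auto
  have "(\<Sum>x\<in>B. coeff B y x *\<^sub>R col x) = (\<Sum>v\<in>col ` B. representation (col ` B) y v *\<^sub>R v)"
    unfolding coeff_def by (simp add: sum.reindex[OF *(1)] o_def)
  also have "\<dots> = y"
    using *(2) assms is_basis_span finite_vars by (intro sum_representation_eq) auto
  finally show ?thesis .
qed

lemma basis_zero:
  assumes "is_basis B" "(\<Sum>x\<in>B. c x *\<^sub>R col x) = 0" "x \<in> B"
  shows "c x = 0"
proof -
  have *: "inj_on col B" "independent (col ` B)"
    using assms unfolding is_basis_def by auto
  have "(\<Sum>v\<in>col ` B. c (inv_into B col v) *\<^sub>R v) = 0"
    using assms(2) by (simp add: sum.reindex[OF *(1)] o_def *(1))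
  then have "c (inv_into B col (col x)) = 0"
    by (rule independentD[OF *(2) _ subset_refl _ imageI[OF assms(3)], rotated]) (simp add: finite_vars)
  then show ?thesis
    using *(1) assms(3) by simp
qed

lemma coeff_eqI:
  assumes "is_basis B" "(\<Sum>x\<in>B. c x *\<^sub>R col x) = y" "x \<in> B"
  shows "coeff B y x = c x"
proof -
  have "c x *\<^sub>R col x \<in> equation_space" if "x \<in> B" for x
    using assms(1) that subspace_scale[OF subspace_equation_space] col_in_equation_space
    unfolding is_basis_def by blast
  then have "y \<in> equation_space"
    using assms(2) subspace_sum[OF subspace_equation_space, of B "\<lambda>x. c x *\<^sub>R col x"] by simp
  then have "(\<Sum>x\<in>B. (coeff B y x - c x) *\<^sub>R col x) = 0"
    using coeff_expand[OF assms(1)] assms(2) by (simp add: scaleR_diff_left sum_subtractf)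
  from basis_zero[OF assms(1) this assms(3)] show ?thesis by simp
qed

lemma coeff_add:
  assumes "is_basis B" "y \<in> equation_space" "y' \<in> equation_space" "x \<in> B"
  shows "coeff B (y + y') x = coeff B y x + coeff B y' x"
  using assms by (intro coeff_eqI) (simp_all add: scaleR_add_left sum.distrib coeff_expand)

lemma coeff_scale:
  assumes "is_basis B" "y \<in> equation_space" "x \<in> B"
  shows "coeff B (c *\<^sub>R y) x = c * coeff B y x"
  using assms
  by (intro coeff_eqI) (simp_all add: coeff_expand flip: scaleR_scaleR scaleR_sum_right)

lemma coeff_zero:
  assumes "is_basis B" "x \<in> B"
  shows "coeff B 0 x = 0"
  using coeff_eqI[OF assms(1), of "\<lambda>_. 0" 0 x] assms by simp

text \<open>Testing coefficients indexed by variables also yields injectivity of \<open>col\<close>: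
  two equal columns would give a dependency with coefficients 1 and -1.\<close>

lemma is_basisI:
  assumes "B \<subseteq> vars" "card B = CARD('n) + card R"
    and zero: "\<And>c x. (\<Sum>x\<in>B. c x *\<^sub>R col x) = 0 \<Longrightarrow> x \<in> B \<Longrightarrow> c x = 0"
  shows "is_basis B"
proof -
  have inj: "inj_on col B"
  proof (rule inj_onI, rule ccontr)
    fix x y assume *: "x \<in> B" "y \<in> B" "col x = col y" "x \<noteq> y"
    let ?c = "\<lambda>v. (if v = x then 1 else 0) - (if v = y then 1 else (0::real))"
    have "(\<Sum>v\<in>B. ?c v *\<^sub>R col v) = (\<Sum>v\<in>B. if v = x then col v else 0) - (\<Sum>v\<in>B. if v = y then col v else 0)"
      unfolding sum_subtractf[symmetric] by (intro sum.cong) (auto simp: scaleR_diff_left)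
    also have "\<dots> = 0"
      using * finite_vars by simp
    finally have "?c x = 0"
      using zero[of ?c x] *(1) by simp
    then show False
      using *(4) by simp
  qed
  have "independent (col ` B)"
    unfolding independent_explicit
  proof (intro conjI allI impI ballI)
    fix c v assume *: "(\<Sum>v\<in>col ` B. c v *\<^sub>R v) = 0" "v \<in> col ` B"
    from *(1) have "(\<Sum>x\<in>B. c (col x) *\<^sub>R col x) = 0"
      by (simp add: sum.reindex[OF inj] o_def)
    then show "c v = 0"
      using zero[of "\<lambda>x. c (col x)"] *(2) by blast
  qed (simp add: finite_vars)
  then show ?thesis
    using assms(1,2) inj unfolding is_basis_def by blast
qed

lemma is_basis_exchange:
  assumes B: "is_basis B" and e: "e \<in> vars" "e \<notin> B" and x: "x \<in> B" "coeff B (col e) x \<noteq> 0"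
  shows "is_basis (insert e B - {x})"
proof (rule is_basisI)
  have B': "B \<subseteq> vars" "card B = CARD('n) + card R"
    using B unfolding is_basis_def by auto
  show "insert e B - {x} \<subseteq> vars" using B' e by auto
  show "card (insert e B - {x}) = CARD('n) + card R"
    using B'(2) e(2) x(1) finite_vars by simp
  fix c y assume c: "(\<Sum>y\<in>insert e B - {x}. c y *\<^sub>R col y) = 0" and y: "y \<in> insert e B - {x}"
  have eq: "insert e B - {x} = insert e (B - {x})"
    using e(2) x(1) by auto
  \<comment> \<open>The given combination rewritten over \<open>B\<close> by expanding the column of
    \<open>e\<close>.\<close>
  define d where "d y = (if y = x then 0 else c y) + c e * coeff B (col e) y" for y
  have "(\<Sum>y\<in>B. d y *\<^sub>R col y) =
      (\<Sum>y\<in>B. (if y = x then 0 else c y) *\<^sub>R col y) + c e *\<^sub>R (\<Sum>y\<in>B. coeff B (col e) y *\<^sub>R col y)"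
    unfolding d_def by (simp add: scaleR_add_left sum.distrib scaleR_sum_right)
  also have "(\<Sum>y\<in>B. (if y = x then 0 else c y) *\<^sub>R col y) = (\<Sum>y\<in>B - {x}. c y *\<^sub>R col y)"
    using finite_vars[of B] by (intro sum.mono_neutral_cong_right) auto
  also have "\<dots> + c e *\<^sub>R (\<Sum>y\<in>B. coeff B (col e) y *\<^sub>R col y) = 0"
    using c e(2) finite_vars[of B] unfolding eq coeff_expand[OF B col_in_equation_space[OF e(1)]]
    by (simp add: add.commute)
  finally have d0: "d y = 0" if "y \<in> B" for y
    using basis_zero[OF B] that by blast
  from d0[OF x(1)] have "c e = 0"
    using x(2) unfolding d_def by simp
  then show "c y = 0"
    using y d0[of y] unfolding d_def by auto
qed

text \<open>Applied to differences, this says that the right-hand side and the nonbasic values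
  determine an assignment; the formulas for moves along an edge rest on it.\<close>

lemma system_zero_basis:
  assumes "is_basis B" "\<And>x. x \<notin> B \<Longrightarrow> X x = 0" "system X = 0"
  shows "X = (\<lambda>x. 0)"
proof
  fix x
  have "(\<Sum>x\<in>B. X x *\<^sub>R col x) = 0"
    using assms unfolding system_def is_basis_def
    by (subst sum.mono_neutral_cong_left[of vars]) (auto simp: finite_vars)
  then show "X x = 0"
    using basis_zero[OF assms(1)] assms(2) by blast
qed

section \<open>Pivoting in the perturbed system\<close>

definition pval :: "((real^'n) \<times> (real^'m)) list \<Rightarrow> real \<Rightarrow> ('n, 'm) state \<Rightarrow> ('n, 'm) var \<Rightarrow> real" where
  "pval ps \<epsilon> s x = lexpoly (lexval ps s x) \<epsilon>"

text \<open>An edge is recorded by its free variables and not by a point on it. So there are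
  finitely many edges, and a path that never repeats one must stop.\<close>

definition edge :: "('n, 'm) state \<Rightarrow> ('n, 'm) var set" where
  "edge s = insert (entering s) (basis s)"

definition direction :: "('n, 'm) state \<Rightarrow> ('n, 'm) var \<Rightarrow> real" where
  "direction s y = (if y \<in> edge s then rate s y else 0)"

definition feasible :: "(('n, 'm) var \<Rightarrow> real) \<Rightarrow> bool" where
  "feasible X \<longleftrightarrow> (\<forall>x\<in>vars. lo x \<le> ereal (X x) \<and> ereal (X x) \<le> hi x)"

text \<open>\<open>Tvar\<close> is included because on the path \<open>t\<close> is either basic or
  entering. The variables left out sit at bounds, which makes complementarity automatic.\<close>

definition selection :: "('n, 'm) var set \<Rightarrow> bool" where
  "selection S \<longleftrightarrow> S \<subseteq> vars \<and> Tvar \<in> S \<and> (\<forall>j. card (S \<inter> {Zvar j, Wvar j, Vvar j}) = 1) \<and>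
     (\<forall>i\<in>R. card (S \<inter> {Svar i, Lvar i}) = 1)"

lemma selection_iff:
  "selection S \<longleftrightarrow> S \<subseteq> vars \<and> Tvar \<in> S \<and>
    (\<forall>j. Zvar j \<in> S \<and> Wvar j \<notin> S \<and> Vvar j \<notin> S \<or> Zvar j \<notin> S \<and> Wvar j \<in> S \<and> Vvar j \<notin> S \<or>
      Zvar j \<notin> S \<and> Wvar j \<notin> S \<and> Vvar j \<in> S) \<and> (\<forall>i\<in>R. Svar i \<in> S \<longleftrightarrow> Lvar i \<notin> S)"
  unfolding selection_def by (simp add: card_Int_two card_Int_three del: One_nat_def)

lemma selectionD:
  assumes "selection S"
  shows "Zvar j \<in> S \<and> Wvar j \<notin> S \<and> Vvar j \<notin> S \<or> Zvar j \<notin> S \<and> Wvar j \<in> S \<and> Vvar j \<notin> S \<or>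
      Zvar j \<notin> S \<and> Wvar j \<notin> S \<and> Vvar j \<in> S"
    and "i \<in> R \<Longrightarrow> Svar i \<in> S \<longleftrightarrow> Lvar i \<notin> S" and "S \<subseteq> vars" and "Tvar \<in> S"
  using assms unfolding selection_iff by blast+

text \<open>The variables outside an edge stay at the bounds given by \<open>start_val\<close>, which depend only on
  the edge.\<close>

definition valid_state :: "((real^'n) \<times> (real^'m)) list \<Rightarrow> ('n, 'm) state \<Rightarrow> bool" where
  "valid_state ps s \<longleftrightarrow> is_basis (basis s) \<and> entering s \<in> vars \<and> entering s \<notin> basis s \<and>
    selection (edge s) \<and> (\<forall>y. y \<notin> edge s \<longrightarrow> nbval s y = start_val (edge s) 0 y) \<and>
    (if entering s = Tvar then dir s = -1 \<and> 0 \<le> nbval s Tvar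
     else dir s = 1 \<and> lo (entering s) = ereal (nbval s (entering s)) \<or>
       dir s = -1 \<and> hi (entering s) = ereal (nbval s (entering s))) \<and>
    (\<forall>x\<in>basis s. \<forall>\<^sub>F \<epsilon> in at_right 0. lo x < ereal (pval ps \<epsilon> s x) \<and> ereal (pval ps \<epsilon> s x) < hi x)"

lemma vars_simps [simp]: "Zvar j \<in> vars" "Tvar \<in> vars" "Wvar j \<in> vars \<longleftrightarrow> l j \<noteq> -\<infinity>"
  "Vvar j \<in> vars \<longleftrightarrow> u j \<noteq> \<infinity>" "Svar i \<in> vars \<longleftrightarrow> i \<in> R" "Lvar i \<in> vars \<longleftrightarrow> i \<in> R"
  unfolding vars_def by auto

lemma lo_less_hi: "x \<in> vars \<Longrightarrow> lo x < hi x"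
proof (cases x)
  case (Zvar j)
  then show ?thesis using l_less_u by simp
next
  case (Svar i)
  then show "x \<in> vars \<Longrightarrow> lo x < hi x" using K_not_Rzero[of i] by (cases "K i") auto
next
  case (Lvar i)
  then show "x \<in> vars \<Longrightarrow> lo x < hi x" using K_not_Rzero[of i] by (cases "K i") auto
qed auto

lemma lo_not_infty: "x \<in> vars \<Longrightarrow> lo x \<noteq> \<infinity>" and hi_not_minfty: "x \<in> vars \<Longrightarrow> hi x \<noteq> -\<infinity>"
  using lo_less_hi[of x] by auto

text \<open>For \<open>Zvar\<close> the selected member of its triple tells which bound holds; the
  default 0 of \<open>start_val\<close> is not reached there.\<close>

lemma start_val_off_selection:
  assumes "selection S" "y \<notin> S" "y \<in> vars"
  shows "lo y = ereal (start_val S t y) \<or> hi y = ereal (start_val S t y)"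
proof (cases y)
  case (Zvar j)
  show ?thesis
  proof (cases "Wvar j \<in> S")
    case True
    then have "l j \<noteq> -\<infinity>" using assms unfolding selection_iff by auto
    then have "l j = ereal (real_of_ereal (l j))"
      using l_not_inf[of j] by (cases "l j") auto
    then show ?thesis using True Zvar by simp
  next
    case False
    then have V: "Vvar j \<in> S" using assms Zvar unfolding selection_iff by auto
    then have "u j \<noteq> \<infinity>" using assms unfolding selection_iff by auto
    then have "u j = ereal (real_of_ereal (u j))"
      using u_not_inf[of j] by (cases "u j") auto
    then show ?thesis using V False Zvar by simp
  qed
next
  case (Svar i)
  then show ?thesis using assms by (cases "K i") (auto simp: zero_ereal_def)
next
  case (Lvar i)
  then show ?thesis using assms K_not_Rzero[of i] by (cases "K i") (auto simp: zero_ereal_def)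
next
  case Tvar
  then show ?thesis using assms unfolding selection_iff by auto
qed (auto simp: zero_ereal_def)

lemma start_val_off_vars: "y \<notin> vars \<Longrightarrow> start_val S t y = 0"
  by (cases y) auto

lemma system_diff: "system (\<lambda>x. X x - Y x) = system X - system Y"
  unfolding system_def by (simp add: scaleR_diff_left sum_subtractf)

lemma system_scale: "system (\<lambda>x. c * X x) = c *\<^sub>R system X"
  unfolding system_def by (simp add: scaleR_sum_right)

section \<open>Basic solutions of the perturbed system, their nondegeneracy and feasibility\<close>

lemma perturbation_in_equation_space:
  "set ps \<subseteq> equation_space \<Longrightarrow> perturbation ps \<epsilon> \<in> equation_space"
  by (induction ps) (auto intro!: subspace_scale subspace_add subspace_equation_space
      subspace_0[OF subspace_equation_space])

lemma coeff_perturbation: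
  assumes "is_basis B" "set ps \<subseteq> equation_space" "x \<in> B"
  shows "coeff B (perturbation ps \<epsilon>) x = \<epsilon> * lexpoly (map (\<lambda>p. coeff B p x) ps) \<epsilon>"
  using assms(2)
proof (induction ps)
  case (Cons p ps)
  then show ?case
    using assms(1,3) perturbation_in_equation_space[of ps \<epsilon>]
    by (simp add: coeff_scale coeff_add subspace_add[OF subspace_equation_space])
qed (simp add: coeff_zero assms)

lemma pval_nonbasic: "x \<notin> basis s \<Longrightarrow> pval ps \<epsilon> s x = nbval s x"
  unfolding pval_def lexval_def val_def by simp

lemma nonbasic_in_equation_space:
  "rhs - (\<Sum>y\<in>vars - B. nb y *\<^sub>R col y) \<in> equation_space"
  by (intro subspace_diff subspace_equation_space rhs_in_equation_space subspace_sum subspace_scale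
      col_in_equation_space) auto

lemma pval_basic:
  assumes "is_basis (basis s)" "set ps \<subseteq> equation_space" "x \<in> basis s"
  shows "pval ps \<epsilon> s x =
    coeff (basis s) (rhs - (\<Sum>y\<in>vars - basis s. nbval s y *\<^sub>R col y) + perturbation ps \<epsilon>) x"
  using assms perturbation_in_equation_space[OF assms(2)] nonbasic_in_equation_space
  unfolding pval_def lexval_def val_def by (simp add: coeff_add coeff_perturbation)

lemma val_pval: "val s = pval [] \<epsilon> s"
  unfolding pval_def lexval_def by simp

text \<open>Gives the formal lists their meaning: at a real \<epsilon> they form the basic solution
  for a perturbed right-hand side that is the same for all states, so two states can be compared by
  subtraction.\<close>

lemma system_pval:
  assumes "is_basis (basis s)" "set ps \<subseteq> equation_space"
  shows "system (pval ps \<epsilon> s) = rhs + perturbation ps \<epsilon>"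
proof -
  let ?N = "\<Sum>y\<in>vars - basis s. nbval s y *\<^sub>R col y"
  have sub: "basis s \<subseteq> vars"
    using assms(1) unfolding is_basis_def by blast
  have "system (pval ps \<epsilon> s) =
      (\<Sum>x\<in>vars - basis s. pval ps \<epsilon> s x *\<^sub>R col x) + (\<Sum>x\<in>basis s. pval ps \<epsilon> s x *\<^sub>R col x)"
    unfolding system_def by (rule sum.subset_diff[OF sub finite_vars])
  also have "(\<Sum>x\<in>vars - basis s. pval ps \<epsilon> s x *\<^sub>R col x) = ?N"
    by (intro sum.cong) (auto simp: pval_nonbasic)
  also have "(\<Sum>x\<in>basis s. pval ps \<epsilon> s x *\<^sub>R col x) = rhs - ?N + perturbation ps \<epsilon>"
    using coeff_expand[OF assms(1), of "rhs - ?N + perturbation ps \<epsilon>"] nonbasic_in_equation_space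
      perturbation_in_equation_space[OF assms(2)] subspace_add[OF subspace_equation_space]
    by (simp add: pval_basic[OF assms] cong: sum.cong)
  finally show ?thesis by simp
qed

lemma system_direction:
  assumes "is_basis (basis s)" "entering s \<in> vars" "entering s \<notin> basis s"
  shows "system (direction s) = 0"
proof -
  have sub: "edge s \<subseteq> vars"
    using assms(1,2) unfolding is_basis_def edge_def by blast
  have "system (direction s) = (\<Sum>x\<in>edge s. rate s x *\<^sub>R col x)"
    unfolding system_def using sub finite_vars
    by (intro sum.mono_neutral_cong_right) (auto simp: direction_def)
  also have "\<dots> = dir s *\<^sub>R col (entering s) + (\<Sum>x\<in>basis s. rate s x *\<^sub>R col x)"
    using assms(3) finite_vars unfolding edge_def by (simp add: rate_def)
  also have "(\<Sum>x\<in>basis s. rate s x *\<^sub>R col x) =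
      - dir s *\<^sub>R (\<Sum>x\<in>basis s. coeff (basis s) (col (entering s)) x *\<^sub>R col x)"
    unfolding scaleR_sum_right using assms(3) by (intro sum.cong) (auto simp: rate_def)
  also have "\<dots> = - dir s *\<^sub>R col (entering s)"
    using coeff_expand[OF assms(1) col_in_equation_space[OF assms(2)]] by simp
  finally show ?thesis by simp
qed

text \<open>An edge has one variable more than a basis, so the homogeneous system leaves one degree
  of freedom, and the entering variable fixes the multiple.\<close>

lemma edge_line:
  assumes s: "is_basis (basis s)" "entering s \<in> vars" "entering s \<notin> basis s" "dir s \<noteq> 0"
    and X: "\<And>y. y \<notin> edge s \<Longrightarrow> X y = 0" "system X = 0"
  shows "X y = X (entering s) / dir s * direction s y"
proof -
  let ?c = "X (entering s) / dir s"
  have "(\<lambda>y. X y - ?c * direction s y) = (\<lambda>y. 0)"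
  proof (rule system_zero_basis[OF s(1)])
    show "system (\<lambda>y. X y - ?c * direction s y) = 0"
      by (simp only: system_diff system_scale X(2) system_direction[OF s(1-3)]) simp
    fix y assume y: "y \<notin> basis s"
    show "X y - ?c * direction s y = 0"
    proof (cases "y = entering s")
      case True
      then show ?thesis using s(4) by (simp add: direction_def edge_def rate_def)
    next
      case False
      then have "y \<notin> edge s" using y unfolding edge_def by simp
      then show ?thesis using X(1) by (simp add: direction_def)
    qed
  qed
  then show ?thesis
    by (metis eq_iff_diff_eq_0)
qed

lemma lex_order_span:
  assumes "lex_order ps"
  shows "set ps \<subseteq> equation_space" "span (set ps) = equation_space"
proof -
  have *: "length ps = CARD('n) + card R" "distinct ps" "independent (set ps)"
    "\<forall>p\<in>set ps. \<forall>i. i \<notin> R \<longrightarrow> snd p $ i = 0"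
    using assms unfolding lex_order_def by auto
  then show sub: "set ps \<subseteq> equation_space"
    unfolding equation_space_def by blast
  then have "span (set ps) \<subseteq> equation_space"
    using span_minimal subspace_equation_space by blast
  moreover have "equation_space \<subseteq> span (set ps)"
    using sub *(3) dim_equation_space *(1) distinct_card[OF *(2)]
    by (intro card_ge_dim_independent) auto
  ultimately show "span (set ps) = equation_space" ..
qed

lemma coeff_col:
  assumes "is_basis B" "x \<in> B"
  shows "coeff B (col x) x = 1"
proof -
  have "(\<Sum>y\<in>B. (if y = x then 1 else 0) *\<^sub>R col y) = (\<Sum>y\<in>B. if y = x then col y else 0)"
    by (intro sum.cong) auto
  also have "\<dots> = col x"
    using assms(2) finite_vars by simp
  finally show ?thesis
    using coeff_eqI[OF assms(1) _ assms(2), of "\<lambda>y. if y = x then 1 else 0"] by simp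
qed

lemma coeff_vanishing_on_span:
  assumes B: "is_basis B" "x \<in> B" and P: "P \<subseteq> equation_space" "\<And>p. p \<in> P \<Longrightarrow> coeff B p x = 0"
    and y: "y \<in> span P"
  shows "coeff B y x = 0"
proof -
  have "subspace {y \<in> equation_space. coeff B y x = 0}"
    using subspace_equation_space B
    by (auto simp: subspace_def coeff_add coeff_scale coeff_zero)
  then have "span P \<subseteq> {y \<in> equation_space. coeff B y x = 0}"
    using P by (intro span_minimal) auto
  then show ?thesis using y by blast
qed

lemma length_lex [simp]: "length (lexreal ps \<beta>) = Suc (length ps)" "length (lexval ps s x) = Suc (length ps)"
  unfolding lexreal_def lexval_def by simp_all

lemma lexpoly_lexreal [simp]: "lexpoly (lexreal ps \<beta>) \<epsilon> = \<beta>"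
  unfolding lexreal_def by simp

text \<open>The column of \<open>x\<close> lies in the span of the lexicographic vectors and has
  coordinate 1 at \<open>x\<close>, so these vectors cannot all have coordinate 0 there. This is why
  the lexicographic rule needs as many vectors as equations.\<close>

lemma lexval_nondegenerate:
  assumes "lex_order ps" "is_basis (basis s)" "x \<in> basis s"
  shows "lexval ps s x \<noteq> lexreal ps \<beta>"
proof
  assume "lexval ps s x = lexreal ps \<beta>"
  then have "map (\<lambda>p. coeff (basis s) p x) ps = map (\<lambda>_. 0) ps"
    using assms(3) unfolding lexval_def lexreal_def by simp
  then have "\<And>p. p \<in> set ps \<Longrightarrow> coeff (basis s) p x = 0"
    by (simp add: map_eq_conv)
  moreover have "col x \<in> span (set ps)"
    using lex_order_span(2)[OF assms(1)] assms(2,3) col_in_equation_space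
    unfolding is_basis_def by blast
  ultimately have "coeff (basis s) (col x) x = 0"
    using coeff_vanishing_on_span[OF assms(2,3) lex_order_span(1)[OF assms(1)]] by blast
  then show False
    using coeff_col[OF assms(2,3)] by simp
qed

lemma strictly_feasible:
  assumes "lex_order ps" "is_basis (basis s)" "x \<in> basis s"
    and weak: "\<forall>\<^sub>F \<epsilon> in at_right 0. lo x \<le> ereal (pval ps \<epsilon> s x) \<and> ereal (pval ps \<epsilon> s x) \<le> hi x"
  shows "\<forall>\<^sub>F \<epsilon> in at_right 0. lo x < ereal (pval ps \<epsilon> s x) \<and> ereal (pval ps \<epsilon> s x) < hi x"
proof (rule eventually_conj)
  note ne = lexval_nondegenerate[OF assms(1-3)]
  have x: "x \<in> vars" using assms(2,3) unfolding is_basis_def by blast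
  show "\<forall>\<^sub>F \<epsilon> in at_right 0. lo x < ereal (pval ps \<epsilon> s x)"
  proof (cases "lo x")
    case (real \<beta>)
    have "\<forall>\<^sub>F \<epsilon> in at_right 0. lexpoly (lexreal ps \<beta>) \<epsilon> < lexpoly (lexval ps s x) \<epsilon>"
      using weak real ne[of \<beta>]
      by (intro eventually_le_imp_less) (auto simp: pval_def elim: eventually_mono)
    then show ?thesis using real by (simp add: pval_def)
  qed (use lo_not_infty[OF x] in auto)
  show "\<forall>\<^sub>F \<epsilon> in at_right 0. ereal (pval ps \<epsilon> s x) < hi x"
  proof (cases "hi x")
    case (real \<beta>)
    have "\<forall>\<^sub>F \<epsilon> in at_right 0. lexpoly (lexval ps s x) \<epsilon> < lexpoly (lexreal ps \<beta>) \<epsilon>"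
      using weak real ne[of \<beta>]
      by (intro eventually_le_imp_less) (auto simp: pval_def elim: eventually_mono)
    then show ?thesis using real by (simp add: pval_def)
  qed (use hi_not_minfty[OF x] in auto)
qed

lemma lex_feasible_iff:
  assumes "basis s \<subseteq> vars"
  shows "lex_feasible ps s \<longleftrightarrow> (\<forall>x\<in>basis s. \<forall>\<^sub>F \<epsilon> in at_right 0.
    lo x \<le> ereal (pval ps \<epsilon> s x) \<and> ereal (pval ps \<epsilon> s x) \<le> hi x)"
proof -
  have "(\<forall>\<beta>. (lo x = ereal \<beta> \<longrightarrow> lexordp_eq (lexreal ps \<beta>) (lexval ps s x)) \<and>
     (hi x = ereal \<beta> \<longrightarrow> lexordp_eq (lexval ps s x) (lexreal ps \<beta>))) \<longleftrightarrow>
     (\<forall>\<^sub>F \<epsilon> in at_right 0. lo x \<le> ereal (pval ps \<epsilon> s x) \<and> ereal (pval ps \<epsilon> s x) \<le> hi x)"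
    if x: "x \<in> basis s" for x
  proof -
    have "lo x \<noteq> \<infinity>" "hi x \<noteq> -\<infinity>"
      using x assms lo_not_infty hi_not_minfty by blast+
    then show ?thesis
      by (cases "lo x"; cases "hi x")
        (auto simp add: lexordp_eq_iff_eventually eventually_conj_iff pval_def)
  qed
  then show ?thesis unfolding lex_feasible_def by blast
qed

lemma valid_state_feasible:
  assumes "valid_state ps s"
  shows "\<forall>\<^sub>F \<epsilon> in at_right 0. feasible (pval ps \<epsilon> s)"
proof -
  have s: "selection (edge s)" "entering s \<in> vars" "entering s \<notin> basis s"
    "\<And>y. y \<notin> edge s \<Longrightarrow> nbval s y = start_val (edge s) 0 y"
    "if entering s = Tvar then dir s = -1 \<and> 0 \<le> nbval s Tvar
     else dir s = 1 \<and> lo (entering s) = ereal (nbval s (entering s)) \<or>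
       dir s = -1 \<and> hi (entering s) = ereal (nbval s (entering s))"
    "\<forall>x\<in>basis s. \<forall>\<^sub>F \<epsilon> in at_right 0. lo x < ereal (pval ps \<epsilon> s x) \<and> ereal (pval ps \<epsilon> s x) < hi x"
    using assms unfolding valid_state_def by auto
  have "\<forall>x\<in>vars. \<forall>\<^sub>F \<epsilon> in at_right 0. lo x \<le> ereal (pval ps \<epsilon> s x) \<and> ereal (pval ps \<epsilon> s x) \<le> hi x"
  proof
    fix x assume x: "x \<in> vars"
    consider "x \<in> basis s" | "x = entering s" | "x \<notin> edge s"
      unfolding edge_def by blast
    then show "\<forall>\<^sub>F \<epsilon> in at_right 0. lo x \<le> ereal (pval ps \<epsilon> s x) \<and> ereal (pval ps \<epsilon> s x) \<le> hi x"
    proof cases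
      case 1
      from bspec[OF s(6) 1] show ?thesis by (rule eventually_mono) auto
    next
      case 2
      have "lo x \<le> ereal (nbval s x) \<and> ereal (nbval s x) \<le> hi x"
        using s(5) lo_less_hi[OF x] unfolding 2 by (auto split: if_splits)
      then show ?thesis using s(3) by (simp add: pval_nonbasic 2)
    next
      case 3
      then have "lo x \<le> ereal (nbval s x) \<and> ereal (nbval s x) \<le> hi x"
        using start_val_off_selection[OF s(1) 3 x, of 0] lo_less_hi[OF x] s(4)[OF 3] by auto
      moreover have "x \<notin> basis s" using 3 unfolding edge_def by simp
      ultimately show ?thesis by (simp add: pval_nonbasic)
    qed
  qed
  then show ?thesis
    unfolding feasible_def by (intro eventually_ball_finite finite_vars)
qed

section \<open>A single pivot: complement, step length and invariance of valid states\<close>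

lemma lexpoly_ratio: "lexpoly (ratio ps s x \<beta>) \<epsilon> = (\<beta> - pval ps \<epsilon> s x) / rate s x"
  unfolding ratio_def by (simp add: lexpoly_map2_diff_divide pval_def)

lemma length_ratio: "length (ratio ps s x \<beta>) = Suc (length ps)"
  unfolding ratio_def by simp

text \<open>Selecting \<open>Wvar\<close> or \<open>Vvar\<close> records the bound at which
  \<open>Zvar\<close> was left, and the bound can be recovered from the selection. So the exchange
  changes \<open>start_val\<close> off the edges only at \<open>x\<close>, and the complement moves
  away from the bound at which it stands.\<close>

lemma complement_of_leaving:
  assumes S: "selection S" "x \<in> S" "x \<noteq> Tvar"
    and bound: "if low then lo x = ereal \<beta> else hi x = ereal \<beta>"
    and cd: "complement x low = (c, d)"
  shows "c \<in> vars" "c \<notin> S" "c \<noteq> Tvar" "selection (insert c (S - {x}))"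
    "d = 1 \<and> lo c = ereal (start_val S t c) \<or> d = -1 \<and> hi c = ereal (start_val S t c)"
    "start_val (insert c (S - {x})) t x = \<beta>"
    "y \<notin> insert c S \<Longrightarrow> y \<noteq> x \<Longrightarrow> start_val (insert c (S - {x})) t y = start_val S t y"
proof -
  note tri = selectionD(1)[OF S(1)] and two = selectionD(2)[OF S(1)] and sub = selectionD(3)[OF S(1)]
  have x: "x \<in> vars" using sub S(2) by blast
  have "c \<in> vars \<and> c \<notin> S \<and> c \<noteq> Tvar \<and> selection (insert c (S - {x})) \<and>
    (d = 1 \<and> lo c = ereal (start_val S t c) \<or> d = -1 \<and> hi c = ereal (start_val S t c)) \<and>
    start_val (insert c (S - {x})) t x = \<beta> \<and>
    (\<forall>y. y \<notin> insert c S \<longrightarrow> y \<noteq> x \<longrightarrow> start_val (insert c (S - {x})) t y = start_val S t y)"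
  proof (cases x)
    case (Zvar j)
    note tri = tri[of j]
    show ?thesis
    proof (cases low)
      case True
      then have c: "c = Wvar j" "d = 1" and l: "l j = ereal \<beta>"
        using cd Zvar bound by auto
      have "start_val (insert c (S - {x})) t y = start_val S t y" if "y \<notin> insert c S" "y \<noteq> x" for y
        using that by (cases y) (auto simp: c Zvar)
      moreover have "selection (insert c (S - {x}))"
        using S(1) tri l Zvar S(2) unfolding selection_iff c by auto
      ultimately show ?thesis
        using tri Zvar S(2) l by (auto simp: c zero_ereal_def)
    next
      case False
      then have c: "c = Vvar j" "d = 1" and l: "u j = ereal \<beta>"
        using cd Zvar bound by auto
      have "start_val (insert c (S - {x})) t y = start_val S t y" if "y \<notin> insert c S" "y \<noteq> x" for y
        using that by (cases y) (auto simp: c Zvar)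
      moreover have "selection (insert c (S - {x}))"
        using S(1) tri l Zvar S(2) unfolding selection_iff c by auto
      ultimately show ?thesis
        using tri Zvar S(2) l by (auto simp: c zero_ereal_def)
    qed
  next
    case (Wvar j)
    note tri = tri[of j]
    have c: "c = Zvar j" "d = 1" and b: "\<beta> = 0"
      using cd Wvar bound by (auto split: if_splits simp: zero_ereal_def)
    have "start_val (insert c (S - {x})) t y = start_val S t y" if "y \<notin> insert c S" "y \<noteq> x" for y
      using that by (cases y) (auto simp: c Wvar)
    moreover have "selection (insert c (S - {x}))"
      using S(1) tri Wvar S(2) unfolding selection_iff c by auto
    moreover have "l j = ereal (real_of_ereal (l j))"
      using x Wvar l_not_inf[of j] by (cases "l j") auto
    ultimately show ?thesis
      using tri Wvar S(2) b by (auto simp: c)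
  next
    case (Vvar j)
    note tri = tri[of j]
    have c: "c = Zvar j" "d = -1" and b: "\<beta> = 0"
      using cd Vvar bound by (auto split: if_splits simp: zero_ereal_def)
    have "start_val (insert c (S - {x})) t y = start_val S t y" if "y \<notin> insert c S" "y \<noteq> x" for y
      using that by (cases y) (auto simp: c Vvar)
    moreover have "selection (insert c (S - {x}))"
      using S(1) tri Vvar S(2) unfolding selection_iff c by auto
    moreover have "u j = ereal (real_of_ereal (u j))"
      using x Vvar u_not_inf[of j] by (cases "u j") auto
    ultimately show ?thesis
      using tri Vvar S(2) b by (auto simp: c)
  next
    case (Svar i)
    have i: "i \<in> R" using x Svar by simp
    note two = two[OF i]
    have c: "c = Lvar i" "d = (if low then 1 else -1)"
      using cd Svar by auto
    have b: "\<beta> = 0" "if low then K i = Rplus else K i = Rminus"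
      using Svar bound K_not_Rzero[OF i]
      by (cases low; cases "K i"; simp add: zero_ereal_def)+
    have "start_val (insert c (S - {x})) t y = start_val S t y" if "y \<notin> insert c S" "y \<noteq> x" for y
      using that by (cases y) (auto simp: c Svar)
    moreover have "selection (insert c (S - {x}))"
      using S(1) two Svar S(2) i unfolding selection_iff c by auto
    ultimately show ?thesis
      using two Svar S(2) b i by (cases low) (auto simp: c zero_ereal_def)
  next
    case (Lvar i)
    have i: "i \<in> R" using x Lvar by simp
    note two = two[OF i]
    have c: "c = Svar i" "d = (if low then 1 else -1)"
      using cd Lvar by auto
    have b: "\<beta> = 0" "if low then K i = Rplus else K i = Rminus"
      using Lvar bound K_not_Rzero[OF i]
      by (cases low; cases "K i"; simp add: zero_ereal_def)+
    have "start_val (insert c (S - {x})) t y = start_val S t y" if "y \<notin> insert c S" "y \<noteq> x" for y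
      using that by (cases y) (auto simp: c Lvar)
    moreover have "selection (insert c (S - {x}))"
      using S(1) two Lvar S(2) i unfolding selection_iff c by auto
    ultimately show ?thesis
      using two Lvar S(2) b i by (cases low) (auto simp: c zero_ereal_def)
  qed (use S(3) in simp)
  then show "c \<in> vars" "c \<notin> S" "c \<noteq> Tvar" "selection (insert c (S - {x}))"
    "d = 1 \<and> lo c = ereal (start_val S t c) \<or> d = -1 \<and> hi c = ereal (start_val S t c)"
    "start_val (insert c (S - {x})) t x = \<beta>"
    "y \<notin> insert c S \<Longrightarrow> y \<noteq> x \<Longrightarrow> start_val (insert c (S - {x})) t y = start_val S t y"
    by blast+
qed

definition successor :: "('n, 'm) state \<Rightarrow> ('n, 'm) var \<Rightarrow> real \<Rightarrow> ('n, 'm) state" where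
  "successor s x \<beta> = \<lparr> basis = insert (entering s) (basis s) - {x},
     nbval = (nbval s)(x := \<beta>),
     entering = fst (complement x (rate s x < 0)),
     dir = snd (complement x (rate s x < 0)) \<rparr>"

lemma pivot_iff: "pivot ps s s' \<longleftrightarrow> val s Tvar \<noteq> 0 \<and> (\<exists>x \<beta>. leaving ps s x \<beta> \<and> s' = successor s x \<beta>)"
  unfolding pivot_def successor_def ..

lemma valid_stateD:
  assumes "valid_state ps s"
  shows "is_basis (basis s)" "entering s \<in> vars" "entering s \<notin> basis s" "selection (edge s)"
    "\<And>y. y \<notin> edge s \<Longrightarrow> nbval s y = start_val (edge s) 0 y"
    "if entering s = Tvar then dir s = -1 \<and> 0 \<le> nbval s Tvar
     else dir s = 1 \<and> lo (entering s) = ereal (nbval s (entering s)) \<or>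
       dir s = -1 \<and> hi (entering s) = ereal (nbval s (entering s))"
    "\<And>x. x \<in> basis s \<Longrightarrow>
      \<forall>\<^sub>F \<epsilon> in at_right 0. lo x < ereal (pval ps \<epsilon> s x) \<and> ereal (pval ps \<epsilon> s x) < hi x"
    "edge s \<subseteq> vars" "dir s \<noteq> 0"
  using assms unfolding valid_state_def selection_def by (auto split: if_splits)

lemma basis_successor:
  assumes s: "is_basis (basis s)" "entering s \<in> vars" "entering s \<notin> basis s"
    and x: "x \<in> edge s" "rate s x \<noteq> 0"
  shows "is_basis (basis (successor s x \<beta>))"
proof (cases "x = entering s")
  case True
  then have "basis (successor s x \<beta>) = basis s"
    using s(3) by (auto simp: successor_def)
  then show ?thesis using s(1) by simp
next
  case False
  then have "x \<in> basis s" "coeff (basis s) (col (entering s)) x \<noteq> 0"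
    using x unfolding edge_def rate_def by auto
  from is_basis_exchange[OF s this] show ?thesis
    by (simp add: successor_def)
qed

text \<open>Both sides solve the same perturbed system and agree outside the new basis. This covers
  the step in which the entering variable blocks itself and the basis stays the same.\<close>

lemma pval_successor:
  assumes ps: "set ps \<subseteq> equation_space"
    and s: "is_basis (basis s)" "entering s \<in> vars" "entering s \<notin> basis s"
    and x: "x \<in> edge s" "rate s x \<noteq> 0"
  shows "pval ps \<epsilon> (successor s x \<beta>) y = pval ps \<epsilon> s y + (\<beta> - pval ps \<epsilon> s x) / rate s x * direction s y"
proof -
  let ?s' = "successor s x \<beta>"
  let ?c = "(\<beta> - pval ps \<epsilon> s x) / rate s x"
  note B' = basis_successor[OF s x, of \<beta>]
  have "(\<lambda>y. (pval ps \<epsilon> ?s' y - pval ps \<epsilon> s y) - ?c * direction s y) = (\<lambda>y. 0)"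
  proof (rule system_zero_basis[OF B'])
    show "system (\<lambda>y. (pval ps \<epsilon> ?s' y - pval ps \<epsilon> s y) - ?c * direction s y) = 0"
      by (simp only: system_diff system_scale system_pval[OF s(1) ps] system_pval[OF B' ps]
          system_direction[OF s]) simp
    fix y assume y: "y \<notin> basis ?s'"
    show "(pval ps \<epsilon> ?s' y - pval ps \<epsilon> s y) - ?c * direction s y = 0"
    proof (cases "y = x")
      case True
      then show ?thesis
        using x pval_nonbasic[OF y] by (simp add: direction_def successor_def)
    next
      case False
      then have "y \<notin> edge s" using y unfolding edge_def successor_def by simp
      then show ?thesis
        using False pval_nonbasic[OF y] pval_nonbasic[of y s]
        by (simp add: direction_def successor_def edge_def)
    qed
  qed
  from fun_cong[OF this, of y] show ?thesis by simp
qed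

text \<open>Basic variables are strictly inside their bounds for small \<epsilon>; an entering
  variable travels from one bound to a different one, and an entering \<open>t\<close> starts at a
  nonzero value. Strict positivity later excludes edges of length 0.\<close>

lemma step_positive:
  assumes s: "valid_state ps s" and T: "val s Tvar \<noteq> 0" and x: "blocking s x \<beta>"
  shows "\<forall>\<^sub>F \<epsilon> in at_right 0. (\<beta> - pval ps \<epsilon> s x) / rate s x > 0"
proof (cases "x \<in> basis s")
  case True
  from valid_stateD(7)[OF s True] show ?thesis
    by (rule eventually_mono)
      (use x in \<open>auto simp: blocking_def intro: divide_pos_pos divide_neg_neg\<close>)
next
  case False
  then have e: "x = entering s" using x unfolding blocking_def by simp
  note d = valid_stateD(6)[OF s]
  have pv: "pval ps \<epsilon> s x = nbval s x" for \<epsilon>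
    using pval_nonbasic[OF False] .
  have "(\<beta> - nbval s x) / rate s x > 0"
  proof (cases "x = Tvar")
    case True
    then have "nbval s x \<noteq> 0" using T False unfolding val_def by simp
    then show ?thesis
      using d x True e by (auto simp: blocking_def rate_def zero_ereal_def split: if_splits)
  next
    case ne: False
    have "lo x < hi x" using valid_stateD(2)[OF s] e lo_less_hi by simp
    then show ?thesis
      using d x ne unfolding e by (auto simp: blocking_def rate_def)
  qed
  then show ?thesis by (simp add: pv)
qed

text \<open>The lexicographic minimum ratio keeps basic variables weakly within their bounds, and
  nondegeneracy turns this into strict inequalities.\<close>

lemma valid_successor:
  assumes s: "valid_state ps s" and ps: "lex_order ps" and T: "val s Tvar \<noteq> 0"
    and lv: "leaving ps s x \<beta>"
  shows "valid_state ps (successor s x \<beta>)"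
proof -
  define \<sigma> where "\<sigma> = successor s x \<beta>"
  note D = valid_stateD[OF s]
  note ps' = lex_order_span(1)[OF ps]
  have bl: "blocking s x \<beta>" using lv unfolding leaving_def by blast
  have x: "x \<in> edge s" "rate s x \<noteq> 0"
    "if rate s x < 0 then lo x = ereal \<beta> else hi x = ereal \<beta>"
    using bl unfolding blocking_def edge_def by auto
  note B' = basis_successor[OF D(1-3) x(1,2), of \<beta>, folded \<sigma>_def]
  note step = pval_successor[OF ps' D(1-3) x(1,2), of _ \<beta>, folded \<sigma>_def]
  obtain c d where cd: "complement x (rate s x < 0) = (c, d)"
    by (metis surj_pair)
  have s': "basis \<sigma> = edge s - {x}" "entering \<sigma> = c" "dir \<sigma> = d" "nbval \<sigma> = (nbval s)(x := \<beta>)"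
    using cd unfolding \<sigma>_def successor_def edge_def by simp_all
  have feas: "\<forall>\<^sub>F \<epsilon> in at_right 0. lo y < ereal (pval ps \<epsilon> \<sigma> y) \<and> ereal (pval ps \<epsilon> \<sigma> y) < hi y"
    if y: "y \<in> basis \<sigma>" for y
  proof (rule strictly_feasible[OF ps B' y])
    have ye: "y \<in> edge s" "y \<in> vars" using y D(8) unfolding s' by auto
    have old: "\<forall>\<^sub>F \<epsilon> in at_right 0. lo y \<le> ereal (pval ps \<epsilon> s y) \<and> ereal (pval ps \<epsilon> s y) \<le> hi y"
      using valid_state_feasible[OF s] by (rule eventually_mono) (use ye(2) in \<open>auto simp: feasible_def\<close>)
    have ratios: "\<forall>\<^sub>F \<epsilon> in at_right 0.
        (\<beta> - pval ps \<epsilon> s x) / rate s x \<le> (\<beta>' - pval ps \<epsilon> s y) / rate s y" if "blocking s y \<beta>'" for \<beta>'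
    proof -
      have "lexordp_eq (ratio ps s x \<beta>) (ratio ps s y \<beta>')"
        using lv that unfolding leaving_def by blast
      then show ?thesis
        by (simp add: lexordp_eq_iff_eventually length_ratio lexpoly_ratio)
    qed
    \<comment> \<open>Only a variable of negative rate can reach its lower bound, and for it the
      ratio test limits the step; any other variable has not decreased.\<close>
    have lower: "\<forall>\<^sub>F \<epsilon> in at_right 0. lo y \<le> ereal (pval ps \<epsilon> \<sigma> y)"
    proof (cases "rate s y < 0")
      case True
      show ?thesis
      proof (cases "lo y")
        case (real \<beta>')
        then have "blocking s y \<beta>'" using True ye(1) unfolding blocking_def edge_def by blast
        from ratios[OF this] show ?thesis
          by (rule eventually_mono)
            (use True ye(1) real in \<open>simp add: step direction_def neg_le_divide_eq\<close>)
      qed (use lo_not_infty[OF ye(2)] in auto)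
    next
      case False
      from old step_positive[OF s T bl] show ?thesis
      proof eventually_elim
        case (elim \<epsilon>)
        then have "pval ps \<epsilon> s y \<le> pval ps \<epsilon> \<sigma> y"
          using False ye(1) mult_nonneg_nonneg[of "(\<beta> - pval ps \<epsilon> s x) / rate s x" "rate s y"]
          unfolding step direction_def by simp
        then show ?case using elim(1) by (meson ereal_less_eq(3) order_trans)
      qed
    qed
    have upper: "\<forall>\<^sub>F \<epsilon> in at_right 0. ereal (pval ps \<epsilon> \<sigma> y) \<le> hi y"
    proof (cases "rate s y > 0")
      case True
      show ?thesis
      proof (cases "hi y")
        case (real \<beta>')
        then have "blocking s y \<beta>'" using True ye(1) unfolding blocking_def edge_def by blast
        from ratios[OF this] show ?thesis
          by (rule eventually_mono)
            (use True ye(1) real in \<open>simp add: step direction_def pos_le_divide_eq\<close>)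
      qed (use hi_not_minfty[OF ye(2)] in auto)
    next
      case False
      from old step_positive[OF s T bl] show ?thesis
      proof eventually_elim
        case (elim \<epsilon>)
        then have "pval ps \<epsilon> \<sigma> y \<le> pval ps \<epsilon> s y"
          using False ye(1) mult_nonneg_nonpos[of "(\<beta> - pval ps \<epsilon> s x) / rate s x" "rate s y"]
          unfolding step direction_def by simp
        then show ?case using elim(1) by (meson ereal_less_eq(3) order_trans)
      qed
    qed
    show "\<forall>\<^sub>F \<epsilon> in at_right 0. lo y \<le> ereal (pval ps \<epsilon> \<sigma> y) \<and> ereal (pval ps \<epsilon> \<sigma> y) \<le> hi y"
      using lower upper by (rule eventually_conj)
  qed
  show ?thesis
  \<comment> \<open>\<open>Tvar\<close> is its own complement, so reaching t = 0 leaves the edge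
    unchanged and the state valid, although no pivot starts from it.\<close>
  proof (cases "x = Tvar")
    case True
    then have "c = Tvar" "d = -1" using cd by auto
    have "edge \<sigma> = edge s"
      using x(1) True \<open>c = Tvar\<close> unfolding edge_def[of \<sigma>] s' by blast
    have "\<beta> = 0" using x(3) True by (auto simp: zero_ereal_def split: if_splits)
    show ?thesis
      unfolding \<sigma>_def[symmetric] valid_state_def \<open>edge \<sigma> = edge s\<close>
      using B' feas D(4,5) x(1) True \<open>\<beta> = 0\<close> \<open>c = Tvar\<close> \<open>d = -1\<close> by (auto simp: s')
  next
    case False
    note c = complement_of_leaving(1-4)[OF D(4) x(1) False x(3) cd]
      complement_of_leaving(5-7)[OF D(4) x(1) False x(3) cd, where t = 0]
    have ed: "edge \<sigma> = insert c (edge s - {x})"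
      unfolding edge_def[of \<sigma>] s' ..
    have "x \<noteq> c" using c(2) x(1) by blast
    have "nbval \<sigma> y = start_val (edge \<sigma>) 0 y" if "y \<notin> edge \<sigma>" for y
    proof (cases "y = x")
      case True
      then show ?thesis using c(6) unfolding ed s' by simp
    next
      case ne: False
      then have "y \<notin> insert c (edge s)" using that unfolding ed by simp
      then show ?thesis using c(7)[of y] ne D(5)[of y] unfolding ed s' by simp
    qed
    moreover have "nbval \<sigma> c = start_val (edge s) 0 c"
      using D(5)[OF c(2)] \<open>x \<noteq> c\<close> unfolding s' by simp
    ultimately show ?thesis
      unfolding \<sigma>_def[symmetric] valid_state_def
      using B' feas c(1-5) by (auto simp: s'(1-3) ed)
  qed
qed

lemma edge_successor:
  assumes s: "valid_state ps s" and bl: "blocking s x \<beta>" "x \<noteq> Tvar"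
  shows "edge (successor s x \<beta>) \<noteq> edge s" "entering (successor s x \<beta>) \<noteq> Tvar"
proof -
  note D = valid_stateD[OF s]
  obtain c d where cd: "complement x (rate s x < 0) = (c, d)"
    by (metis surj_pair)
  have x: "x \<in> edge s" "if rate s x < 0 then lo x = ereal \<beta> else hi x = ereal \<beta>"
    using bl unfolding blocking_def edge_def by auto
  note c = complement_of_leaving(2,3)[OF D(4) x(1) bl(2) x(2) cd]
  show "edge (successor s x \<beta>) \<noteq> edge s" "entering (successor s x \<beta>) \<noteq> Tvar"
    using c cd unfolding edge_def successor_def by auto
qed

section \<open>Edges are not visited twice\<close>

definition blocked :: "(('n, 'm) var \<Rightarrow> real) \<Rightarrow> (('n, 'm) var \<Rightarrow> real) \<Rightarrow> ('n, 'm) var \<Rightarrow> bool" where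
  "blocked X D y \<longleftrightarrow> y \<in> vars \<and> (D y < 0 \<and> lo y = ereal (X y) \<or> D y > 0 \<and> hi y = ereal (X y))"

text \<open>A positive step would push the blocked variable out of its range: \<open>X\<close> is
  the last feasible point of its line in direction \<open>D\<close>.\<close>

lemma blocked_step:
  assumes "blocked X D y" "feasible Y" "Y y = X y + a * D y"
  shows "a \<le> 0"
proof (rule ccontr)
  assume "\<not> a \<le> 0"
  then have "a > 0" by simp
  have bnd: "lo y \<le> ereal (X y + a * D y)" "ereal (X y + a * D y) \<le> hi y"
    using assms unfolding feasible_def blocked_def by auto
  show False
  proof (cases "D y < 0")
    case True
    then show ?thesis
      using bnd(1) assms(1) mult_pos_neg[OF \<open>a > 0\<close> True] unfolding blocked_def by auto
  next
    case False
    then have "D y > 0" "hi y = ereal (X y)" using assms(1) unfolding blocked_def by auto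
    then show ?thesis
      using bnd(2) mult_pos_pos[OF \<open>a > 0\<close> \<open>D y > 0\<close>] by auto
  qed
qed

text \<open>\<open>Zvar\<close> is outside both selections, at its lower bound for the one and at
  its upper bound for the other, and these bounds are distinct.\<close>

lemma opposite_bounds_differ:
  assumes S: "selection S" "Wvar j \<in> S" "\<And>y. y \<notin> S \<Longrightarrow> X y = start_val S 0 y"
    and S': "selection S'" "Vvar j \<in> S'" "\<And>y. y \<notin> S' \<Longrightarrow> X y = start_val S' 0 y"
  shows False
proof -
  have "Zvar j \<notin> S" "Zvar j \<notin> S'" "Wvar j \<notin> S'"
    using S(1,2) S'(1,2) unfolding selection_iff by blast+
  then have "real_of_ereal (l j) = real_of_ereal (u j)"
    using S(2,3) S'(2,3) by (metis start_val.simps(1))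
  moreover have "l j \<noteq> -\<infinity>" "u j \<noteq> \<infinity>"
    using S S' unfolding selection_iff by auto
  ultimately show False
    using l_less_u[of j] l_not_inf[of j] u_not_inf[of j] by (cases "l j"; cases "u j") auto
qed

text \<open>A vertex of the perturbed problem is the endpoint of only two edges.\<close>

lemma two_selections_at_vertex:
  assumes sel: "selection S1" "selection S2" "selection S3"
    and B: "S1 = insert a1 B" "S2 = insert a2 B" "S3 = insert a3 B"
    and X: "\<And>y. y \<notin> S1 \<Longrightarrow> X y = start_val S1 0 y" "\<And>y. y \<notin> S2 \<Longrightarrow> X y = start_val S2 0 y"
      "\<And>y. y \<notin> S3 \<Longrightarrow> X y = start_val S3 0 y"
    and ne: "S1 \<noteq> S2" "S1 \<noteq> S3" and a1: "a1 \<notin> B"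
  shows "S2 = S3"
proof (rule ccontr)
  assume ne': "S2 \<noteq> S3"
  have a: "a1 \<noteq> a2" "a1 \<noteq> a3" "a2 \<noteq> a3"
    using ne ne' B by auto
  have T: "Tvar \<in> B" using sel a unfolding selection_iff B by blast
  note tri = selectionD(1) and two = selectionD(2)
  \<comment> \<open>Three different edges through one basis would free each of \<open>Zvar\<close>,
    \<open>Wvar\<close> and \<open>Vvar\<close> once, so the vertex would be at both bounds. In a
    pair there are only two candidates anyway.\<close>
  have triple: False if j: "a1 \<in> {Zvar j, Wvar j, Vvar j}" for j
  proof -
    have "Zvar j \<notin> B" "Wvar j \<notin> B" "Vvar j \<notin> B"
      using tri[OF sel(1), of j] j a1 unfolding B by auto
    then have "a2 \<in> {Zvar j, Wvar j, Vvar j}" "a3 \<in> {Zvar j, Wvar j, Vvar j}"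
      using tri[OF sel(2), of j] tri[OF sel(3), of j] unfolding B by auto
    then have "{a1, a2, a3} = {Zvar j, Wvar j, Vvar j}"
      using j a by auto
    then have "Wvar j \<in> S1 \<or> Wvar j \<in> S2 \<or> Wvar j \<in> S3" "Vvar j \<in> S1 \<or> Vvar j \<in> S2 \<or> Vvar j \<in> S3"
      unfolding B by blast+
    then obtain S S' where "S \<in> {S1, S2, S3}" "Wvar j \<in> S" "S' \<in> {S1, S2, S3}" "Vvar j \<in> S'"
      by blast
    then show False
      using opposite_bounds_differ[of S j X S'] sel X by blast
  qed
  have pair: False if i: "a1 \<in> {Svar i, Lvar i}" for i
  proof -
    have "i \<in> R" using sel(1) i unfolding selection_iff B by auto
    then have "Svar i \<notin> B" "Lvar i \<notin> B"
      using two[OF sel(1), of i] i a1 unfolding B by auto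
    then have "a2 \<in> {Svar i, Lvar i}" "a3 \<in> {Svar i, Lvar i}"
      using two[OF sel(2), of i] two[OF sel(3), of i] \<open>i \<in> R\<close> unfolding B by auto
    then show False using a i by auto
  qed
  show False
    by (cases a1) (use triple pair T a1 in auto)
qed

lemma pval_off_edge:
  assumes "valid_state ps s" "y \<notin> edge s"
  shows "pval ps \<epsilon> s y = start_val (edge s) 0 y" "direction s y = 0"
  using valid_stateD(5)[OF assms] assms(2) pval_nonbasic[of y s]
  by (auto simp: edge_def direction_def)

lemma direction_entering: "direction s (entering s) = dir s"
  unfolding direction_def edge_def rate_def by simp

text \<open>If an edge were visited twice, consider the first repetition.  The vertex at which the edge
  is entered again is one of its two endpoints (only one for the starting ray), so the other edge
  at that vertex has been visited before as well.\<close>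

lemma edges_distinct:
  assumes ps: "lex_order ps"
    and valid: "\<And>i. i \<le> N \<Longrightarrow> valid_state ps (f i)"
    and T: "\<And>i. i \<le> N \<Longrightarrow> val (f i) Tvar \<noteq> 0"
    and step: "\<And>i. i < N \<Longrightarrow> leaving ps (f i) (x i) (\<beta> i)"
      "\<And>i. i < N \<Longrightarrow> f (Suc i) = successor (f i) (x i) (\<beta> i)"
    and start: "\<forall>\<^sub>F \<epsilon> in at_right 0. \<forall>c\<ge>0. feasible (\<lambda>y. pval ps \<epsilon> (f 0) y - c * direction (f 0) y)"
  shows "m \<le> N \<Longrightarrow> j < m \<Longrightarrow> edge (f j) \<noteq> edge (f m)"
proof -
  have bl: "blocking (f i) (x i) (\<beta> i)" if "i < N" for i
    using step(1)[OF that] unfolding leaving_def by blast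
  have x_edge: "x i \<in> edge (f i)" "rate (f i) (x i) \<noteq> 0" if "i < N" for i
    using bl[OF that] unfolding blocking_def edge_def by auto
  have xT: "x i \<noteq> Tvar" if "i < N" for i
  proof
    assume *: "x i = Tvar"
    then have "\<beta> i = 0"
      using bl[OF that] by (auto simp: blocking_def zero_ereal_def)
    then have "val (f (Suc i)) Tvar = 0"
      unfolding step(2)[OF that] val_def successor_def using * by simp
    then show False using T[of "Suc i"] that by simp
  qed
  have "\<forall>\<^sub>F \<epsilon> in at_right 0. \<forall>i\<in>{..N}. feasible (pval ps \<epsilon> (f i))"
    by (intro eventually_ball_finite) (use valid_state_feasible valid in auto)
  moreover have "\<forall>\<^sub>F \<epsilon> in at_right 0. \<forall>i\<in>{..N}. \<forall>y\<in>basis (f i).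
      lo y < ereal (pval ps \<epsilon> (f i) y) \<and> ereal (pval ps \<epsilon> (f i) y) < hi y"
    by (intro eventually_ball_finite ballI finite_atMost finite_vars) (use valid_stateD(7)[OF valid] in auto)
  moreover have "\<forall>\<^sub>F \<epsilon> in at_right 0. \<forall>i\<in>{..<N}. (\<beta> i - pval ps \<epsilon> (f i) (x i)) / rate (f i) (x i) > 0"
    by (intro eventually_ball_finite) (use step_positive[OF valid T bl] in auto)
  moreover note start
  ultimately have "\<forall>\<^sub>F \<epsilon> in at_right 0. (\<forall>i\<in>{..N}. feasible (pval ps \<epsilon> (f i))) \<and>
      (\<forall>i\<in>{..N}. \<forall>y\<in>basis (f i).
        lo y < ereal (pval ps \<epsilon> (f i) y) \<and> ereal (pval ps \<epsilon> (f i) y) < hi y) \<and>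
      (\<forall>i\<in>{..<N}. (\<beta> i - pval ps \<epsilon> (f i) (x i)) / rate (f i) (x i) > 0) \<and>
      (\<forall>c\<ge>0. feasible (\<lambda>y. pval ps \<epsilon> (f 0) y - c * direction (f 0) y))"
    by eventually_elim blast
  from eventually_happens'[OF trivial_limit_at_right_real this] obtain \<epsilon>
    where "(\<forall>i\<in>{..N}. feasible (pval ps \<epsilon> (f i))) \<and>
      (\<forall>i\<in>{..N}. \<forall>y\<in>basis (f i).
        lo y < ereal (pval ps \<epsilon> (f i) y) \<and> ereal (pval ps \<epsilon> (f i) y) < hi y) \<and>
      (\<forall>i\<in>{..<N}. (\<beta> i - pval ps \<epsilon> (f i) (x i)) / rate (f i) (x i) > 0) \<and>
      (\<forall>c\<ge>0. feasible (\<lambda>y. pval ps \<epsilon> (f 0) y - c * direction (f 0) y))" ..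
  then have \<epsilon>: "\<And>i. i \<le> N \<Longrightarrow> feasible (pval ps \<epsilon> (f i))"
      "\<And>i y. i \<le> N \<Longrightarrow> y \<in> basis (f i) \<Longrightarrow>
        lo y < ereal (pval ps \<epsilon> (f i) y) \<and> ereal (pval ps \<epsilon> (f i) y) < hi y"
      "\<And>i. i < N \<Longrightarrow> (\<beta> i - pval ps \<epsilon> (f i) (x i)) / rate (f i) (x i) > 0"
      "\<And>c. c \<ge> 0 \<Longrightarrow> feasible (\<lambda>y. pval ps \<epsilon> (f 0) y - c * direction (f 0) y)"
    by simp_all
  \<comment> \<open>The \<epsilon> just obtained suits all states of the finite path; from here on
    the argument is about points and directions at this fixed \<epsilon>.\<close>
  define X where "X i = pval ps \<epsilon> (f i)" for i
  define D where "D i = direction (f i)" for i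
  define S where "S i = edge (f i)" for i
  define e where "e i = entering (f i)" for i
  define \<theta> where "\<theta> i = (\<beta> i - X i (x i)) / rate (f i) (x i)" for i
  note ps' = lex_order_span(1)[OF ps]
  have \<theta>: "\<theta> i > 0" if "i < N" for i
    using \<epsilon>(3)[OF that] unfolding \<theta>_def X_def .
  have next_X: "X (Suc i) y = X i y + \<theta> i * D i y" if "i < N" for i y
    unfolding X_def D_def \<theta>_def step(2)[OF that]
    by (rule pval_successor) (use ps' valid_stateD(1-3)[OF valid] x_edge that in auto)
  have feas: "feasible (X i)" if "i \<le> N" for i
    using \<epsilon>(1)[OF that] unfolding X_def .
  have S_vars: "S i \<subseteq> vars" and sel: "selection (S i)" if "i \<le> N" for i
    using valid_stateD(4,8)[OF valid[OF that]] unfolding S_def by auto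
  have dir: "D i (e i) \<noteq> 0" "D i (e i) = dir (f i)" "e i \<in> S i" "e i \<notin> basis (f i)" if "i \<le> N" for i
    using valid_stateD(9,3)[OF valid[OF that]] direction_entering
    unfolding D_def e_def S_def edge_def by auto
  \<comment> \<open>A vertex is the forward end of the edge before it, because of the leaving
    variable, and by \<open>e_blocked\<close> the backward end of the edge after it, because of the
    entering variable.\<close>
  have x_blocked: "blocked (X (Suc i)) (D i) (x i)" if "i < N" for i
  proof -
    have "X (Suc i) (x i) = \<beta> i"
      unfolding X_def step(2)[OF that]
      using pval_nonbasic[of "x i" "successor (f i) (x i) (\<beta> i)"] by (simp add: successor_def)
    then show ?thesis
      using bl[OF that] S_vars[of i] x_edge[OF that] that
      unfolding blocked_def D_def direction_def S_def blocking_def by auto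
  qed
  have e_blocked: "blocked (X i) (\<lambda>y. - D i y) (e i)" if "0 < i" "i \<le> N" for i
  proof -
    obtain k where k: "i = Suc k" using \<open>0 < i\<close> gr0_conv_Suc by blast
    have "e i \<noteq> Tvar"
      using edge_successor(2)[OF valid bl xT, of k] step(2)[of k] that unfolding e_def k by simp
    then show ?thesis
      using valid_stateD(2,3,6)[OF valid[OF that(2)]] dir(2)[OF that(2)] pval_nonbasic[of "e i" "f i"]
      unfolding blocked_def X_def e_def by auto
  qed
  have basis_Suc: "S i = insert (x i) (basis (f (Suc i)))" if "i < N" for i
    using x_edge(1)[OF that] unfolding S_def step(2)[OF that] by (auto simp: successor_def edge_def)
  have basis_e: "S i = insert (e i) (basis (f i))" for i
    unfolding S_def e_def edge_def ..
  have off: "X i y = start_val (S i) 0 y" "D i y = 0" if "i \<le> N" "y \<notin> S i" for i y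
    using pval_off_edge[OF valid] that unfolding X_def S_def D_def by auto
  have off': "X (Suc i) y = start_val (S i) 0 y" if "i < N" "y \<notin> S i" for i y
    using off[of i y] that next_X[of i y] by simp
  have S_ne: "S i \<noteq> S (Suc i)" if "i < N" for i
    using edge_successor(1)[OF valid bl xT, of i] step(2)[of i] that unfolding S_def by auto
  \<comment> \<open>A vertex determines its basis as the set of variables strictly inside their
    bounds. The initial state is excluded, since there the entering \<open>Tvar\<close> lies
    strictly above its bound.\<close>
  have basis_eq: "basis (f i) = {y \<in> vars. lo y < ereal (X i y) \<and> ereal (X i y) < hi y}"
    if "0 < i" "i \<le> N" for i
  proof (intro equalityI subsetI)
    fix y assume "y \<in> basis (f i)"
    then show "y \<in> {y \<in> vars. lo y < ereal (X i y) \<and> ereal (X i y) < hi y}"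
      using \<epsilon>(2)[OF that(2)] S_vars[OF that(2)] unfolding X_def basis_e by auto
  next
    fix y assume y: "y \<in> {y \<in> vars. lo y < ereal (X i y) \<and> ereal (X i y) < hi y}"
    have "y \<noteq> e i"
      using y e_blocked[OF that] unfolding blocked_def by auto
    moreover have "y \<in> S i"
    proof (rule ccontr)
      assume "y \<notin> S i"
      then show False
        using start_val_off_selection[OF sel[OF that(2)], of y 0] off[OF that(2)] y by auto
    qed
    ultimately show "y \<in> basis (f i)" unfolding basis_e by blast
  qed
  have vertex: "S2 = S3" if m: "0 < m" "m \<le> N" and sels: "selection S2" "selection S3"
    "S2 = insert a2 (basis (f m))" "S3 = insert a3 (basis (f m))"
    "\<And>y. y \<notin> S2 \<Longrightarrow> X m y = start_val S2 0 y" "\<And>y. y \<notin> S3 \<Longrightarrow> X m y = start_val S3 0 y"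
    "S m \<noteq> S2" "S m \<noteq> S3" for m S2 S3 a2 a3
    using two_selections_at_vertex[OF sel[OF m(2)] sels(1,2) basis_e sels(3,4) off(1)[OF m(2)] sels(5,6)
        sels(7,8) dir(4)[OF m(2)]] .
  have "\<forall>j<m. S j \<noteq> S m" if "m \<le> N" for m
    using that
  proof (induction m rule: less_induct)
    case (less m)
    show ?case
    proof (intro allI impI notI)
      fix j assume j: "j < m" and eq: "S j = S m"
      then obtain p where p: "m = Suc p" using less_imp_Suc_add by blast
      have pN: "p < N" "0 < m" "j \<le> N" "j < N" using less.prems j p by auto
      have jp: "j < p" using j eq S_ne[OF pN(1)] unfolding p by (metis less_SucE)
      have fj: "is_basis (basis (f j))" "entering (f j) \<in> vars" "entering (f j) \<notin> basis (f j)" "dir (f j) \<noteq> 0"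
        using valid_stateD[OF valid[OF pN(3)]] by auto
      \<comment> \<open>\<open>X m\<close> lies on the line of edge j at parameter \<open>c\<close>,
        and the two directions on this line differ by the factor \<kappa>, whose sign tells whether
        the edge is entered again forwards or backwards.\<close>
      define c where "c = (X m (e j) - X j (e j)) / dir (f j)"
      have Xm: "X m y = X j y + c * D j y" for y
      proof -
        have "system (X i) = rhs + perturbation ps \<epsilon>" if "i \<le> N" for i
          unfolding X_def using valid_stateD(1)[OF valid[OF that]] ps' by (rule system_pval)
        then have "system (\<lambda>y. X m y - X j y) = 0"
          using less.prems pN(3) by (simp add: system_diff)
        moreover have "X m y - X j y = 0" if "y \<notin> edge (f j)" for y
          using off(1)[of m y] off(1)[of j y] that eq less.prems pN(3) unfolding S_def by simp
        ultimately have "X m y - X j y = c * D j y"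
          using edge_line[OF fj, of "\<lambda>y. X m y - X j y"] unfolding c_def D_def e_def by blast
        then show ?thesis by simp
      qed
      define \<kappa> where "\<kappa> = D m (e j) / dir (f j)"
      have Dm: "D m y = \<kappa> * D j y" for y
      proof -
        have "system (D m) = 0"
          unfolding D_def using valid_stateD(1-3)[OF valid[OF less.prems]] by (rule system_direction)
        moreover have "D m y = 0" if "y \<notin> edge (f j)" for y
          using off(2)[OF less.prems, of y] that eq unfolding S_def by simp
        ultimately show ?thesis
          using edge_line[OF fj, of "D m"] unfolding \<kappa>_def D_def e_def by blast
      qed
      have "\<kappa> \<noteq> 0"
        using dir(1)[OF less.prems] Dm by auto
      have em: "blocked (X m) (\<lambda>y. - D m y) (e m)"
        using e_blocked pN(2) less.prems by blast
      have prev: "S p = insert (x p) (basis (f m))" "selection (S p)" "S m \<noteq> S p"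
        "\<And>y. y \<notin> S p \<Longrightarrow> X m y = start_val (S p) 0 y"
        using basis_Suc[OF pN(1)] sel[of p] S_ne[OF pN(1)] off'[OF pN(1)] pN unfolding p by auto
      show False
      \<comment> \<open>Forwards: \<open>X m\<close> would be the initial vertex of edge j. The
        starting ray has none; otherwise edges j - 1 and p coincide, against the induction
        hypothesis.\<close>
      proof (cases "\<kappa> > 0")
        case True
        have lower: "a \<ge> 0" if "feasible Y" "\<And>y. Y y = X m y + a * D j y" for Y a
          using blocked_step[OF em that(1), of "- (a / \<kappa>)"] that(2) True
          by (simp add: Dm field_simps)
        show False
        proof (cases "j = 0")
          case False
          have "- c \<ge> 0"
            using feas[OF pN(3)] by (rule lower) (simp add: Xm)
          moreover have "c \<ge> 0"
            using blocked_step[OF e_blocked feas[OF less.prems], of j "- c"] False pN(3) Xm by simp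
          ultimately have "X m = X j"
            using Xm by auto
          obtain k where k: "j = Suc k" using False gr0_conv_Suc by blast
          have "k < N" using pN(3) k by simp
          have "basis (f m) = basis (f j)"
            using basis_eq[of m] basis_eq[of j] \<open>X m = X j\<close> False pN less.prems by simp
          then have "S p = S k"
            using vertex[OF pN(2) less.prems prev(2) sel[of k] prev(1), of "x k"] prev(3,4)
              basis_Suc[OF \<open>k < N\<close>] off'[OF \<open>k < N\<close>] \<open>X m = X j\<close> S_ne[OF \<open>k < N\<close>] eq \<open>k < N\<close> k by auto
          moreover have "\<forall>j<p. S j \<noteq> S p"
            using less.IH[of p] p pN(1) by simp
          ultimately show False
            using jp k by (metis Suc_lessD)
        next
          case True
          have "feasible (\<lambda>y. X 0 y - (\<bar>c\<bar> + 1) * D 0 y)"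
            using \<epsilon>(4) unfolding X_def D_def by simp
          then have "- c - \<bar>c\<bar> - 1 \<ge> 0"
            by (rule lower) (simp add: Xm True algebra_simps)
          then show False by linarith
        qed
      next
        case False
        then have \<kappa>: "\<kappa> < 0" using \<open>\<kappa> \<noteq> 0\<close> by simp
        \<comment> \<open>Backwards: \<open>X m\<close> would be the terminal vertex of edge j, so
          edges p and j + 1 coincide. By the induction hypothesis p = j + 1, and then edge p would
          have length 0.\<close>
        have upper: "a \<le> 0" if "feasible Y" "\<And>y. Y y = X m y + a * D j y" for Y a
          using blocked_step[OF em that(1), of "- (a / \<kappa>)"] that(2) \<kappa>
          by (simp add: Dm field_simps)
        have "\<theta> j - c \<le> 0"
          using feas[of "Suc j"] pN by (intro upper[of "X (Suc j)"]) (auto simp: Xm next_X algebra_simps)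
        moreover have "c - \<theta> j \<le> 0"
          using blocked_step[OF x_blocked[OF pN(4)] feas[OF less.prems], of "c - \<theta> j"]
          by (simp add: Xm next_X pN algebra_simps)
        ultimately have "X m = X (Suc j)"
          using Xm next_X[OF pN(4)] by auto
        have "basis (f m) = basis (f (Suc j))"
          using basis_eq[of m] basis_eq[of "Suc j"] \<open>X m = X (Suc j)\<close> pN less.prems by simp
        then have "S p = S (Suc j)"
          using vertex[OF pN(2) less.prems prev(2) sel[of "Suc j"] prev(1), of "e (Suc j)"] prev(3,4)
            basis_e off(1)[of "Suc j"] \<open>X m = X (Suc j)\<close> S_ne[OF pN(4)] eq pN by auto
        then have "p = Suc j"
          using less.IH[of p] p pN(1) jp by (metis Suc_leI le_neq_implies_less lessI less_imp_le)
        then have "X m (e p) = X p (e p)"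
          using \<open>X m = X (Suc j)\<close> by simp
        then show False
          using next_X[OF pN(1), of "e p"] \<theta>[OF pN(1)] dir(1)[of p] pN(1) unfolding p by simp
      qed
    qed
  qed
  then show "m \<le> N \<Longrightarrow> j < m \<Longrightarrow> edge (f j) \<noteq> edge (f m)"
    unfolding S_def by blast
qed

section \<open>Complementarity and secondary rays\<close>

lemma multiplier_inner:
  "multiplier Y \<bullet> z = (\<Sum>i\<in>UNIV. Y (Lvar i) * (A *v z) $ i) + (\<Sum>j\<in>UNIV. Y (Wvar j) * z $ j)
    - (\<Sum>j\<in>UNIV. Y (Vvar j) * z $ j)"
proof -
  have "(transpose A *v v) \<bullet> z = v \<bullet> (A *v z)" for v
    using dot_lmul_matrix[of v A z] by simp
  then show ?thesis
    unfolding multiplier_def by (simp add: inner_add_left inner_diff_left) (simp add: inner_vec_def)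
qed

text \<open>Pairs every multiplier with the change of its own slack, so that the signs can be read
  off term by term.\<close>

lemma multiplier_inner_diff:
  assumes "A *v zvec X - svec X = A *v zvec X' - svec X'"
  shows "multiplier Y \<bullet> (zvec X' - zvec X) = (\<Sum>i\<in>UNIV. Y (Lvar i) * (X' (Svar i) - X (Svar i)))
    + (\<Sum>j\<in>UNIV. Y (Wvar j) * (X' (Zvar j) - X (Zvar j)))
    + (\<Sum>j\<in>UNIV. Y (Vvar j) * (X (Zvar j) - X' (Zvar j)))"
proof -
  have "A *v (zvec X' - zvec X) = svec X' - svec X"
    using assms by (simp add: matrix_vector_mult_diff_distrib algebra_simps)
  then show ?thesis
    unfolding multiplier_inner by (simp add: right_diff_distrib sum_subtractf)
qed

text \<open>Isolates the conditions on the multipliers, so that they also make sense for the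
  direction of a ray and for corrected multipliers, which are not themselves feasible
  assignments.\<close>

definition dual_feasible :: "('n, 'm) var set \<Rightarrow> (('n, 'm) var \<Rightarrow> real) \<Rightarrow> bool" where
  "dual_feasible S Y \<longleftrightarrow> (\<forall>i. Lvar i \<notin> S \<longrightarrow> Y (Lvar i) = 0) \<and> (\<forall>j. Wvar j \<notin> S \<longrightarrow> Y (Wvar j) = 0) \<and>
    (\<forall>j. Vvar j \<notin> S \<longrightarrow> Y (Vvar j) = 0) \<and> (\<forall>i. K i = Rplus \<longrightarrow> 0 \<le> Y (Lvar i)) \<and>
    (\<forall>i. K i = Rminus \<longrightarrow> Y (Lvar i) \<le> 0) \<and> (\<forall>j. 0 \<le> Y (Wvar j)) \<and> (\<forall>j. 0 \<le> Y (Vvar j))"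

lemma complementary_terms_nonneg:
  assumes S: "selection S" and X: "\<And>y. y \<notin> S \<Longrightarrow> X y = start_val S 0 y"
    and Y: "dual_feasible S Y" and X': "feasible X'"
  shows "0 \<le> Y (Lvar i) * (X' (Svar i) - X (Svar i))"
    and "0 \<le> Y (Wvar j) * (X' (Zvar j) - X (Zvar j))"
    and "0 \<le> Y (Vvar j) * (X (Zvar j) - X' (Zvar j))"
proof -
  show "0 \<le> Y (Lvar i) * (X' (Svar i) - X (Svar i))"
  proof (cases "Lvar i \<in> S")
    case True
    then have i: "i \<in> R" "Svar i \<notin> S"
      using S unfolding selection_iff by auto
    then have "lo (Svar i) \<le> ereal (X' (Svar i)) \<and> ereal (X' (Svar i)) \<le> hi (Svar i)" "X (Svar i) = 0"
      using bspec[OF X'[unfolded feasible_def], of "Svar i"] X[of "Svar i"] by simp_all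
    then show ?thesis
      using Y K_not_Rzero[OF i(1)] unfolding dual_feasible_def
      by (cases "K i") (auto intro: mult_nonneg_nonneg mult_nonpos_nonpos)
  qed (use Y in \<open>auto simp: dual_feasible_def\<close>)
  have bnd: "l j \<le> ereal (X' (Zvar j))" "ereal (X' (Zvar j)) \<le> u j"
    using X' unfolding feasible_def by (auto dest: bspec[of _ _ "Zvar j"])
  show "0 \<le> Y (Wvar j) * (X' (Zvar j) - X (Zvar j))"
  proof (cases "Wvar j \<in> S")
    case True
    then have "X (Zvar j) = real_of_ereal (l j)" "l j \<noteq> -\<infinity>"
      using S X[of "Zvar j"] unfolding selection_iff by auto
    then show ?thesis
      using bnd(1) l_not_inf[of j] Y unfolding dual_feasible_def
      by (cases "l j") (auto intro: mult_nonneg_nonneg)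
  qed (use Y in \<open>auto simp: dual_feasible_def\<close>)
  show "0 \<le> Y (Vvar j) * (X (Zvar j) - X' (Zvar j))"
  proof (cases "Vvar j \<in> S")
    case True
    then have "X (Zvar j) = real_of_ereal (u j)" "u j \<noteq> \<infinity>"
      using S X[of "Zvar j"] unfolding selection_iff by auto
    then show ?thesis
      using bnd(2) u_not_inf[of j] Y unfolding dual_feasible_def
      by (cases "u j") (auto intro: mult_nonneg_nonneg)
  qed (use Y in \<open>auto simp: dual_feasible_def\<close>)
qed

text \<open>A sum of nonnegative products of multipliers and slacks: this gives the normal-cone
  inequality, and complementary slackness in the case of equality.\<close>

lemma complementary_inner:
  assumes S: "selection S" and X: "\<And>y. y \<notin> S \<Longrightarrow> X y = start_val S 0 y"
    and Y: "dual_feasible S Y" and X': "feasible X'"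
    and eq: "A *v zvec X - svec X = A *v zvec X' - svec X'"
  shows "multiplier Y \<bullet> (zvec X' - zvec X) \<ge> 0"
    and "multiplier Y \<bullet> (zvec X' - zvec X) \<le> 0 \<Longrightarrow> Y (Lvar i) * (X' (Svar i) - X (Svar i)) = 0"
    and "multiplier Y \<bullet> (zvec X' - zvec X) \<le> 0 \<Longrightarrow> Y (Wvar j) * (X' (Zvar j) - X (Zvar j)) = 0"
    and "multiplier Y \<bullet> (zvec X' - zvec X) \<le> 0 \<Longrightarrow> Y (Vvar j) * (X (Zvar j) - X' (Zvar j)) = 0"
proof -
  note t = complementary_terms_nonneg[OF S X Y X']
  define s1 s2 s3 where "s1 = (\<Sum>i\<in>UNIV. Y (Lvar i) * (X' (Svar i) - X (Svar i)))"
    and "s2 = (\<Sum>j\<in>UNIV. Y (Wvar j) * (X' (Zvar j) - X (Zvar j)))"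
    and "s3 = (\<Sum>j\<in>UNIV. Y (Vvar j) * (X (Zvar j) - X' (Zvar j)))"
  have s: "s1 \<ge> 0" "s2 \<ge> 0" "s3 \<ge> 0"
    unfolding s1_def s2_def s3_def using t by (auto intro!: sum_nonneg)
  have eq': "multiplier Y \<bullet> (zvec X' - zvec X) = s1 + s2 + s3"
    unfolding s1_def s2_def s3_def by (rule multiplier_inner_diff[OF eq])
  then show "multiplier Y \<bullet> (zvec X' - zvec X) \<ge> 0"
    using s by simp
  assume "multiplier Y \<bullet> (zvec X' - zvec X) \<le> 0"
  then have "s1 = 0" "s2 = 0" "s3 = 0"
    using s unfolding eq' by linarith+
  then show "Y (Lvar i) * (X' (Svar i) - X (Svar i)) = 0"
    "Y (Wvar j) * (X' (Zvar j) - X (Zvar j)) = 0" "Y (Vvar j) * (X (Zvar j) - X' (Zvar j)) = 0"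
    unfolding s1_def s2_def s3_def using t by (simp_all add: sum_nonneg_eq_0_iff)
qed

text \<open>Every product vanishes, because a selection never contains both a multiplier and the
  primal variable of its constraint.\<close>

lemma complementary_direction_inner:
  assumes S: "selection S" and Y: "\<And>i. Lvar i \<notin> S \<Longrightarrow> Y (Lvar i) = 0"
      "\<And>j. Wvar j \<notin> S \<Longrightarrow> Y (Wvar j) = 0" "\<And>j. Vvar j \<notin> S \<Longrightarrow> Y (Vvar j) = 0"
    and D: "\<And>y. y \<notin> S \<Longrightarrow> D y = 0" "A *v zvec D = svec D"
  shows "multiplier Y \<bullet> zvec D = 0"
proof -
  have "Y (Lvar i) * D (Svar i) = 0" for i
  proof (cases "Lvar i \<in> S")
    case True
    then have "Svar i \<notin> S" using S unfolding selection_iff by auto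
    then show ?thesis using D(1) by simp
  qed (simp add: Y)
  moreover have "Y (Wvar j) * D (Zvar j) = 0 \<and> Y (Vvar j) * D (Zvar j) = 0" for j
  proof (cases "Zvar j \<in> S")
    case True
    then have "Wvar j \<notin> S" "Vvar j \<notin> S" using S unfolding selection_iff by blast+
    then show ?thesis using Y by simp
  qed (simp add: D(1))
  ultimately show ?thesis
    unfolding multiplier_inner D(2) by (simp only: vec_lambda_beta sum.neutral_const add_0 diff_self)
qed

section \<open>From assignments back to points of \<open>C\<close>, and the two ways in which a path
  can end\<close>

definition point :: "real^'n \<Rightarrow> ('n, 'm) var \<Rightarrow> real" where
  "point c x = (case x of Zvar j \<Rightarrow> c $ j | Svar i \<Rightarrow> (A *v c - b) $ i | _ \<Rightarrow> 0)"

lemma zvec_point [simp]: "zvec (point c) = c" and svec_point [simp]: "svec (point c) = A *v c - b"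
  by (simp_all add: point_def vec_eq_iff)

lemma feasible_point: "c \<in> C \<Longrightarrow> feasible (point c)"
  unfolding feasible_def
proof
  fix x assume c: "c \<in> C" and x: "x \<in> vars"
  show "lo x \<le> ereal (point c x) \<and> ereal (point c x) \<le> hi x"
  proof (cases x)
    case (Zvar j)
    then show ?thesis using c unfolding mem_C by (simp add: point_def)
  next
    case (Svar i)
    then have "(A *v c - b) $ i \<in> {x. lo (Svar i) \<le> ereal x \<and> ereal x \<le> hi (Svar i)}"
      using c x unfolding mem_C bounds_Svar by auto
    then show ?thesis using Svar by (simp add: point_def)
  next
    case (Lvar i)
    then show ?thesis by (cases "K i") (simp_all add: point_def zero_ereal_def)
  qed (simp_all add: point_def zero_ereal_def)
qed

lemma feasible_in_C:
  assumes "feasible X" "A *v zvec X - svec X = b"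
  shows "zvec X \<in> C"
  unfolding mem_C
proof (intro conjI ballI allI)
  fix i assume "i \<in> R"
  have "A *v zvec X - b = svec X"
    using assms(2) by (simp add: algebra_simps)
  then have "(A *v zvec X - b) $ i = X (Svar i)"
    by simp
  moreover have "X (Svar i) \<in> {x. lo (Svar i) \<le> ereal x \<and> ereal x \<le> hi (Svar i)}"
    using assms(1) \<open>i \<in> R\<close> unfolding feasible_def by (auto dest: bspec[of _ _ "Svar i"])
  ultimately show "(A *v zvec X - b) $ i \<in> factor_set (K i)"
    unfolding bounds_Svar by simp
next
  fix j
  show "l j \<le> ereal (zvec X $ j)" "ereal (zvec X $ j) \<le> u j"
    using assms(1) unfolding feasible_def by (auto dest: bspec[of _ _ "Zvar j"])
qed

lemma feasible_dual_feasible: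
  assumes "selection S" "feasible X" "\<And>y. y \<notin> S \<Longrightarrow> X y = start_val S 0 y"
  shows "dual_feasible S X"
proof -
  have off: "X (Lvar i) = 0" if "Lvar i \<notin> S" for i
    using assms(3)[OF that] by simp
  have R: "i \<in> R" if "Lvar i \<in> S" for i
    using assms(1) that unfolding selection_iff by auto
  have "K i = Rplus \<longrightarrow> 0 \<le> X (Lvar i)" "K i = Rminus \<longrightarrow> X (Lvar i) \<le> 0" for i
    using off[of i] R[of i] assms(2) unfolding feasible_def
    by (cases "Lvar i \<in> S"; force dest: bspec[of _ _ "Lvar i"])+
  moreover have "0 \<le> X (Wvar j)" for j
  proof (cases "Wvar j \<in> S")
    case True
    then have "Wvar j \<in> vars" using assms(1) unfolding selection_iff by blast
    then have "lo (Wvar j) \<le> ereal (X (Wvar j))" using assms(2) unfolding feasible_def by blast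
    then show ?thesis by simp
  qed (simp add: assms(3))
  moreover have "0 \<le> X (Vvar j)" for j
  proof (cases "Vvar j \<in> S")
    case True
    then have "Vvar j \<in> vars" using assms(1) unfolding selection_iff by blast
    then have "lo (Vvar j) \<le> ereal (X (Vvar j))" using assms(2) unfolding feasible_def by blast
    then show ?thesis by simp
  qed (simp add: assms(3))
  ultimately show ?thesis
    unfolding dual_feasible_def using assms(3) by simp
qed

lemma pval_tendsto_val: "((\<lambda>\<epsilon>. pval ps \<epsilon> s x) \<longlongrightarrow> val s x) (at_right 0)"
  unfolding pval_def lexval_def by (rule lexpoly_tendsto)

lemma feasible_val:
  assumes "\<forall>\<^sub>F \<epsilon> in at_right 0. feasible (pval ps \<epsilon> s)"
  shows "feasible (val s)"
  unfolding feasible_def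
proof
  fix x assume x: "x \<in> vars"
  have ev: "\<forall>\<^sub>F \<epsilon> in at_right 0. lo x \<le> ereal (pval ps \<epsilon> s x) \<and> ereal (pval ps \<epsilon> s x) \<le> hi x"
    using assms by (rule eventually_mono) (use x in \<open>auto simp: feasible_def\<close>)
  have "((\<lambda>\<epsilon>. ereal (pval ps \<epsilon> s x)) \<longlongrightarrow> ereal (val s x)) (at_right 0)"
    by (intro tendsto_intros pval_tendsto_val)
  from tendsto_lowerbound[OF this _ trivial_limit_at_right_real]
    tendsto_upperbound[OF this _ trivial_limit_at_right_real]
  show "lo x \<le> ereal (val s x) \<and> ereal (val s x) \<le> hi x"
    using ev by (simp add: eventually_conj_iff)
qed

text \<open>Weak inequalities survive the limit of \<epsilon> to 0, and \<open>val\<close> solves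
  the unperturbed system since it is \<open>pval\<close> for the empty list.\<close>

lemma valid_state_val:
  assumes "valid_state ps s"
  shows "feasible (val s)" "dual_feasible (edge s) (val s)"
    "\<And>y. y \<notin> edge s \<Longrightarrow> val s y = start_val (edge s) 0 y"
    "M *v zvec (val s) + q = multiplier (val s) + val s Tvar *\<^sub>R r"
    "A *v zvec (val s) - svec (val s) = b"
proof -
  show f: "feasible (val s)"
    using feasible_val valid_state_feasible[OF assms] .
  show off: "val s y = start_val (edge s) 0 y" if "y \<notin> edge s" for y
    using pval_off_edge(1)[OF assms that, of 0] pval_nonbasic[of y s ps 0] that
    unfolding edge_def val_def by simp
  show "dual_feasible (edge s) (val s)"
    using valid_stateD(4)[OF assms] f off by (rule feasible_dual_feasible)
  have "system (val s) = rhs"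
    using system_pval[OF valid_stateD(1)[OF assms], of "[]" 0] val_pval[of s 0] by simp
  moreover have "val s x = 0" if "x \<notin> vars" for x
    using off[of x] valid_stateD(8)[OF assms] that start_val_off_vars by auto
  ultimately have "(M *v zvec (val s) - multiplier (val s) - val s Tvar *\<^sub>R r,
      A *v zvec (val s) - svec (val s)) = (- q, b)"
    using system_eq[of "val s"] unfolding rhs_def by simp
  then show "M *v zvec (val s) + q = multiplier (val s) + val s Tvar *\<^sub>R r"
    "A *v zvec (val s) - svec (val s) = b"
    by (auto simp: algebra_simps)
qed

lemma valid_state_z:
  assumes "valid_state ps s"
  shows "zvec (val s) \<in> C" "dual_feasible (edge s) Y \<Longrightarrow> c \<in> C \<Longrightarrow> multiplier Y \<bullet> (c - zvec (val s)) \<ge> 0"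
proof -
  note V = valid_state_val[OF assms]
  show "zvec (val s) \<in> C"
    by (rule feasible_in_C[OF V(1,5)])
  show "multiplier Y \<bullet> (c - zvec (val s)) \<ge> 0" if "dual_feasible (edge s) Y" "c \<in> C"
    using complementary_inner(1)[OF valid_stateD(4)[OF assms] V(3) that(1) feasible_point[OF that(2)]] V(5)
    by simp
qed

text \<open>With t = 0 the vector \<open>M *v z + q\<close> is the multiplier, so the normal-cone
  inequality is the variational inequality; and \<open>x\<close> is \<open>z\<close> minus the
  multiplier, so it projects to \<open>z\<close>.\<close>

lemma solution_at_zero:
  assumes s: "valid_state ps s" and T: "val s Tvar = 0"
  shows "z_of s = closest_point C (x_of s)" "solves_AVI C q M (z_of s)"
proof -
  note V = valid_state_val[OF s]
  have z: "z_of s = zvec (val s)" unfolding z_of_def ..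
  have x: "x_of s = z_of s - multiplier (val s)"
    unfolding x_of_def multiplier_def by (simp add: algebra_simps)
  have n: "multiplier (val s) \<bullet> (c - z_of s) \<ge> 0" if "c \<in> C" for c
    using valid_state_z(2)[OF s V(2) that] unfolding z .
  show "solves_AVI C q M (z_of s)"
    unfolding solves_AVI_def using n V(4) T valid_state_z(1)[OF s] by (simp add: z)
  have "closest_point C (z_of s + - multiplier (val s)) = z_of s"
    by (rule closest_point_normal[OF C_closed C_convex])
      (use valid_state_z(1)[OF s] n in \<open>simp_all add: z normal_cone_def\<close>)
  then show "z_of s = closest_point C (x_of s)"
    unfolding x by simp
qed

lemma final_ray:
  assumes s: "valid_state ps s" and T: "val s Tvar \<noteq> 0"
    and ray: "\<And>x \<beta>. \<not> blocking s x \<beta>"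
    and cop: "copositive_on C M"
    and imp: "\<forall>z\<in>C. M *v z \<in> dual_cone C \<longrightarrow> z \<bullet> (M *v z) = 0 \<longrightarrow> z \<bullet> q \<ge> 0"
  shows "direction s (Zvar j) = 0" "direction s Tvar > 0" "zvec (val s) = 0"
    "feasible X \<Longrightarrow> \<theta> \<ge> 0 \<Longrightarrow> feasible (\<lambda>y. X y + \<theta> * direction s y)"
proof -
  note V = valid_state_val[OF s] and Z = valid_state_z[OF s] and S = valid_stateD(4)[OF s]
  define D where "D = direction s"
  have off: "D y = 0" if "y \<notin> edge s" for y
    using that unfolding D_def direction_def by simp
  \<comment> \<open>Nothing blocks, so a decreasing variable has no lower bound and, by
    \<open>nb'\<close>, an increasing one no upper bound.\<close>
  have nb: "lo y = -\<infinity>" if "D y < 0" "y \<in> vars" for y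
  proof -
    have "y \<in> edge s" "rate s y < 0" using that unfolding D_def direction_def by (auto split: if_splits)
    then show ?thesis
      using ray[of y] lo_not_infty[OF that(2)] unfolding blocking_def edge_def
      by (cases "lo y") auto
  qed
  have nb': "hi y = \<infinity>" if "D y > 0" "y \<in> vars" for y
  proof -
    have "y \<in> edge s" "rate s y > 0" using that unfolding D_def direction_def by (auto split: if_splits)
    then show ?thesis
      using ray[of y] hi_not_minfty[OF that(2)] unfolding blocking_def edge_def
      by (cases "hi y") auto
  qed
  have move: "feasible (\<lambda>y. X y + \<theta> * D y)" if "feasible X" "\<theta> \<ge> 0" for X \<theta>
    unfolding feasible_def
  proof
    fix y assume y: "y \<in> vars"
    have b: "lo y \<le> ereal (X y)" "ereal (X y) \<le> hi y"
      using that(1) y unfolding feasible_def by auto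
    consider "D y < 0" | "D y = 0" | "D y > 0" by linarith
    then show "lo y \<le> ereal (X y + \<theta> * D y) \<and> ereal (X y + \<theta> * D y) \<le> hi y"
    proof cases
      case 1
      have "ereal (X y + \<theta> * D y) \<le> ereal (X y)"
        using mult_nonneg_nonpos[OF that(2), of "D y"] 1 by simp
      from order_trans[OF this b(2)] show ?thesis using nb[OF 1 y] by simp
    next
      case 2
      then show ?thesis using b by simp
    next
      case 3
      have "ereal (X y) \<le> ereal (X y + \<theta> * D y)"
        using mult_nonneg_nonneg[OF that(2), of "D y"] 3 by simp
      from order_trans[OF b(1) this] show ?thesis using nb'[OF 3 y] by simp
    qed
  qed
  then show "feasible X \<Longrightarrow> \<theta> \<ge> 0 \<Longrightarrow> feasible (\<lambda>y. X y + \<theta> * direction s y)"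
    unfolding D_def by blast
  have dT: "D Tvar \<ge> 0"
    using nb[of Tvar] by (cases "D Tvar < 0") auto
  have dual: "dual_feasible (edge s) D"
  proof -
    have i: "i \<in> R" if "Lvar i \<in> edge s" for i
      using S that unfolding selection_iff by auto
    have "K i = Rplus \<longrightarrow> 0 \<le> D (Lvar i)" for i
      using nb[of "Lvar i"] i[of i] off[of "Lvar i"] by (cases "D (Lvar i) < 0"; cases "Lvar i \<in> edge s") auto
    moreover have "K i = Rminus \<longrightarrow> D (Lvar i) \<le> 0" for i
      using nb'[of "Lvar i"] i[of i] off[of "Lvar i"] by (cases "D (Lvar i) > 0"; cases "Lvar i \<in> edge s") auto
    moreover have "0 \<le> D (Wvar j)" for j
      using nb[of "Wvar j"] off[of "Wvar j"] S unfolding selection_iff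
      by (cases "D (Wvar j) < 0"; cases "Wvar j \<in> edge s") auto
    moreover have "0 \<le> D (Vvar j)" for j
      using nb[of "Vvar j"] off[of "Vvar j"] S unfolding selection_iff
      by (cases "D (Vvar j) < 0"; cases "Vvar j \<in> edge s") auto
    ultimately show ?thesis
      unfolding dual_feasible_def using off by simp
  qed
  have "system D = 0"
    unfolding D_def using valid_stateD(1-3)[OF s] by (rule system_direction)
  moreover have "D y = 0" if "y \<notin> vars" for y
    using off valid_stateD(8)[OF s] that by blast
  ultimately have "(M *v zvec D - multiplier D - D Tvar *\<^sub>R r, A *v zvec D - svec D) = 0"
    using system_eq[of D] by simp
  then have MD: "M *v zvec D = multiplier D + D Tvar *\<^sub>R r" and AD: "A *v zvec D = svec D"
    by (auto simp: algebra_simps zero_prod_def)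
  define d where "d = zvec D"
  define z where "z = zvec (val s)"
  have zC: "z \<in> C" unfolding z_def by (rule Z(1))
  \<comment> \<open>\<open>d\<close> is the limit of \<open>z + \<theta> *\<^sub>R d\<close> divided
    by \<theta>.\<close>
  have dC: "d \<in> C"
  proof -
    have "z + \<theta> *\<^sub>R d \<in> C" if "\<theta> \<ge> 0" for \<theta>
    proof -
      let ?X = "\<lambda>y. val s y + \<theta> * D y"
      have *: "zvec ?X = z + \<theta> *\<^sub>R d" "svec ?X = svec (val s) + \<theta> *\<^sub>R svec D"
        unfolding z_def d_def by (simp_all add: vec_eq_iff)
      have "A *v zvec ?X - svec ?X = b"
        unfolding * using V(5) AD unfolding z_def d_def
        by (simp add: matrix_vector_right_distrib matrix_vector_mult_scaleR)
      from feasible_in_C[OF move[OF V(1) that] this] show ?thesis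
        unfolding * .
    qed
    then have "(1 / real (Suc n)) *\<^sub>R (z + real (Suc n) *\<^sub>R d) \<in> C" for n
      using C_cone by (intro mem_cone) auto
    then have "\<forall>n. (1 / real (Suc n)) *\<^sub>R z + d \<in> C"
      by (simp add: scaleR_add_right del: of_nat_Suc)
    moreover have "(\<lambda>n. (1 / real (Suc n)) *\<^sub>R z + d) \<longlonglongrightarrow> 0 *\<^sub>R z + d"
      by (intro tendsto_intros LIMSEQ_Suc[OF lim_1_over_n])
    ultimately show "d \<in> C"
      using closed_sequentially[OF C_closed, of "\<lambda>n. (1 / real (Suc n)) *\<^sub>R z + d"] by simp
  qed
  have n: "multiplier D \<bullet> (c - z) \<ge> 0" if "c \<in> C" for c
    using Z(2)[OF dual that] unfolding z_def .
  \<comment> \<open>The normal-cone inequality is tested at twice \<open>z\<close> and at 0.\<close>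
  have mz: "multiplier D \<bullet> z = 0"
  proof -
    have "2 *\<^sub>R z \<in> C" using C_cone zC by (simp add: mem_cone)
    from n[OF this] n[OF zero_in_C] show ?thesis
      by (simp add: inner_diff_right)
  qed
  have orth: "multiplier D \<bullet> d = 0" "multiplier (val s) \<bullet> d = 0"
    unfolding d_def using dual V(2) unfolding dual_feasible_def
    by (intro complementary_direction_inner[OF S] off AD; simp)+
  have t: "val s Tvar > 0"
    using V(1) T unfolding feasible_def by (force dest: bspec[of _ _ Tvar])
  \<comment> \<open>Copositivity against \<open>r \<bullet> d < 0\<close> makes t constant along the
    ray. Then \<open>M *v d\<close> is the multiplier of the direction, hence in the dual cone, and
    the hypothesis on \<open>q\<close> applies. Now \<open>d \<bullet> (M *v z + q)\<close> is
    nonnegative, but equals a positive t times \<open>r \<bullet> d\<close>.\<close>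
  have d0: "d = 0"
  proof (rule ccontr)
    assume "d \<noteq> 0"
    then have rd: "r \<bullet> d < 0" using r_negative dC by blast
    have dMd: "d \<bullet> (M *v d) = D Tvar * (r \<bullet> d)"
      using orth(1) MD unfolding d_def[symmetric] by (simp add: inner_add_right inner_commute)
    have "d \<bullet> (M *v d) \<ge> 0" using cop dC unfolding copositive_on_def by blast
    then have "D Tvar = 0"
      using dMd rd dT by (smt (verit) mult_pos_neg)
    then have Md: "M *v d = multiplier D" "d \<bullet> (M *v d) = 0"
      using MD dMd unfolding d_def by auto
    have "M *v d \<in> dual_cone C"
      unfolding dual_cone_def Md(1) using n mz by (simp add: inner_diff_right)
    with imp dC Md(2) have "d \<bullet> q \<ge> 0" by blast
    moreover have "d \<bullet> (M *v z) \<ge> 0"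
      using copositive_flat_direction[OF cop C_convex C_cone zC dC Md(2)] mz unfolding Md(1)
      by (simp add: inner_commute)
    moreover have "d \<bullet> (M *v z + q) = val s Tvar * (r \<bullet> d)"
      using orth(2) unfolding z_def V(4) by (simp add: inner_add_right inner_commute)
    ultimately show False
      using mult_pos_neg[OF t rd] by (simp add: inner_add_right)
  qed
  then show "direction s (Zvar j) = 0"
    unfolding d_def D_def by (simp add: vec_eq_iff)
  have mr: "multiplier D = - (D Tvar *\<^sub>R r)"
    using MD d0 unfolding d_def[symmetric] by (simp add: eq_neg_iff_add_eq_0)
  \<comment> \<open>With constant t the multiplier vector of the direction is 0. Pairing it with an
    interior point, whose slacks are all strict, annihilates each single multiplier and thereby the
    whole direction.\<close>
  have "D Tvar \<noteq> 0"
  proof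
    assume "D Tvar = 0"
    then have "multiplier D = 0" using mr by simp
    obtain z0 where "z0 \<in> C" and z0: "\<And>i. i \<in> R \<Longrightarrow> lo (Svar i) < ereal ((A *v z0 - b) $ i) \<and>
        ereal ((A *v z0 - b) $ i) < hi (Svar i)"
      "\<And>j. l j < ereal (z0 $ j) \<and> ereal (z0 $ j) < u j"
      using interior_point by blast
    have "feasible (point z0)"
      by (rule feasible_point[OF \<open>z0 \<in> C\<close>])
    moreover have "A *v zvec (val s) - svec (val s) = A *v zvec (point z0) - svec (point z0)"
      using V(5) by simp
    ultimately have terms: "D (Lvar i) * (point z0 (Svar i) - val s (Svar i)) = 0"
        "D (Wvar j) * (point z0 (Zvar j) - val s (Zvar j)) = 0"
        "D (Vvar j) * (val s (Zvar j) - point z0 (Zvar j)) = 0" for i j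
      using complementary_inner(2-4)[OF S V(3) dual] \<open>multiplier D = 0\<close> by (metis inner_zero_left order_refl)+
    have "D (Lvar i) = 0" for i
    proof (cases "Lvar i \<in> edge s")
      case True
      then have i: "i \<in> R" "Svar i \<notin> edge s" using S unfolding selection_iff by auto
      have "point z0 (Svar i) \<noteq> 0"
        using z0(1)[OF i(1)] K_not_Rzero[OF i(1)] by (cases "K i") (auto simp: point_def zero_ereal_def)
      moreover have "val s (Svar i) = 0" using V(3)[OF i(2)] by simp
      ultimately show ?thesis using terms(1)[of i] by simp
    qed (simp add: off)
    moreover have "D (Wvar j) = 0" for j
    proof (cases "Wvar j \<in> edge s")
      case True
      then have "Zvar j \<notin> edge s" "l j \<noteq> -\<infinity>" using S unfolding selection_iff by auto
      then have "ereal (val s (Zvar j)) = l j"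
        using V(3)[of "Zvar j"] True l_not_inf[of j] by (cases "l j") auto
      then have "point z0 (Zvar j) \<noteq> val s (Zvar j)"
        using z0(2)[of j] unfolding point_def by auto
      then show ?thesis using terms(2)[of j] by simp
    qed (simp add: off)
    moreover have "D (Vvar j) = 0" for j
    proof (cases "Vvar j \<in> edge s")
      case True
      then have "Zvar j \<notin> edge s" "Wvar j \<notin> edge s" "u j \<noteq> \<infinity>" using S unfolding selection_iff by auto
      then have "ereal (val s (Zvar j)) = u j"
        using V(3)[of "Zvar j"] True u_not_inf[of j] by (cases "u j") auto
      then have "point z0 (Zvar j) \<noteq> val s (Zvar j)"
        using z0(2)[of j] unfolding point_def by auto
      then show ?thesis using terms(3)[of j] by simp
    qed (simp add: off)
    moreover have "D (Zvar j) = 0" for j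
      using d0 unfolding d_def by (simp add: vec_eq_iff)
    moreover have "svec D = 0"
      using d0 AD unfolding d_def[symmetric] by simp
    then have "D (Svar i) = 0" for i
      by (simp add: vec_eq_iff)
    ultimately have "D y = 0" for y
      using \<open>D Tvar = 0\<close> by (cases y) auto
    moreover have "D (entering s) \<noteq> 0"
      unfolding D_def direction_entering by (rule valid_stateD(9)[OF s])
    ultimately show False by blast
  qed
  with dT show "direction s Tvar > 0" unfolding D_def by simp
  \<comment> \<open>The multiplier of the direction is now a nonzero multiple of \<open>r\<close>,
    so \<open>mz\<close> applies to \<open>r\<close> itself.\<close>
  have "r \<bullet> z = 0"
    using mz \<open>D Tvar \<noteq> 0\<close> unfolding mr by simp
  then show "zvec (val s) = 0"
    using r_negative[OF zC] unfolding z_def by fastforce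
qed

section \<open>Uniqueness of the starting ray\<close>

lemma complementary_basis_iff:
  "complementary_basis B \<longleftrightarrow> is_basis B \<and> Tvar \<notin> B \<and> selection (insert Tvar B)"
  unfolding complementary_basis_def selection_def is_basis_def by auto

text \<open>Keeps from \<open>start\<close> only what the starting ray shares with a final ray, so
  that uniqueness can be applied to both.\<close>

definition ray_basis :: "((real^'n) \<times> (real^'m)) list \<Rightarrow> ('n, 'm) var set \<Rightarrow> real \<Rightarrow> bool" where
  "ray_basis ps B \<tau> \<longleftrightarrow> complementary_basis B \<and> \<tau> > 0 \<and>
    (\<forall>t\<ge>\<tau>. lex_feasible ps (start_state B t) \<and> z_of (start_state B t) = 0)"

section \<open>Moving \<open>t\<close> along the ray of a complementary basis\<close>

lemma start_state_simps [simp]: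
  "basis (start_state B t) = B" "nbval (start_state B t) = start_val B t"
  "entering (start_state B t) = Tvar" "dir (start_state B t) = -1"
  "edge (start_state B t) = insert Tvar B"
  unfolding start_state_def edge_def by simp_all

lemma start_val_insert_Tvar: "y \<noteq> Tvar \<Longrightarrow> start_val (insert Tvar B) t' y = start_val B t y"
  by (cases y) auto

lemma start_val_indep: "y \<noteq> Tvar \<Longrightarrow> start_val B t' y = start_val B t y"
  by (cases y) auto

lemma direction_start_state: "direction (start_state B t) = direction (start_state B t')"
  by (simp add: direction_def rate_def fun_eq_iff)

lemma pval_cong:
  assumes "basis s = basis s'" "\<And>y. y \<notin> basis s \<Longrightarrow> nbval s y = nbval s' y"
  shows "pval ps \<epsilon> s x = pval ps \<epsilon> s' x"
proof -
  have "(\<Sum>y\<in>vars - basis s. nbval s y *\<^sub>R col y) = (\<Sum>y\<in>vars - basis s'. nbval s' y *\<^sub>R col y)"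
    using assms by (intro sum.cong) auto
  then have "val s x = val s' x"
    using assms unfolding val_def by simp
  then show ?thesis
    using assms(1) unfolding pval_def lexval_def by (simp only: assms(1))
qed

text \<open>Changing t along the ray is the formal pivot in which \<open>Tvar\<close> enters and
  leaves at once, so the formula for a successor applies.\<close>

lemma pval_start_state_move:
  assumes "complementary_basis B" "set ps \<subseteq> equation_space"
  shows "pval ps \<epsilon> (start_state B t') y =
    pval ps \<epsilon> (start_state B t) y - (t' - t) * direction (start_state B t) y"
proof -
  let ?s = "start_state B t"
  have B: "is_basis B" "Tvar \<notin> B" using assms(1) unfolding complementary_basis_iff by auto
  have "pval ps \<epsilon> (start_state B t') y = pval ps \<epsilon> (successor ?s Tvar t') y"
    by (rule pval_cong)
      (use B(2) start_val_indep[of _ B t' t] in \<open>auto simp: successor_def\<close>)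
  also have "\<dots> = pval ps \<epsilon> ?s y + (t' - pval ps \<epsilon> ?s Tvar) / rate ?s Tvar * direction ?s y"
    by (rule pval_successor) (use assms(2) B in \<open>auto simp: rate_def\<close>)
  also have "pval ps \<epsilon> ?s Tvar = t"
    using B(2) by (simp add: pval_nonbasic)
  finally show ?thesis
    by (simp add: rate_def left_diff_distrib)
qed

lemma pval_start_off:
  assumes "y \<notin> insert Tvar B"
  shows "pval ps \<epsilon> (start_state B t) y = start_val (insert Tvar B) 0 y"
  using assms pval_nonbasic[of y "start_state B t"] start_val_insert_Tvar[of y B 0 t] by simp

lemma pval_start_off_vars:
  assumes "complementary_basis B" "y \<notin> vars"
  shows "pval ps \<epsilon> (start_state B t) y = 0"
proof -
  have "insert Tvar B \<subseteq> vars" using assms(1) unfolding complementary_basis_iff selection_iff by blast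
  then show ?thesis
    using assms(2) pval_start_off[of y B] start_val_off_vars[of y] by (metis subsetD)
qed

lemma lex_feasible_feasible:
  assumes "complementary_basis B" "lex_feasible ps (start_state B t)" "t \<ge> 0"
  shows "\<forall>\<^sub>F \<epsilon> in at_right 0. feasible (pval ps \<epsilon> (start_state B t))"
proof -
  have B: "B \<subseteq> vars" "Tvar \<notin> B" "selection (insert Tvar B)"
    using assms(1) unfolding complementary_basis_iff is_basis_def by auto
  have "\<forall>\<^sub>F \<epsilon> in at_right 0. lo x \<le> ereal (pval ps \<epsilon> (start_state B t) x) \<and>
      ereal (pval ps \<epsilon> (start_state B t) x) \<le> hi x" if x: "x \<in> vars" for x
  proof -
    consider "x \<in> B" | "x = Tvar" | "x \<notin> insert Tvar B" by blast
    then show ?thesis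
    proof cases
      case 1
      then show ?thesis
        using assms(2) lex_feasible_iff[of "start_state B t"] B(1) by simp
    next
      case 2
      then show ?thesis
        using B(2) assms(3) by (simp add: pval_nonbasic zero_ereal_def)
    next
      case 3
      then show ?thesis
        using start_val_off_selection[OF B(3) 3 x, of 0] lo_less_hi[OF x] by (auto simp: pval_start_off)
    qed
  qed
  then show ?thesis
    unfolding feasible_def by (intro eventually_ball_finite finite_vars) blast
qed

text \<open>A weak lexicographic inequality passes to prefixes. Cutting after the first n vectors
  leaves the constraints unperturbed.\<close>

lemma lex_feasible_take:
  assumes "lex_feasible ps s"
  shows "lex_feasible (take k ps) s"
proof -
  have "lexreal (take k ps) \<beta> = take (Suc k) (lexreal ps \<beta>)"
    "lexval (take k ps) s x = take (Suc k) (lexval ps s x)" for \<beta> x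
    unfolding lexreal_def lexval_def by (simp_all add: take_map)
  then show ?thesis
    using assms lexordp_eq_take[where k = "Suc k"] unfolding lex_feasible_def by metis
qed

lemma valid_start_state:
  assumes ps: "lex_order ps" and B: "ray_basis ps B \<tau>"
  shows "valid_state ps (start_state B \<tau>)"
proof -
  have B': "is_basis B" "Tvar \<notin> B" "selection (insert Tvar B)" "complementary_basis B" "\<tau> > 0"
    "lex_feasible ps (start_state B \<tau>)"
    using B unfolding ray_basis_def complementary_basis_iff by auto
  have "\<forall>\<^sub>F \<epsilon> in at_right 0. lo x < ereal (pval ps \<epsilon> (start_state B \<tau>) x) \<and>
      ereal (pval ps \<epsilon> (start_state B \<tau>) x) < hi x" if "x \<in> B" for x
    by (rule strictly_feasible[OF ps])
      (use that B' lex_feasible_iff[of "start_state B \<tau>"] in \<open>auto simp: is_basis_def\<close>)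
  then show ?thesis
    unfolding valid_state_def using B' by (auto simp: start_val_insert_Tvar[of _ B _ \<tau>])
qed

text \<open>The order of quantifiers matters: one \<epsilon> serves the whole ray. Feasibility of
  the unperturbed ray forbids it to approach any finite bound, and the direction is the same for
  every \<epsilon>.\<close>

lemma start_ray_unbounded:
  assumes ps: "lex_order ps" and B: "ray_basis ps B \<tau>"
  shows "\<forall>\<^sub>F \<epsilon> in at_right 0. \<forall>c\<ge>0.
    feasible (\<lambda>y. pval ps \<epsilon> (start_state B \<tau>) y - c * direction (start_state B \<tau>) y)"
proof -
  let ?s = "start_state B \<tau>"
  let ?D = "direction ?s"
  have B': "complementary_basis B" "\<tau> > 0" "\<And>t. t \<ge> \<tau> \<Longrightarrow> lex_feasible ps (start_state B t)"
    using B unfolding ray_basis_def by auto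
  have val_move: "val (start_state B t) y = val ?s y - (t - \<tau>) * ?D y" for t y
    using pval_start_state_move[OF B'(1), of "[]" 0 t y \<tau>] val_pval[of _ 0] by simp
  have f: "feasible (\<lambda>y. val ?s y - c * ?D y)" if "c \<ge> 0" for c
  proof -
    have "feasible (val (start_state B (\<tau> + c)))"
      by (rule feasible_val[OF lex_feasible_feasible[OF B'(1,3)]]) (use that B'(2) in auto)
    moreover have "val (start_state B (\<tau> + c)) = (\<lambda>y. val ?s y - c * ?D y)"
      using val_move[of "\<tau> + c"] by (intro ext) simp
    ultimately show ?thesis by simp
  qed
  have lo: "?D y \<le> 0" if "y \<in> vars" "lo y = ereal a" for y a
  proof (rule ccontr)
    assume "\<not> ?D y \<le> 0"
    then have "?D y > 0" by simp
    \<comment> \<open>At this \<open>c\<close> the value would have passed its bound by at least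
      1.\<close>
    define c where "c = (\<bar>val ?s y - a\<bar> + 1) / ?D y"
    have "c \<ge> 0" "c * ?D y = \<bar>val ?s y - a\<bar> + 1"
      using \<open>?D y > 0\<close> unfolding c_def by auto
    then show False
      using f[of c] that unfolding feasible_def by (auto dest!: bspec[of _ _ y])
  qed
  have hi: "?D y \<ge> 0" if "y \<in> vars" "hi y = ereal a" for y a
  proof (rule ccontr)
    assume "\<not> ?D y \<ge> 0"
    then have "?D y < 0" by simp
    define c where "c = (\<bar>val ?s y - a\<bar> + 1) / - ?D y"
    have "c \<ge> 0" "c * ?D y = - (\<bar>val ?s y - a\<bar> + 1)"
      using \<open>?D y < 0\<close> unfolding c_def by (auto intro: divide_nonneg_neg)
    then show False
      using f[of c] that unfolding feasible_def by (auto dest!: bspec[of _ _ y])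
  qed
  have "\<forall>\<^sub>F \<epsilon> in at_right 0. feasible (pval ps \<epsilon> ?s)"
    by (rule lex_feasible_feasible[OF B'(1,3)]) (use B'(2) in auto)
  then show ?thesis
  proof eventually_elim
    case (elim \<epsilon>)
    show ?case
      unfolding feasible_def
    proof (intro allI impI ballI conjI)
      fix c :: real and y assume c: "c \<ge> 0" and y: "y \<in> vars"
      have b: "lo y \<le> ereal (pval ps \<epsilon> ?s y)" "ereal (pval ps \<epsilon> ?s y) \<le> hi y"
        using elim y unfolding feasible_def by auto
      show "lo y \<le> ereal (pval ps \<epsilon> ?s y - c * ?D y)"
        using b(1) lo[OF y] lo_not_infty[OF y] mult_nonneg_nonpos[OF c, of "?D y"]
        by (cases "lo y") auto
      show "ereal (pval ps \<epsilon> ?s y - c * ?D y) \<le> hi y"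
        using b(2) hi[OF y] hi_not_minfty[OF y] mult_nonneg_nonneg[OF c, of "?D y"]
        by (cases "hi y") auto
    qed
  qed
qed

text \<open>On a final ray t increases while z stays at 0, so making \<open>Tvar\<close> nonbasic
  gives a complementary basis whose own ray is this one.\<close>

lemma final_ray_basis:
  assumes s: "valid_state ps s" and T: "val s Tvar \<noteq> 0" and ps: "lex_order ps"
    and ray: "\<And>x \<beta>. \<not> blocking s x \<beta>"
    and cop: "copositive_on C M"
    and imp: "\<forall>z\<in>C. M *v z \<in> dual_cone C \<longrightarrow> z \<bullet> (M *v z) = 0 \<longrightarrow> z \<bullet> q \<ge> 0"
  shows "\<exists>\<tau>. ray_basis ps (edge s - {Tvar}) \<tau>"
proof -
  let ?B = "edge s - {Tvar}"
  note F = final_ray[OF s T ray cop imp]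
  note D = valid_stateD[OF s]
  have Te: "Tvar \<in> edge s" using D(4) unfolding selection_iff by blast
  have rT: "rate s Tvar > 0" using F(2) Te by (simp only: direction_def if_True)
  have bs: "basis (successor s Tvar t) = ?B" for t
    unfolding successor_def edge_def by simp
  have basis: "is_basis ?B"
    using basis_successor[OF D(1-3) Te, of 0] rT unfolding bs by simp
  have ins: "insert Tvar ?B = edge s" using Te by blast
  have cb: "complementary_basis ?B"
    unfolding complementary_basis_iff ins using basis D(4) by simp
  have move: "pval ps' \<epsilon> (start_state ?B t) y =
      pval ps' \<epsilon> s y + (t - pval ps' \<epsilon> s Tvar) / rate s Tvar * direction s y"
    if "set ps' \<subseteq> equation_space" for ps' \<epsilon> t y
  proof -
    have "pval ps' \<epsilon> (start_state ?B t) y = pval ps' \<epsilon> (successor s Tvar t) y"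
    proof (rule pval_cong)
      show "basis (start_state ?B t) = basis (successor s Tvar t)"
        by (simp add: bs)
      fix y assume y: "y \<notin> basis (start_state ?B t)"
      show "nbval (start_state ?B t) y = nbval (successor s Tvar t) y"
        using y D(5)[of y] start_val_insert_Tvar[of y ?B 0 t] ins
        by (cases "y = Tvar") (auto simp: successor_def)
    qed
    also have "\<dots> = pval ps' \<epsilon> s y + (t - pval ps' \<epsilon> s Tvar) / rate s Tvar * direction s y"
      by (rule pval_successor) (use that D(1-3) Te rT in auto)
    finally show ?thesis .
  qed
  \<comment> \<open>The margin 1 keeps \<open>t\<close> above the perturbed value of
    \<open>Tvar\<close> for small \<epsilon>, so the step along the ray is nonnegative.\<close>
  have lexf: "lex_feasible ps (start_state ?B t)" if t: "t \<ge> \<bar>val s Tvar\<bar> + 1" for t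
  proof -
    have "\<forall>\<^sub>F \<epsilon> in at_right 0. pval ps \<epsilon> s Tvar < t"
      using pval_tendsto_val t by (intro order_tendstoD(2)) auto
    with valid_state_feasible[OF s]
    have "\<forall>\<^sub>F \<epsilon> in at_right 0. feasible (pval ps \<epsilon> (start_state ?B t))"
    proof eventually_elim
      case (elim \<epsilon>)
      then have "(t - pval ps \<epsilon> s Tvar) / rate s Tvar \<ge> 0"
        using rT by simp
      from F(4)[OF elim(1) this] show ?case
        by (simp add: move[OF lex_order_span(1)[OF ps], abs_def])
    qed
    then have "\<forall>x\<in>?B. \<forall>\<^sub>F \<epsilon> in at_right 0. lo x \<le> ereal (pval ps \<epsilon> (start_state ?B t) x) \<and>
        ereal (pval ps \<epsilon> (start_state ?B t) x) \<le> hi x"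
      using D(8) unfolding feasible_def by (auto elim!: eventually_mono)
    then show ?thesis
      using lex_feasible_iff[of "start_state ?B t"] D(8) by auto
  qed
  have z: "z_of (start_state ?B t) = 0" for t
  proof -
    have "val (start_state ?B t) (Zvar j) = 0" for j
      using move[of "[]" 0 t "Zvar j"] F(1)[of j] F(3) unfolding val_pval[of _ 0]
      by (simp add: vec_eq_iff)
    then show ?thesis unfolding z_of_def by (simp add: vec_eq_iff)
  qed
  have "ray_basis ps ?B (\<bar>val s Tvar\<bar> + 1)"
    unfolding ray_basis_def using cb lexf z by auto
  then show ?thesis ..
qed

section \<open>Perturbations of the first equation only\<close>

definition z_space :: "((real^'n) \<times> (real^'m)) set" where
  "z_space = {y. snd y = 0}"

lemma subspace_z_space: "subspace z_space"
  unfolding subspace_def z_space_def by auto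

lemma z_space_subset: "z_space \<subseteq> equation_space"
  unfolding z_space_def equation_space_def by auto

lemma dim_z_space: "dim z_space \<le> CARD('n)"
proof -
  define W where "W = range (\<lambda>j. (axis j 1 :: real^'n, 0 :: real^'m))"
  have "z_space \<subseteq> span W"
  proof
    fix y assume y: "y \<in> z_space"
    have "(\<Sum>j\<in>UNIV. (fst y $ j) *\<^sub>R axis j 1) = fst y"
      using basis_expansion[of "fst y"] by (simp add: scalar_mult_eq_scaleR)
    then have "y = (\<Sum>j\<in>UNIV. (fst y $ j) *\<^sub>R (axis j 1, 0))"
      using y by (simp add: prod_eq_iff fst_sum snd_sum z_space_def)
    also have "\<dots> \<in> span W"
      unfolding W_def by (intro span_sum span_scale span_base) auto
    finally show "y \<in> span W" .
  qed
  then have "dim z_space \<le> card W"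
    unfolding W_def by (intro dim_le_card) auto
  also have "card W \<le> CARD('n)"
    unfolding W_def by (rule card_image_le) simp
  finally show ?thesis .
qed

lemma span_first_perturbations:
  assumes "lex_order ps"
  shows "set (take CARD('n) ps) \<subseteq> z_space" "span (set (take CARD('n) ps)) = z_space"
proof -
  have *: "length ps = CARD('n) + card R" "distinct ps" "independent (set ps)"
    "\<forall>k<CARD('n). snd (ps ! k) = 0"
    using assms unfolding lex_order_def by auto
  show sub: "set (take CARD('n) ps) \<subseteq> z_space"
  proof
    fix p assume "p \<in> set (take CARD('n) ps)"
    then obtain i where "i < CARD('n)" "p = ps ! i"
      by (auto simp: in_set_conv_nth)
    then show "p \<in> z_space" using *(4) by (simp add: z_space_def)
  qed
  have "card (set (take CARD('n) ps)) = CARD('n)"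
    using *(1,2) by (simp add: distinct_card)
  moreover have "independent (set (take CARD('n) ps))"
    using *(3) by (rule independent_mono) (rule set_take_subset)
  ultimately have "z_space \<subseteq> span (set (take CARD('n) ps))"
    using sub dim_z_space by (intro card_ge_dim_independent) auto
  moreover have "span (set (take CARD('n) ps)) \<subseteq> z_space"
    using sub by (rule span_minimal) (rule subspace_z_space)
  ultimately show "span (set (take CARD('n) ps)) = z_space" by blast
qed

lemma system_start:
  assumes "complementary_basis B" "set ps \<subseteq> equation_space"
  shows "(M *v zvec (pval ps \<epsilon> (start_state B t)) - multiplier (pval ps \<epsilon> (start_state B t)) - t *\<^sub>R r,
      A *v zvec (pval ps \<epsilon> (start_state B t)) - svec (pval ps \<epsilon> (start_state B t))) = rhs + perturbation ps \<epsilon>"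
proof -
  have B: "is_basis B" "Tvar \<notin> B" using assms(1) unfolding complementary_basis_iff by auto
  have "pval ps \<epsilon> (start_state B t) Tvar = t"
    using B(2) by (simp add: pval_nonbasic)
  then show ?thesis
    using system_pval[of "start_state B t" ps \<epsilon>] B(1) assms(2)
      system_eq[OF pval_start_off_vars[OF assms(1)]] by simp
qed

text \<open>With z fixed at 0, only the multipliers can balance the change of
  \<open>t *\<^sub>R r\<close>; \<open>direction\<close> lowers t at rate 1, which explains the
  sign.\<close>

lemma ray_direction:
  assumes B: "ray_basis ps B \<tau>"
  shows "direction (start_state B t) (Zvar j) = 0" "multiplier (direction (start_state B t)) = r"
    "\<And>y. y \<notin> insert Tvar B \<Longrightarrow> direction (start_state B t) y = 0"
proof -
  have cb: "complementary_basis B" and z: "\<And>t j. t \<ge> \<tau> \<Longrightarrow> val (start_state B t) (Zvar j) = 0"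
    using B unfolding ray_basis_def z_of_def by (auto simp: vec_eq_iff)
  then have b: "is_basis B" "Tvar \<notin> B" "insert Tvar B \<subseteq> vars"
    unfolding complementary_basis_iff selection_def by auto
  have "val (start_state B (\<tau> + 1)) (Zvar j) =
      val (start_state B \<tau>) (Zvar j) - direction (start_state B \<tau>) (Zvar j)" for j
    using pval_start_state_move[OF cb, of "[]" 0 "\<tau> + 1" "Zvar j" \<tau>] val_pval[of _ 0] by simp
  then have "direction (start_state B \<tau>) (Zvar j) = 0" for j
    using z[of \<tau> j] z[of "\<tau> + 1" j] by simp
  then have Z: "direction (start_state B t) (Zvar j) = 0" for j
    using direction_start_state[of B t \<tau>] by simp
  then show "direction (start_state B t) (Zvar j) = 0" .
  show off: "direction (start_state B t) y = 0" if "y \<notin> insert Tvar B" for y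
    using that by (simp add: direction_def)
  let ?D = "direction (start_state B t)"
  have "system ?D = 0"
    by (rule system_direction) (use b in auto)
  moreover have "?D y = 0" if "y \<notin> vars" for y
    using off that b(3) by blast
  moreover have "?D Tvar = -1"
    using direction_entering[of "start_state B t"] by simp
  moreover have "zvec ?D = 0" using Z by (simp add: vec_eq_iff)
  ultimately show "multiplier ?D = r"
    using system_eq[of ?D] by (simp add: zero_prod_def)
qed

lemma multiplier_eq_0_inner:
  assumes S: "selection S" and Y: "\<And>y. y \<notin> S \<Longrightarrow> Y y = 0"
    and X: "\<And>y. y \<notin> S \<Longrightarrow> X y = start_val S 0 y" "\<And>y. y \<notin> S \<Longrightarrow> X' y = start_val S 0 y"
    and eq: "A *v zvec X - svec X = A *v zvec X' - svec X'"
  shows "multiplier Y \<bullet> (zvec X' - zvec X) = 0"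
proof -
  have "A *v (zvec X' - zvec X) = svec X' - svec X"
    using eq by (simp add: matrix_vector_mult_diff_distrib algebra_simps)
  moreover have "zvec (\<lambda>y. X' y - X y) = zvec X' - zvec X" "svec (\<lambda>y. X' y - X y) = svec X' - svec X"
    by (simp_all add: vec_eq_iff)
  ultimately show ?thesis
    using complementary_direction_inner[OF S, of Y "\<lambda>y. X' y - X y"] Y X by simp
qed

text \<open>Perturbing only the first equation keeps the ray at the vertex 0.\<close>

lemma ray_basis_z_coeff:
  assumes ps: "lex_order ps" and B: "ray_basis ps B \<tau>" and y: "y \<in> z_space"
  shows "Zvar j \<in> B \<Longrightarrow> coeff B y (Zvar j) = 0" "Svar i \<in> B \<Longrightarrow> coeff B y (Svar i) = 0"
proof -
  let ?s = "start_state B \<tau>" and ?ps = "take CARD('n) ps"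
  have cb: "complementary_basis B" "\<tau> > 0" "lex_feasible ps ?s" and z0: "\<And>j. val ?s (Zvar j) = 0"
    using B unfolding ray_basis_def z_of_def by (auto simp: vec_eq_iff)
  then have b: "is_basis B" "Tvar \<notin> B" "selection (insert Tvar B)" "B \<subseteq> vars"
    unfolding complementary_basis_iff is_basis_def by auto
  note P = span_first_perturbations[OF ps]
  have ps': "set ?ps \<subseteq> equation_space"
    using P(1) z_space_subset by blast
  have snd_pert: "snd (perturbation ?ps \<epsilon>) = 0" for \<epsilon>
  proof -
    have "set qs \<subseteq> z_space \<Longrightarrow> snd (perturbation qs \<epsilon>) = 0" for qs
      by (induction qs) (auto simp: z_space_def)
    then show ?thesis using P(1) by blast
  qed
  have val_eq: "A *v zvec (val ?s) - svec (val ?s) = b"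
    using system_start[OF cb(1), of "[]" 0 \<tau>] val_pval[of ?s 0] by (simp add: rhs_def)
  have "\<forall>\<^sub>F \<epsilon> in at_right 0. feasible (pval ?ps \<epsilon> ?s)"
    using lex_feasible_feasible[OF cb(1) lex_feasible_take[OF cb(3)]] cb(2) by simp
  then have ev: "\<forall>\<^sub>F \<epsilon> in at_right 0. \<forall>j. pval ?ps \<epsilon> ?s (Zvar j) = 0"
  proof eventually_elim
    case (elim \<epsilon>)
    let ?X = "pval ?ps \<epsilon> ?s"
    have eq: "A *v zvec ?X - svec ?X = b"
      using system_start[OF cb(1) ps', of \<epsilon> \<tau>] snd_pert by (auto simp: rhs_def prod_eq_iff)
    have inC: "zvec ?X \<in> C"
      by (rule feasible_in_C[OF elim eq])
    have "multiplier (\<lambda>y. if y = Tvar then 0 else direction ?s y) \<bullet> (zvec ?X - zvec (val ?s)) = 0"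
    proof (rule multiplier_eq_0_inner[OF b(3)])
      fix y assume y: "y \<notin> insert Tvar B"
      show "?X y = start_val (insert Tvar B) 0 y" by (rule pval_start_off[OF y])
      show "val ?s y = start_val (insert Tvar B) 0 y"
        using pval_start_off[OF y, of "[]" 0 \<tau>] val_pval[of ?s 0] by simp
      show "(if y = Tvar then 0 else direction ?s y) = 0"
        using ray_direction(3)[OF B y] by simp
    qed (simp add: eq val_eq)
    moreover have "multiplier (\<lambda>y. if y = Tvar then 0 else direction ?s y) = multiplier (direction ?s)"
      by (simp add: multiplier_def)
    moreover have "zvec (val ?s) = 0"
      using z0 by (simp add: vec_eq_iff)
    \<comment> \<open>The perturbed and the unperturbed vertex share their nonbasic values, so their
      difference is orthogonal to the multiplier \<open>r\<close> of the ray. The only point of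
      \<open>C\<close> orthogonal to \<open>r\<close> is 0.\<close>
    ultimately have "r \<bullet> zvec ?X = 0"
      using ray_direction(2)[OF B, of \<tau>] by simp
    then have "zvec ?X = 0"
      using r_negative[OF inC] by fastforce
    then show ?case
      by (simp add: vec_eq_iff)
  qed
  \<comment> \<open>A polynomial that vanishes for small \<epsilon> has zero coefficients, and these
    are the coordinates of the first n vectors.\<close>
  have zc: "coeff B p (Zvar j) = 0" if "p \<in> set ?ps" "Zvar j \<in> B" for p j
  proof -
    have "\<forall>\<^sub>F \<epsilon> in at_right 0. lexpoly (lexval ?ps ?s (Zvar j)) \<epsilon> = 0"
      using ev by (rule eventually_mono) (simp add: pval_def)
    then have "lexval ?ps ?s (Zvar j) = replicate (Suc (length ?ps)) 0"
      using eventually_lexpoly_zero by fastforce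
    then have "map (\<lambda>p. coeff B p (Zvar j)) ?ps = replicate (length ?ps) 0"
      using that(2) unfolding lexval_def by simp
    then show ?thesis
      using that(1) by (metis (no_types, lifting) in_set_conv_nth length_map nth_map nth_replicate)
  qed
  have Z: "coeff B y (Zvar j) = 0" if "Zvar j \<in> B" for j
    using coeff_vanishing_on_span[OF b(1) that ps' zc] that y P(2) by blast
  then show "Zvar j \<in> B \<Longrightarrow> coeff B y (Zvar j) = 0" .
  show "coeff B y (Svar i) = 0" if i: "Svar i \<in> B"
  proof -
    define X where "X x = (if x \<in> B then coeff B y x else 0)" for x
    have "system X = (\<Sum>x\<in>B. coeff B y x *\<^sub>R col x)"
      unfolding system_def X_def using b(4) finite_vars by (intro sum.mono_neutral_cong_right) auto
    also have "\<dots> = y"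
      using coeff_expand[OF b(1)] y z_space_subset by blast
    finally have "snd (system X) = 0"
      using y unfolding z_space_def by simp
    moreover have "X x = 0" if "x \<notin> vars" for x
      using that b(4) unfolding X_def by auto
    moreover have "zvec X = 0"
      using Z unfolding X_def by (simp add: vec_eq_iff)
    ultimately have "svec X = 0"
      using system_eq[of X] by simp
    then have "X (Svar i) = 0"
      by (simp add: vec_eq_iff)
    then show ?thesis
      using i unfolding X_def by simp
  qed
qed

text \<open>For such right-hand sides the coordinates on z vanish, so \<open>M\<close> drops out of
  the first equation and the multipliers alone absorb \<open>v\<close>.\<close>

lemma ray_basis_multiplier:
  assumes ps: "lex_order ps" and B: "ray_basis ps B \<tau>"
  shows "multiplier (\<lambda>x. if x \<in> B then coeff B (v, 0) x else 0) = - v"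
proof -
  have b: "is_basis B" "Tvar \<notin> B" "B \<subseteq> vars"
    using B unfolding ray_basis_def complementary_basis_iff is_basis_def by auto
  have y: "(v, 0) \<in> z_space" unfolding z_space_def by simp
  let ?X = "\<lambda>x. if x \<in> B then coeff B (v, 0) x else 0"
  have "system ?X = (\<Sum>x\<in>B. coeff B (v, 0) x *\<^sub>R col x)"
    unfolding system_def using b(3) finite_vars by (intro sum.mono_neutral_cong_right) auto
  also have "\<dots> = (v, 0)"
    using coeff_expand[OF b(1)] y z_space_subset by blast
  finally have "system ?X = (v, 0)" .
  moreover have "?X x = 0" if "x \<notin> vars" for x
    using that b(3) by auto
  moreover have "zvec ?X = 0"
    using ray_basis_z_coeff(1)[OF ps B y] by (simp add: vec_eq_iff)
  moreover have "?X Tvar = 0" using b(2) by simp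
  ultimately have "(- multiplier ?X, - svec ?X) = (v, 0)"
    using system_eq[of ?X] by (simp only: ) simp
  then show ?thesis by (auto simp: minus_equation_iff)
qed

text \<open>The unperturbed value and the first n coefficients vanish; only the vectors that perturb
  the constraints move the vertex.\<close>

lemma ray_basis_z_order:
  assumes ps: "lex_order ps" and B: "ray_basis ps B \<tau>" and t: "t \<ge> \<tau>"
  shows "\<exists>g L. (g \<longlongrightarrow> L) (at_right 0) \<and>
    (\<forall>\<epsilon>. pval ps \<epsilon> (start_state B t) (Zvar j) = \<epsilon> ^ Suc CARD('n) * g \<epsilon>)"
proof -
  let ?a = "lexval ps (start_state B t) (Zvar j)"
  have z: "val (start_state B t) (Zvar j) = 0"
    using B t unfolding ray_basis_def z_of_def by (auto simp: vec_eq_iff)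
  have "coeff B p (Zvar j) = 0" if "p \<in> set (take CARD('n) ps)" "Zvar j \<in> B" for p
    using ray_basis_z_coeff(1)[OF ps B _ that(2)] that(1) span_first_perturbations(1)[OF ps] by blast
  then have "map (\<lambda>p. if Zvar j \<in> B then coeff B p (Zvar j) else 0) (take CARD('n) ps) =
      map (\<lambda>_. 0) (take CARD('n) ps)"
    by (intro map_cong) auto
  then have "take (Suc CARD('n)) ?a = 0 # map (\<lambda>_. 0) (take CARD('n) ps)"
    using z unfolding lexval_def by (auto simp: take_map)
  then have "lexpoly (take (Suc CARD('n)) ?a) \<epsilon> = 0" for \<epsilon>
    by simp
  then have "pval ps \<epsilon> (start_state B t) (Zvar j) = \<epsilon> ^ Suc CARD('n) * lexpoly (drop (Suc CARD('n)) ?a) \<epsilon>" for \<epsilon>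
    unfolding pval_def using lexpoly_split[of ?a \<epsilon> "Suc CARD('n)"] by simp
  then show ?thesis
    using lexpoly_bounded by blast
qed

text \<open>In the multipliers the perturbation of the first equation dominates the effect of moving
  the vertex, which is of order \<open>\<epsilon>\<close> to the power \<open>n + 1\<close>.\<close>

lemma ray_basis_multiplier_sign:
  assumes ps: "lex_order ps" and B1: "ray_basis ps B1 \<tau>1" and B2: "ray_basis ps B2 \<tau>2"
    and t: "t \<ge> \<tau>1" "t \<ge> \<tau>2" and x: "x \<in> B1" "col x \<in> z_space"
  defines "Y \<equiv> \<lambda>\<epsilon>. pval ps \<epsilon> (start_state B1 t) x + coeff B1
    (M *v (zvec (pval ps \<epsilon> (start_state B1 t)) - zvec (pval ps \<epsilon> (start_state B2 t))), 0) x"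
  shows "lo x = 0 \<Longrightarrow> \<forall>\<^sub>F \<epsilon> in at_right 0. Y \<epsilon> > 0" "hi x = 0 \<Longrightarrow> \<forall>\<^sub>F \<epsilon> in at_right 0. Y \<epsilon> < 0"
proof -
  let ?n = "CARD('n)"
  let ?s = "start_state B1 t"
  have b: "is_basis B1" and lf: "lex_feasible ps ?s"
    using B1 t(1) unfolding ray_basis_def complementary_basis_iff by auto
  obtain g1 L1 where g1: "\<And>j. (g1 j \<longlongrightarrow> L1 j) (at_right 0)"
    "\<And>j \<epsilon>. pval ps \<epsilon> ?s (Zvar j) = \<epsilon> ^ Suc ?n * g1 j \<epsilon>"
    using ray_basis_z_order[OF ps B1 t(1)] by metis
  obtain g2 L2 where g2: "\<And>j. (g2 j \<longlongrightarrow> L2 j) (at_right 0)"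
    "\<And>j \<epsilon>. pval ps \<epsilon> (start_state B2 t) (Zvar j) = \<epsilon> ^ Suc ?n * g2 j \<epsilon>"
    using ray_basis_z_order[OF ps B2 t(2)] by metis
  define G where "G \<epsilon> = (\<chi> j. g1 j \<epsilon> - g2 j \<epsilon>)" for \<epsilon>
  have G: "(G \<longlongrightarrow> (\<chi> j. L1 j - L2 j)) (at_right 0)"
    unfolding G_def by (intro tendsto_vec_lambda tendsto_diff g1(1) g2(1))
  have zG: "zvec (pval ps \<epsilon> ?s) - zvec (pval ps \<epsilon> (start_state B2 t)) = \<epsilon> ^ Suc ?n *\<^sub>R G \<epsilon>" for \<epsilon>
    unfolding G_def by (simp add: vec_eq_iff g1(2) g2(2) algebra_simps)
  \<comment> \<open>The correction of a multiplier is linear in the displacement of the vertex,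
    hence of the same order in \<epsilon>.\<close>
  define h where "h v = coeff B1 (M *v v, 0) x" for v
  have es: "(v, 0) \<in> equation_space" for v
    using z_space_subset unfolding z_space_def by auto
  have h: "h (v + w) = h v + h w" "h (c *\<^sub>R v) = c * h v" for v w c
    using coeff_add[OF b es es x(1)] coeff_scale[OF b es x(1)] unfolding h_def
    by (simp_all add: matrix_vector_right_distrib matrix_vector_mult_scaleR flip: add_Pair scaleR_Pair)
      (metis add_Pair add_0, metis scaleR_Pair scaleR_zero_right)
  then have "linear h" by (intro linearI) auto
  then have "bounded_linear h" by (rule linear_conv_bounded_linear[THEN iffD1])
  then have hG: "((\<lambda>\<epsilon>. h (G \<epsilon>)) \<longlongrightarrow> h (\<chi> j. L1 j - L2 j)) (at_right 0)"
    using G by (rule bounded_linear.tendsto)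
  let ?v = "lexval ps ?s x"
  define a where "a = take (Suc ?n) ?v"
  have "length ps \<ge> ?n"
    using ps unfolding lex_order_def by simp
  then have len: "length a = Suc ?n" unfolding a_def by simp
  obtain L where L: "(lexpoly (drop (Suc ?n) ?v) \<longlongrightarrow> L) (at_right 0)"
    using lexpoly_bounded by blast
  have Y: "Y \<epsilon> = lexpoly a \<epsilon> + \<epsilon> ^ length a * (lexpoly (drop (Suc ?n) ?v) \<epsilon> + h (G \<epsilon>))" for \<epsilon>
  proof -
    have "Y \<epsilon> = pval ps \<epsilon> ?s x + \<epsilon> ^ Suc ?n * h (G \<epsilon>)"
      unfolding Y_def zG h_def[symmetric] h(2) ..
    also have "pval ps \<epsilon> ?s x = lexpoly a \<epsilon> + \<epsilon> ^ Suc ?n * lexpoly (drop (Suc ?n) ?v) \<epsilon>"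
      unfolding pval_def a_def by (rule lexpoly_split)
    finally show ?thesis
      unfolding len by (simp only: distrib_left add.assoc)
  qed
  have "lexreal (take ?n ps) 0 = replicate (length a) 0"
    using \<open>length ps \<ge> ?n\<close> unfolding lexreal_def len by (simp add: map_replicate_const)
  moreover have "lexval (take ?n ps) ?s x = a"
    unfolding a_def lexval_def by (simp add: take_map)
  ultimately have le: "lo x = 0 \<Longrightarrow> lexordp_eq (replicate (length a) 0) a"
    "hi x = 0 \<Longrightarrow> lexordp_eq a (replicate (length a) 0)"
    using lex_feasible_take[OF lf, of ?n] x(1) unfolding lex_feasible_def zero_ereal_def by force+
  \<comment> \<open>The first n vectors span \<open>z_space\<close>, which contains the column of
    \<open>x\<close>; one of them must have a nonzero coordinate at \<open>x\<close>.\<close>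
  have ne: "a \<noteq> replicate (length a) 0"
  proof
    assume "a = replicate (length a) 0"
    then have "map (\<lambda>p. coeff B1 p x) (take ?n ps) = replicate ?n 0"
      using x(1) unfolding len unfolding a_def lexval_def by (simp add: take_map)
    then have "coeff B1 p x = 0" if "p \<in> set (take ?n ps)" for p
      using that by (metis (no_types, lifting) in_set_replicate image_eqI list.set_map)
    moreover have "set (take ?n ps) \<subseteq> equation_space"
      using span_first_perturbations(1)[OF ps] z_space_subset by blast
    ultimately have "coeff B1 (col x) x = 0"
      using coeff_vanishing_on_span[OF b x(1)] x(2) span_first_perturbations(2)[OF ps] by blast
    then show False
      using coeff_col[OF b x(1)] by simp
  qed
  show "\<forall>\<^sub>F \<epsilon> in at_right 0. Y \<epsilon> > 0" if "lo x = 0"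
  proof -
    have "ord_class.lexordp (replicate (length a) 0) a"
      using le(1)[OF that] ne by (metis lexordp_conv_lexordp_eq lexordp_eq_antisym)
    from lex_positive_dominates[OF this tendsto_add[OF L hG]] show ?thesis
      unfolding Y .
  qed
  show "\<forall>\<^sub>F \<epsilon> in at_right 0. Y \<epsilon> < 0" if "hi x = 0"
  proof -
    have "ord_class.lexordp a (replicate (length a) 0)"
      using le(2)[OF that] ne by (metis lexordp_conv_lexordp_eq lexordp_eq_antisym)
    from lex_positive_dominates[OF lexordp_zeros_uminus[OF this] tendsto_minus[OF tendsto_add[OF L hG]]]
    show ?thesis
      by (rule eventually_mono) (simp add: Y lexpoly_uminus algebra_simps)
  qed
qed

text \<open>Adding to the multipliers of the first ray the coordinates of \<open>M\<close> applied
  to the difference of the two vertices makes both rays carry the same normal vector, and by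
  dominance the corrected multipliers keep strict signs. The normal-cone inequalities at the two
  vertices are then opposite, so both are equalities, and each constraint with a multiplier in
  \<open>B1\<close> is tight at the second vertex.\<close>

lemma ray_basis_duals_subset:
  assumes ps: "lex_order ps" and B1: "ray_basis ps B1 \<tau>1" and B2: "ray_basis ps B2 \<tau>2"
  shows "Lvar i \<in> B1 \<Longrightarrow> Lvar i \<in> B2" "Wvar j \<in> B1 \<Longrightarrow> Wvar j \<in> B2" "Vvar j \<in> B1 \<Longrightarrow> Vvar j \<in> B2"
proof -
  define t where "t = max \<tau>1 \<tau>2"
  have t: "t \<ge> \<tau>1" "t \<ge> \<tau>2" unfolding t_def by auto
  have cb: "complementary_basis B1" "complementary_basis B2" "lex_feasible ps (start_state B1 t)"
    "lex_feasible ps (start_state B2 t)" "t \<ge> 0"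
    using B1 B2 t unfolding ray_basis_def by auto
  then have S: "selection (insert Tvar B1)" "selection (insert Tvar B2)" and b: "is_basis B1" "is_basis B2"
    unfolding complementary_basis_iff by auto
  have sub: "B1 \<subseteq> vars" "B2 \<subseteq> vars" using b unfolding is_basis_def by auto
  define X1 where "X1 \<epsilon> = pval ps \<epsilon> (start_state B1 t)" for \<epsilon>
  define X2 where "X2 \<epsilon> = pval ps \<epsilon> (start_state B2 t)" for \<epsilon>
  define \<mu> where "\<mu> \<epsilon> x = (if x \<in> B1 then coeff B1 (M *v (zvec (X1 \<epsilon>) - zvec (X2 \<epsilon>)), 0) x else 0)" for \<epsilon> x
  define Y where "Y \<epsilon> x = X1 \<epsilon> x + \<mu> \<epsilon> x" for \<epsilon> x
  have sign: "\<forall>\<^sub>F \<epsilon> in at_right 0. (lo x = 0 \<longrightarrow> Y \<epsilon> x > 0) \<and> (hi x = 0 \<longrightarrow> Y \<epsilon> x < 0)"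
    if x: "x \<in> B1" "col x \<in> z_space" for x
    using ray_basis_multiplier_sign[OF ps B1 B2 t x] x(1)
    unfolding Y_def \<mu>_def X1_def X2_def by (cases "lo x = 0"; cases "hi x = 0") (auto simp: eventually_conj_iff)
  have "\<forall>\<^sub>F \<epsilon> in at_right 0. \<forall>x\<in>{x \<in> B1. col x \<in> z_space}. (lo x = 0 \<longrightarrow> Y \<epsilon> x > 0) \<and> (hi x = 0 \<longrightarrow> Y \<epsilon> x < 0)"
    by (intro eventually_ball_finite finite_vars) (use sign in blast)
  moreover have "\<forall>\<^sub>F \<epsilon> in at_right 0. feasible (X1 \<epsilon>)" "\<forall>\<^sub>F \<epsilon> in at_right 0. feasible (X2 \<epsilon>)"
    unfolding X1_def X2_def using lex_feasible_feasible cb by blast+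
  moreover have "\<forall>\<^sub>F \<epsilon> in at_right 0. \<forall>x\<in>B2. lo x < ereal (X2 \<epsilon> x) \<and> ereal (X2 \<epsilon> x) < hi x"
  proof (intro eventually_ball_finite finite_vars ballI)
    fix x assume x: "x \<in> B2"
    show "\<forall>\<^sub>F \<epsilon> in at_right 0. lo x < ereal (X2 \<epsilon> x) \<and> ereal (X2 \<epsilon> x) < hi x"
      unfolding X2_def
      by (rule strictly_feasible[OF ps]) (use x b(2) cb(4) lex_feasible_iff[of "start_state B2 t"] sub in auto)
  qed
  ultimately have "\<forall>\<^sub>F \<epsilon> in at_right 0. (\<forall>x\<in>{x \<in> B1. col x \<in> z_space}.
        (lo x = 0 \<longrightarrow> Y \<epsilon> x > 0) \<and> (hi x = 0 \<longrightarrow> Y \<epsilon> x < 0))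
      \<and> feasible (X1 \<epsilon>) \<and> feasible (X2 \<epsilon>) \<and> (\<forall>x\<in>B2. lo x < ereal (X2 \<epsilon> x) \<and> ereal (X2 \<epsilon> x) < hi x)"
    by eventually_elim blast
  from eventually_happens'[OF trivial_limit_at_right_real this] obtain \<epsilon>
    where sign: "\<And>x. x \<in> B1 \<Longrightarrow> col x \<in> z_space \<Longrightarrow> (lo x = 0 \<longrightarrow> Y \<epsilon> x > 0) \<and> (hi x = 0 \<longrightarrow> Y \<epsilon> x < 0)"
      and feas: "feasible (X1 \<epsilon>)" "feasible (X2 \<epsilon>)"
      and strict: "\<And>x. x \<in> B2 \<Longrightarrow> lo x < ereal (X2 \<epsilon> x) \<and> ereal (X2 \<epsilon> x) < hi x"
    by blast
  have off1: "X1 \<epsilon> y = start_val (insert Tvar B1) 0 y" if "y \<notin> insert Tvar B1" for y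
    unfolding X1_def by (rule pval_start_off[OF that])
  have off2: "X2 \<epsilon> y = start_val (insert Tvar B2) 0 y" if "y \<notin> insert Tvar B2" for y
    unfolding X2_def by (rule pval_start_off[OF that])
  have Yoff: "Y \<epsilon> (Lvar i) = 0" if "Lvar i \<notin> B1" for i
    using off1[of "Lvar i"] that unfolding Y_def \<mu>_def by simp
  have YoffW: "Y \<epsilon> (Wvar j) = 0" if "Wvar j \<notin> B1" for j
    using off1[of "Wvar j"] that unfolding Y_def \<mu>_def by simp
  have YoffV: "Y \<epsilon> (Vvar j) = 0" if "Vvar j \<notin> B1" for j
    using off1[of "Vvar j"] that unfolding Y_def \<mu>_def by simp
  have signL: "K i = Rplus \<Longrightarrow> Y \<epsilon> (Lvar i) > 0" "K i = Rminus \<Longrightarrow> Y \<epsilon> (Lvar i) < 0" if "Lvar i \<in> B1" for i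
    using sign[OF that] unfolding z_space_def by simp_all
  have signW: "Y \<epsilon> (Wvar j) > 0" if "Wvar j \<in> B1" for j
    using sign[OF that] unfolding z_space_def by simp
  have signV: "Y \<epsilon> (Vvar j) > 0" if "Vvar j \<in> B1" for j
    using sign[OF that] unfolding z_space_def by simp
  have dual: "dual_feasible (insert Tvar B1) (Y \<epsilon>)"
    unfolding dual_feasible_def
  proof (intro conjI allI impI)
    fix i
    show "K i = Rplus \<Longrightarrow> 0 \<le> Y \<epsilon> (Lvar i)" "K i = Rminus \<Longrightarrow> Y \<epsilon> (Lvar i) \<le> 0"
      using signL[of i] Yoff[of i] by (cases "Lvar i \<in> B1"; simp)+
  next
    fix j
    show "0 \<le> Y \<epsilon> (Wvar j)" using signW[of j] YoffW[of j] by (cases "Wvar j \<in> B1") auto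
    show "0 \<le> Y \<epsilon> (Vvar j)" using signV[of j] YoffV[of j] by (cases "Vvar j \<in> B1") auto
  qed (use Yoff YoffW YoffV in auto)
  note sys = lex_order_span(1)[OF ps, THEN system_start[OF cb(1)], of \<epsilon> t, folded X1_def]
    lex_order_span(1)[OF ps, THEN system_start[OF cb(2)], of \<epsilon> t, folded X2_def]
  note sys12 = trans[OF sys(1) sys(2)[symmetric]]
  have eq: "A *v zvec (X1 \<epsilon>) - svec (X1 \<epsilon>) = A *v zvec (X2 \<epsilon>) - svec (X2 \<epsilon>)"
    using sys12 by (simp only: prod.inject)
  have "M *v zvec (X1 \<epsilon>) - multiplier (X1 \<epsilon>) - t *\<^sub>R r = M *v zvec (X2 \<epsilon>) - multiplier (X2 \<epsilon>) - t *\<^sub>R r"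
    using sys12 by (simp only: prod.inject)
  then have "multiplier (X2 \<epsilon>) = multiplier (X1 \<epsilon>) - M *v zvec (X1 \<epsilon>) + M *v zvec (X2 \<epsilon>)"
    by (simp add: algebra_simps)
  moreover have "multiplier (Y \<epsilon>) = multiplier (X1 \<epsilon>) + multiplier (\<mu> \<epsilon>)"
  proof -
    have "(\<chi> i. Y \<epsilon> (Lvar i)) = (\<chi> i. X1 \<epsilon> (Lvar i)) + (\<chi> i. \<mu> \<epsilon> (Lvar i))"
      "(\<chi> i. Y \<epsilon> (Wvar i)) = (\<chi> i. X1 \<epsilon> (Wvar i)) + (\<chi> i. \<mu> \<epsilon> (Wvar i))"
      "(\<chi> i. Y \<epsilon> (Vvar i)) = (\<chi> i. X1 \<epsilon> (Vvar i)) + (\<chi> i. \<mu> \<epsilon> (Vvar i))"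
      unfolding Y_def by (simp_all add: vec_eq_iff)
    then show ?thesis
      unfolding multiplier_def by (simp add: matrix_vector_right_distrib)
  qed
  moreover have "multiplier (\<mu> \<epsilon>) = - (M *v (zvec (X1 \<epsilon>) - zvec (X2 \<epsilon>)))"
    unfolding \<mu>_def by (rule ray_basis_multiplier[OF ps B1])
  ultimately have mY: "multiplier (Y \<epsilon>) = multiplier (X2 \<epsilon>)"
    by (simp add: matrix_vector_mult_diff_distrib)
  \<comment> \<open>The inequality at the second vertex, tested at the first. With the common
    multiplier it reverses the one at the first vertex, so each product of \<open>Y\<close> with a
    slack vanishes.\<close>
  have "multiplier (X2 \<epsilon>) \<bullet> (zvec (X1 \<epsilon>) - zvec (X2 \<epsilon>)) \<ge> 0"
    using S(2) off2 feasible_dual_feasible[OF S(2) feas(2) off2] feas(1) eq[symmetric]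
    by (rule complementary_inner(1))
  then have "multiplier (Y \<epsilon>) \<bullet> (zvec (X2 \<epsilon>) - zvec (X1 \<epsilon>)) \<le> 0"
    unfolding mY by (simp add: inner_diff_right)
  note terms = complementary_inner(2-4)[OF S(1) off1 dual feas(2) eq this]
  \<comment> \<open>The tight slack cannot be in \<open>B2\<close>, since variables of
    \<open>B2\<close> are strictly inside their bounds at the second vertex; so its multiplier
    is.\<close>
  show "Lvar i \<in> B2" if "Lvar i \<in> B1"
  proof -
    have i: "i \<in> R" "Svar i \<notin> insert Tvar B1"
      using S(1) that unfolding selection_iff by auto
    have "X2 \<epsilon> (Svar i) = 0"
      using terms(1)[of i] off1[OF i(2)] signL[OF that] K_not_Rzero[OF i(1)] by (cases "K i") auto
    then have "Svar i \<notin> B2"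
      using strict[of "Svar i"] by (cases "K i") (auto simp: zero_ereal_def)
    then show ?thesis
      using S(2) i(1) unfolding selection_iff by auto
  qed
  show "Wvar j \<in> B2" if "Wvar j \<in> B1"
  proof -
    have j: "Zvar j \<notin> insert Tvar B1" "l j \<noteq> -\<infinity>"
      using S(1) that unfolding selection_iff by auto
    then have "ereal (X1 \<epsilon> (Zvar j)) = l j"
      using off1[OF j(1)] that l_not_inf[of j] by (cases "l j") auto
    moreover have "X2 \<epsilon> (Zvar j) = X1 \<epsilon> (Zvar j)"
      using terms(2)[of j] signW[OF that] by simp
    ultimately have l: "ereal (X2 \<epsilon> (Zvar j)) = l j" by simp
    then have "Zvar j \<notin> B2"
      using strict[of "Zvar j"] by auto
    \<comment> \<open>\<open>Vvar\<close> in \<open>B2\<close> would put the second vertex at the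
      upper bound, but it is at the lower one.\<close>
    moreover have "Vvar j \<notin> B2"
    proof
      assume V: "Vvar j \<in> B2"
      then have "Wvar j \<notin> B2" "u j \<noteq> \<infinity>" using S(2) unfolding selection_iff by auto
      then have "ereal (X2 \<epsilon> (Zvar j)) = u j"
        using off2[of "Zvar j"] V \<open>Zvar j \<notin> B2\<close> u_not_inf[of j] by (cases "u j") auto
      then show False using l l_less_u[of j] by simp
    qed
    ultimately show ?thesis
      using S(2) unfolding selection_iff by auto
  qed
  show "Vvar j \<in> B2" if "Vvar j \<in> B1"
  proof -
    have j: "Zvar j \<notin> insert Tvar B1" "Wvar j \<notin> B1" "u j \<noteq> \<infinity>"
      using S(1) that unfolding selection_iff by auto
    then have "ereal (X1 \<epsilon> (Zvar j)) = u j"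
      using off1[OF j(1)] that u_not_inf[of j] by (cases "u j") auto
    moreover have "X2 \<epsilon> (Zvar j) = X1 \<epsilon> (Zvar j)"
      using terms(3)[of j] signV[OF that] by simp
    ultimately have u: "ereal (X2 \<epsilon> (Zvar j)) = u j" by simp
    then have "Zvar j \<notin> B2"
      using strict[of "Zvar j"] by auto
    moreover have "Wvar j \<notin> B2"
    proof
      assume W: "Wvar j \<in> B2"
      then have "l j \<noteq> -\<infinity>" using S(2) unfolding selection_iff by auto
      then have "ereal (X2 \<epsilon> (Zvar j)) = l j"
        using off2[of "Zvar j"] W \<open>Zvar j \<notin> B2\<close> l_not_inf[of j] by (cases "l j") auto
      then show False using u l_less_u[of j] by simp
    qed
    ultimately show ?thesis
      using S(2) unfolding selection_iff by auto
  qed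
qed

text \<open>By symmetry both bases select the same multipliers, and these determine which primal
  variables are selected.\<close>

lemma ray_basis_unique:
  assumes ps: "lex_order ps" and B1: "ray_basis ps B1 \<tau>1" and B2: "ray_basis ps B2 \<tau>2"
  shows "B1 = B2"
proof -
  have S: "selection (insert Tvar B1)" "selection (insert Tvar B2)" "Tvar \<notin> B1" "Tvar \<notin> B2"
    using B1 B2 unfolding ray_basis_def complementary_basis_iff by auto
  have L: "Lvar i \<in> B1 \<longleftrightarrow> Lvar i \<in> B2" for i
    using ray_basis_duals_subset(1)[OF ps B1 B2] ray_basis_duals_subset(1)[OF ps B2 B1] by blast
  have W: "Wvar j \<in> B1 \<longleftrightarrow> Wvar j \<in> B2" for j
    using ray_basis_duals_subset(2)[OF ps B1 B2] ray_basis_duals_subset(2)[OF ps B2 B1] by blast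
  have V: "Vvar j \<in> B1 \<longleftrightarrow> Vvar j \<in> B2" for j
    using ray_basis_duals_subset(3)[OF ps B1 B2] ray_basis_duals_subset(3)[OF ps B2 B1] by blast
  have Z: "Zvar j \<in> B \<longleftrightarrow> Wvar j \<notin> B \<and> Vvar j \<notin> B" and Sv: "Svar i \<in> B \<longleftrightarrow> i \<in> R \<and> Lvar i \<notin> B"
    if "selection (insert Tvar B)" for B j i
    using that unfolding selection_iff by auto
  have "x \<in> B1 \<longleftrightarrow> x \<in> B2" for x
    using L W V Z[OF S(1)] Z[OF S(2)] Sv[OF S(1)] Sv[OF S(2)] S(3,4) by (cases x) auto
  then show ?thesis by blast
qed

section \<open>Termination\<close>

lemma leaving_exists:
  assumes "blocking s x \<beta>"
  shows "\<exists>x \<beta>. leaving ps s x \<beta>"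
proof -
  let ?P = "{(x, \<beta>). blocking s x \<beta>}"
  have "?P \<subseteq> (\<lambda>x. (x, real_of_ereal (lo x))) ` UNIV \<union> (\<lambda>x. (x, real_of_ereal (hi x))) ` UNIV"
    unfolding blocking_def by (force simp: image_iff)
  then have "finite ?P"
    using finite_UNIV_var finite_subset by (metis (no_types, lifting) finite_UnI finite_imageI)
  moreover have "?P \<noteq> {}" using assms by blast
  ultimately obtain p where "p \<in> ?P"
    "\<forall>p'\<in>?P. lexordp_eq (ratio ps s (fst p) (snd p)) (ratio ps s (fst p') (snd p'))"
    using lexordp_eq_finite_minimum[of ?P "\<lambda>p. ratio ps s (fst p) (snd p)"] by blast
  then show ?thesis
    unfolding leaving_def by (cases p) auto
qed

lemma valid_state_path:
  assumes "valid_state ps s0" "lex_order ps" "(pivot ps)\<^sup>*\<^sup>* s0 s"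
  shows "valid_state ps s"
  using assms(3)
proof induction
  case (step s s')
  then show ?case
    using valid_successor[OF _ assms(2)] unfolding pivot_iff by blast
qed (rule assms(1))

lemma path_edges_distinct:
  assumes ps: "lex_order ps" and B: "ray_basis ps B \<tau>"
    and f: "f 0 = start_state B \<tau>" "\<And>i. i < N \<Longrightarrow> pivot ps (f i) (f (Suc i))"
    and T: "val (f N) Tvar \<noteq> 0" and jm: "j < m" "m \<le> N"
  shows "edge (f j) \<noteq> edge (f m)"
proof -
  have valid: "valid_state ps (f i)" if "i \<le> N" for i
    using that
  proof (induction i)
    case (Suc i)
    then show ?case
      using valid_state_path[OF _ ps, of "f i" "f (Suc i)"] f(2)[of i] by auto
  qed (simp add: f(1) valid_start_state[OF ps B])
  have "\<forall>i. \<exists>x \<beta>. i < N \<longrightarrow> leaving ps (f i) x \<beta> \<and> f (Suc i) = successor (f i) x \<beta>"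
    using f(2) unfolding pivot_iff by blast
  then obtain x \<beta> where step:
    "\<And>i. i < N \<Longrightarrow> leaving ps (f i) (x i) (\<beta> i) \<and> f (Suc i) = successor (f i) (x i) (\<beta> i)"
    by metis
  have "val (f i) Tvar \<noteq> 0" if "i \<le> N" for i
    using f(2)[of i] T that unfolding pivot_iff by (cases "i = N") auto
  then show ?thesis
    by (intro edges_distinct[where f = f and ps = ps and N = N and x = x and \<beta> = \<beta>])
      (use ps valid step start_ray_unbounded[OF ps B] f(1) jm in auto)
qed

lemma start_finds_solution:
  assumes start: "start C 0 ps s0"
    and cop: "copositive_on C M"
    and imp: "\<forall>z\<in>C. M *v z \<in> dual_cone C \<longrightarrow> z \<bullet> (M *v z) = 0 \<longrightarrow> z \<bullet> q \<ge> 0"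
  shows "finds_solution_from C ps s0"
proof -
  obtain B \<tau> where ps: "lex_order ps" and B: "ray_basis ps B \<tau>" and s0: "s0 = start_state B \<tau>"
    using start unfolding start_def ray_basis_def by blast
  have valid0: "valid_state ps s0"
    unfolding s0 by (rule valid_start_state[OF ps B])
  have TB: "Tvar \<notin> B"
    using B unfolding ray_basis_def complementary_basis_iff by blast
  have "\<nexists>f. f 0 = s0 \<and> (\<forall>k. pivot ps (f k) (f (Suc k)))"
  proof
    assume "\<exists>f. f 0 = s0 \<and> (\<forall>k. pivot ps (f k) (f (Suc k)))"
    then obtain f where f: "f 0 = start_state B \<tau>" "\<And>k. pivot ps (f k) (f (Suc k))"
      unfolding s0 by blast
    have "edge (f j) \<noteq> edge (f m)" if "j < m" for j m
      by (rule path_edges_distinct[where f = f and ps = ps and B = B and \<tau> = \<tau> and N = m])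
        (use ps B f that in \<open>auto simp: pivot_iff\<close>)
    then have "inj (\<lambda>k. edge (f k))"
      by (metis injI linorder_neqE_nat)
    moreover have "finite (range (\<lambda>k. edge (f k)))"
      by (rule finite_subset[OF subset_UNIV]) (metis Pow_UNIV finite_Pow_iff finite_vars)
    ultimately show False
      using finite_imageD infinite_UNIV_nat by blast
  qed
  moreover have "val s Tvar = 0" if s: "(pivot ps)\<^sup>*\<^sup>* s0 s" "\<nexists>s'. pivot ps s s'" for s
  proof (rule ccontr)
    assume T: "val s Tvar \<noteq> 0"
    have valid: "valid_state ps s"
      by (rule valid_state_path[OF valid0 ps s(1)])
    have ray: "\<not> blocking s x \<beta>" for x \<beta>
      using leaving_exists[of s x \<beta> ps] s(2) T unfolding pivot_iff by blast
    obtain \<tau>' where "ray_basis ps (edge s - {Tvar}) \<tau>'"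
      using final_ray_basis[OF valid T ps ray cop imp] by blast
    then have "edge s - {Tvar} = B"
      by (rule ray_basis_unique[OF ps _ B])
    moreover have "Tvar \<in> edge s"
      using valid_stateD(4)[OF valid] unfolding selection_iff by blast
    ultimately have "edge s = edge s0"
      unfolding s0 by auto
    from rtranclp_imp_relpowp[OF s(1)] obtain N where "(pivot ps ^^ N) s0 s" by blast
    then obtain f where f: "f 0 = s0" "f N = s" "\<forall>i<N. pivot ps (f i) (f (Suc i))"
      unfolding relpowp_fun_conv by blast
    show False
    \<comment> \<open>The starting state is no ray, since \<open>Tvar\<close> is blocked there by
      its bound 0; a longer path would repeat the edge of the start.\<close>
    proof (cases "N = 0")
      case True
      then have "s = start_state B \<tau>" using f s0 by simp
      then have "blocking s Tvar 0"
        unfolding blocking_def by (simp add: rate_def zero_ereal_def)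
      then show False using ray by blast
    next
      case False
      have "edge (f 0) \<noteq> edge (f N)"
        by (rule path_edges_distinct[where f = f and ps = ps and B = B and \<tau> = \<tau> and N = N])
          (use ps B f T s0 False in auto)
      then show False
        using f \<open>edge s = edge s0\<close> by simp
    qed
  qed
  moreover have "z_of s = closest_point C (x_of s) \<and> solves_AVI C q M (z_of s)"
    if "(pivot ps)\<^sup>*\<^sup>* s0 s" "val s Tvar = 0" for s
    using solution_at_zero[OF valid_state_path[OF valid0 ps that(1)] that(2)] by blast
  ultimately show ?thesis
    unfolding finds_solution_from_def by blast
qed

section \<open>Existence of a starting basis\<close>

text \<open>The constraints that are tight at 0, each named by its multiplier variable.\<close>

definition active :: "('n, 'm) var set" where
  "active = {x. (\<exists>i\<in>R. x = Lvar i \<and> b $ i = 0) \<or> (\<exists>j. x = Wvar j \<and> l j = 0) \<or> (\<exists>j. x = Vvar j \<and> u j = 0)}"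

text \<open>Multipliers of \<open>Rminus\<close> rows are nonpositive; the sign turns all active
  gradients into outward normals with nonnegative coefficients.\<close>

definition sign :: "('n, 'm) var \<Rightarrow> real" where
  "sign x = (case x of Lvar i \<Rightarrow> if K i = Rminus then -1 else 1 | _ \<Rightarrow> 1)"

definition normal :: "('n, 'm) var \<Rightarrow> real^'n" where
  "normal x = sign x *\<^sub>R fst (col x)"

lemma sign_sq: "sign x * sign x = 1"
  unfolding sign_def by (cases x) auto

lemma fst_col: "fst (col x) = sign x *\<^sub>R normal x"
  unfolding normal_def by (simp add: sign_sq)

text \<open>Inactive constraints hold strictly at 0 and survive a small step; active ones are
  controlled by their normals.\<close>

lemma small_multiple_in_C:
  assumes d: "\<And>x. x \<in> active \<Longrightarrow> normal x \<bullet> d \<le> 0"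
  shows "\<exists>\<eta>>0. \<eta> *\<^sub>R d \<in> C"
proof -
  have row: "\<forall>\<^sub>F \<eta> in at_right 0. (A *v (\<eta> *\<^sub>R d) - b) $ i \<in> factor_set (K i)" if i: "i \<in> R" for i
  proof -
    have eq: "(A *v (\<eta> *\<^sub>R d) - b) $ i = \<eta> * (row i A \<bullet> d) - b $ i" for \<eta>
      by (simp add: A_nth)
    have b: "- b $ i \<in> factor_set (K i)"
      using zero_in_C i unfolding mem_C by simp
    show ?thesis
    proof (cases "b $ i = 0")
      case True
      then have "normal (Lvar i) \<bullet> d \<le> 0"
        using i by (intro d) (simp add: active_def)
      then have "\<eta> * (row i A \<bullet> d) - b $ i \<in> factor_set (K i)" if "\<eta> > 0" for \<eta>
        using K_not_Rzero[OF i] True that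
        by (cases "K i") (auto simp: normal_def sign_def mult_nonneg_nonpos)
      then show ?thesis
        unfolding eq using eventually_at_right_less[of "0::real"] by (rule eventually_mono[rotated])
    next
      case False
      have lim: "((\<lambda>\<eta>. \<eta> * (row i A \<bullet> d) - b $ i) \<longlongrightarrow> 0 * (row i A \<bullet> d) - b $ i) (at_right 0)"
        by (intro tendsto_intros)
      show ?thesis
      proof (cases "K i")
        case Rplus
        then have "0 * (row i A \<bullet> d) - b $ i > 0" using b False by simp
        from order_tendstoD(1)[OF lim this] show ?thesis
          unfolding eq by (rule eventually_mono) (simp add: Rplus)
      next
        case Rminus
        then have "0 * (row i A \<bullet> d) - b $ i < 0" using b False by simp
        from order_tendstoD(2)[OF lim this] show ?thesis
          unfolding eq by (rule eventually_mono) (simp add: Rminus)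
      qed (use K_not_Rzero[OF i] in blast)
    qed
  qed
  have lim: "((\<lambda>\<eta>. ereal (\<eta> * d $ j)) \<longlongrightarrow> ereal (0 * d $ j)) (at_right 0)" for j
    by (intro tendsto_intros)
  have lower: "\<forall>\<^sub>F \<eta> in at_right 0. l j \<le> ereal ((\<eta> *\<^sub>R d) $ j)" for j
  proof (cases "l j = 0")
    case True
    then have "normal (Wvar j) \<bullet> d \<le> 0"
      by (intro d) (simp add: active_def)
    then have "d $ j \<ge> 0"
      by (simp add: normal_def sign_def inner_axis inner_commute)
    then have "l j \<le> ereal ((\<eta> *\<^sub>R d) $ j)" if "\<eta> > 0" for \<eta>
      using True that by (simp add: zero_ereal_def)
    then show ?thesis
      using eventually_at_right_less[of "0::real"] by (rule eventually_mono[rotated])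
  next
    case False
    then have "l j < ereal (0 * d $ j)" using l_le[of j] by (simp add: zero_ereal_def[symmetric])
    from order_tendstoD(1)[OF lim this] show ?thesis
      by (rule eventually_mono) simp
  qed
  have upper: "\<forall>\<^sub>F \<eta> in at_right 0. ereal ((\<eta> *\<^sub>R d) $ j) \<le> u j" for j
  proof (cases "u j = 0")
    case True
    then have "normal (Vvar j) \<bullet> d \<le> 0"
      by (intro d) (simp add: active_def)
    then have "d $ j \<le> 0"
      by (simp add: normal_def sign_def inner_axis inner_commute)
    then have "ereal ((\<eta> *\<^sub>R d) $ j) \<le> u j" if "\<eta> > 0" for \<eta>
      using True that by (simp add: zero_ereal_def mult_nonneg_nonpos)
    then show ?thesis
      using eventually_at_right_less[of "0::real"] by (rule eventually_mono[rotated])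
  next
    case False
    then have "ereal (0 * d $ j) < u j" using u_ge[of j] by (simp add: zero_ereal_def[symmetric])
    from order_tendstoD(2)[OF lim this] show ?thesis
      by (rule eventually_mono) simp
  qed
  have "\<forall>\<^sub>F \<eta> in at_right 0. \<forall>i\<in>R. (A *v (\<eta> *\<^sub>R d) - b) $ i \<in> factor_set (K i)"
    using row by (intro eventually_ball_finite) auto
  moreover have "\<forall>\<^sub>F \<eta> in at_right 0. \<forall>j\<in>UNIV. l j \<le> ereal ((\<eta> *\<^sub>R d) $ j) \<and> ereal ((\<eta> *\<^sub>R d) $ j) \<le> u j"
    by (intro eventually_ball_finite ballI eventually_conj lower upper) simp
  ultimately have "\<forall>\<^sub>F \<eta> in at_right 0. \<eta> > 0 \<and> \<eta> *\<^sub>R d \<in> C"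
    using eventually_at_right_less[of "0::real"]
    by eventually_elim (auto simp: mem_C)
  then show ?thesis
    using eventually_happens'[OF trivial_limit_at_right_real] by blast
qed

text \<open>Farkas' lemma by separation: a vector outside the cone of active normals is separated
  from it by a direction that has a small positive multiple in \<open>C\<close>, against
  normality.\<close>

lemma normal_cone_subset_hull: "normal_cone C 0 \<subseteq> convex_cone hull (normal ` active)"
proof
  let ?H = "convex_cone hull (normal ` active)"
  fix y assume y: "y \<in> normal_cone C 0"
  show "y \<in> ?H"
  proof (rule ccontr)
    assume "y \<notin> ?H"
    have H: "closed ?H" "convex ?H"
      by (simp_all add: closed_convex_cone_hull finite_vars convex_convex_cone_hull)
    then obtain a b0 where ab: "a \<bullet> y < b0" "\<And>h. h \<in> ?H \<Longrightarrow> a \<bullet> h > b0"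
      using separating_hyperplane_closed_point \<open>y \<notin> ?H\<close> by metis
    have "b0 < 0" using ab(2)[OF convex_cone_hull_contains_0] by simp
    have "a \<bullet> h \<ge> 0" if "h \<in> ?H" for h
    proof (rule ccontr)
      assume neg: "\<not> a \<bullet> h \<ge> 0"
      then have "(b0 / (a \<bullet> h)) *\<^sub>R h \<in> ?H"
        using \<open>b0 < 0\<close> that by (intro convex_cone_hull_mul) (auto simp: divide_nonpos_neg)
      from ab(2)[OF this] neg show False by simp
    qed
    then have "a \<bullet> normal x \<ge> 0" if "x \<in> active" for x
      using hull_inc[OF imageI[OF that]] by blast
    then have "normal x \<bullet> (- a) \<le> 0" if "x \<in> active" for x
      using that by (simp add: inner_commute)
    then obtain \<eta> where \<eta>: "\<eta> > 0" "\<eta> *\<^sub>R (- a) \<in> C"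
      using small_multiple_in_C by blast
    then have "y \<bullet> (\<eta> *\<^sub>R (- a) - 0) \<le> 0"
      using y unfolding normal_cone_def by blast
    then have "y \<bullet> a \<ge> 0"
      using \<eta>(1) by (simp add: zero_le_mult_iff)
    then show False
      using ab(1) \<open>b0 < 0\<close> by (simp add: inner_commute)
  qed
qed

lemma normal_in_normal_cone: "x \<in> active \<Longrightarrow> normal x \<in> normal_cone C 0"
proof -
  assume x: "x \<in> active"
  have "normal x \<bullet> c \<le> 0" if c: "c \<in> C" for c
  proof -
    consider i where "i \<in> R" "x = Lvar i" "b $ i = 0"
      | j where "x = Wvar j" "l j = 0" | j where "x = Vvar j" "u j = 0"
      using x unfolding active_def by blast
    then show ?thesis
    proof cases
      case 1
      then have "(A *v c - b) $ i \<in> factor_set (K i)"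
        using c unfolding mem_C by blast
      then have "row i A \<bullet> c \<in> factor_set (K i)"
        by (simp add: A_nth 1(3))
      then show ?thesis
        using K_not_Rzero[OF 1(1)] 1 by (cases "K i") (auto simp: normal_def sign_def)
    next
      case 2
      then have "c $ j \<ge> 0" using c unfolding mem_C by (metis ereal_less_eq(3) zero_ereal_def)
      then show ?thesis using 2 by (simp add: normal_def sign_def inner_axis inner_commute)
    next
      case 3
      then have "c $ j \<le> 0" using c unfolding mem_C by (metis ereal_less_eq(3) zero_ereal_def)
      then show ?thesis using 3 by (simp add: normal_def sign_def inner_axis inner_commute)
    qed
  qed
  then show ?thesis unfolding normal_cone_def by simp
qed

text \<open>A direction orthogonal to all active normals would put a line into \<open>C\<close>,
  against pointedness.\<close>

lemma span_normal: "span (normal ` active) = UNIV"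
proof (rule ccontr)
  assume "span (normal ` active) \<noteq> UNIV"
  then have "span (normal ` active) \<subset> span UNIV"
    by auto
  then have "\<exists>d. d \<noteq> 0 \<and> (\<forall>y\<in>span (normal ` active). orthogonal d y)"
  proof (rule orthogonal_to_subspace_exists_gen)
    fix d assume "d \<noteq> 0" "\<And>y. y \<in> span (normal ` active) \<Longrightarrow> orthogonal d y"
    then show ?thesis by (intro exI[of _ d]) simp
  qed
  then obtain d where d: "d \<noteq> 0" "\<forall>y\<in>span (normal ` active). orthogonal d y"
    by blast
  have "normal x \<bullet> d = 0" if "x \<in> active" for x
    using bspec[OF d(2), of "normal x"] that by (simp add: span_base orthogonal_def inner_commute)
  then obtain \<eta> \<eta>' where \<eta>: "\<eta> > 0" "\<eta> *\<^sub>R d \<in> C" "\<eta>' > 0" "\<eta>' *\<^sub>R (- d) \<in> C"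
    using small_multiple_in_C[of d] small_multiple_in_C[of "- d"] by auto
  have "d \<in> C" "- d \<in> C"
    using mem_cone[OF C_cone \<eta>(2), of "1 / \<eta>"] mem_cone[OF C_cone \<eta>(4), of "1 / \<eta>'"] \<eta>(1,3) by simp_all
  then have "d \<in> C \<inter> uminus ` C" by (metis IntI image_eqI minus_minus)
  then show False using d(1) C_pointed by blast
qed

text \<open>The normal cone is full-dimensional, so \<open>r\<close> is an interior point of it and
  tolerates the subtraction of \<open>q\<close> divided by a large \<open>t\<close>.\<close>

lemma covering_points:
  "\<exists>k0. \<forall>t\<ge>k0. t *\<^sub>R r - q \<in> convex_cone hull (normal ` active)"
proof -
  let ?N = "normal_cone C 0"
  have "0 \<in> ?N" unfolding normal_cone_def by simp
  have "span (normal ` active) \<subseteq> span ?N"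
    using normal_in_normal_cone by (intro span_mono) blast
  then have "affine hull ?N = UNIV"
    using affine_hull_span_0[OF hull_inc[OF \<open>0 \<in> ?N\<close>]] unfolding span_normal by blast
  then have "r \<in> interior ?N"
    using r rel_interior_interior by blast
  then obtain e where e: "e > 0" "ball r e \<subseteq> ?N"
    unfolding mem_interior by blast
  have "t *\<^sub>R r - q \<in> convex_cone hull (normal ` active)" if t: "t \<ge> norm q / e + 1" for t
  proof -
    have "norm q / e \<ge> 0" using e(1) by simp
    then have "t > 0" "norm q / e < t" using t by linarith+
    then have "norm ((1 / t) *\<^sub>R q) < e"
      using e(1) by (simp add: field_simps)
    then have "r - (1 / t) *\<^sub>R q \<in> ?N"
      using e(2) by (auto simp: dist_norm)
    then have "r - (1 / t) *\<^sub>R q \<in> convex_cone hull (normal ` active)"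
      using normal_cone_subset_hull by blast
    from convex_cone_hull_mul[OF this, of t] \<open>t > 0\<close> show ?thesis
      by (simp add: scaleR_diff_right)
  qed
  then show ?thesis by blast
qed

text \<open>Caratheodory gives for each large integer a basis of normals with nonnegative
  coordinates, and infinitely many integers share one basis. The coordinates are affine in t, so
  their slopes are nonnegative and they stay nonnegative from the first such integer on.\<close>

lemma simplicial_cone_of_ray:
  "\<exists>D \<tau>. D \<subseteq> normal ` active \<and> independent D \<and> span D = UNIV \<and> \<tau> > 0 \<and>
    (\<forall>t\<ge>\<tau>. \<exists>c. (\<forall>d\<in>D. c d \<ge> 0) \<and> t *\<^sub>R r - q = (\<Sum>d\<in>D. c d *\<^sub>R d))"
proof -
  let ?G = "normal ` active"
  have fin: "finite ?G" using finite_vars by blast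
  obtain k0 where k0: "\<And>t. t \<ge> k0 \<Longrightarrow> t *\<^sub>R r - q \<in> convex_cone hull ?G"
    using covering_points by blast
  have ex: "\<exists>D. D \<subseteq> ?G \<and> independent D \<and> span D = UNIV \<and>
      (\<exists>c. (\<forall>d\<in>D. c d \<ge> 0) \<and> t *\<^sub>R r - q = (\<Sum>d\<in>D. c d *\<^sub>R d))" if t: "t \<ge> k0" for t
  proof -
    obtain D c where D: "D \<subseteq> ?G" "independent D" "\<forall>d\<in>D. c d \<ge> 0" "t *\<^sub>R r - q = (\<Sum>d\<in>D. c d *\<^sub>R d)"
      using convex_cone_hull_caratheodory[OF fin k0[OF t]] by blast
    obtain D' where D': "D \<subseteq> D'" "D' \<subseteq> ?G" "independent D'" "?G \<subseteq> span D'"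
      using maximal_independent_subset_extend[OF D(1,2)] by blast
    have "span D' = UNIV"
      using span_mono[OF D'(4)] span_normal by (simp add: span_span) blast
    moreover have "(\<Sum>d\<in>D. c d *\<^sub>R d) = (\<Sum>d\<in>D'. (if d \<in> D then c d else 0) *\<^sub>R d)"
      using D'(1) finite_subset[OF D'(2) fin] by (intro sum.mono_neutral_cong_left) auto
    ultimately show ?thesis
      using D' D(3,4) by (intro exI[of _ D'] conjI exI[of _ "\<lambda>d. if d \<in> D then c d else 0"]) auto
  qed
  define K0 where "K0 = nat \<lceil>\<bar>k0\<bar>\<rceil> + 1"
  have K0: "real k \<ge> k0" "k > 0" if "k \<ge> K0" for k
  proof -
    have "real k \<ge> real K0" using that by simp
    then show "real k \<ge> k0" unfolding K0_def by linarith
    show "k > 0" using that unfolding K0_def by simp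
  qed
  define P where "P k D \<longleftrightarrow> D \<subseteq> ?G \<and> independent D \<and> span D = UNIV \<and>
      (\<exists>c. (\<forall>d\<in>D. c d \<ge> 0) \<and> real k *\<^sub>R r - q = (\<Sum>d\<in>D. c d *\<^sub>R d))" for k D
  define Df where "Df k = (SOME D. P k D)" for k
  have Df': "P k (Df k)" if "k \<ge> K0" for k
    unfolding Df_def by (rule someI_ex) (unfold P_def, rule ex[OF K0(1)[OF that]])
  note Df = Df'[unfolded P_def]
  have "finite (Df ` {K0..})"
    by (rule finite_subset[of _ "Pow ?G"]) (use Df fin in \<open>blast, simp\<close>)
  then obtain k1 where k1: "k1 \<ge> K0" "infinite {k \<in> {K0..}. Df k = Df k1}"
    using pigeonhole_infinite[OF infinite_Ici, of Df K0] by auto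
  define D where "D = Df k1"
  have D: "D \<subseteq> ?G" "independent D" "span D = UNIV" using Df[OF k1(1)] unfolding D_def by auto
  have finD: "finite D" using D(1) fin finite_subset by blast
  define \<rho> where "\<rho> = representation D"
  have rep: "v = (\<Sum>d\<in>D. \<rho> v d *\<^sub>R d)" for v
    unfolding \<rho>_def using sum_representation_eq[OF D(2) _ finD order_refl, of v] D(3) by simp
  have nonneg: "real k * \<rho> r d - \<rho> q d \<ge> 0" if k: "k \<ge> K0" "Df k = D" and d: "d \<in> D" for k d
  proof -
    obtain c where c: "\<forall>d\<in>D. c d \<ge> 0" "real k *\<^sub>R r - q = (\<Sum>d\<in>D. c d *\<^sub>R d)"
      using Df[OF k(1)] unfolding k(2) by blast
    have "(\<Sum>d\<in>D. (c d - (real k * \<rho> r d - \<rho> q d)) *\<^sub>R d) =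
        (\<Sum>d\<in>D. c d *\<^sub>R d) - (real k *\<^sub>R (\<Sum>d\<in>D. \<rho> r d *\<^sub>R d) - (\<Sum>d\<in>D. \<rho> q d *\<^sub>R d))"
      by (simp add: scaleR_diff_left sum_subtractf scaleR_sum_right)
    also have "\<dots> = 0" unfolding rep[symmetric] c(2) by simp
    finally have "c d - (real k * \<rho> r d - \<rho> q d) = 0"
      using independentD[OF D(2) finD order_refl, where u = "\<lambda>d. c d - (real k * \<rho> r d - \<rho> q d)"] d by blast
    then show ?thesis using c(1) d by auto
  qed
  \<comment> \<open>A negative slope would bound the indices that use the basis \<open>D\<close>,
    but there are infinitely many of them.\<close>
  have pos: "\<rho> r d \<ge> 0" if d: "d \<in> D" for d
  proof (rule ccontr)
    assume "\<not> \<rho> r d \<ge> 0"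
    then have neg: "\<rho> r d < 0" by simp
    have "k \<le> nat \<lceil>\<bar>\<rho> q d / \<rho> r d\<bar>\<rceil>" if "k \<in> {k \<in> {K0..}. Df k = Df k1}" for k
    proof -
      have "real k * \<rho> r d \<ge> \<rho> q d"
        using nonneg[of k d] that d unfolding D_def by simp
      then have "real k \<le> \<rho> q d / \<rho> r d"
        using neg by (simp add: neg_le_divide_eq)
      then show ?thesis by linarith
    qed
    then have "finite {k \<in> {K0..}. Df k = Df k1}"
      using finite_nat_set_iff_bounded_le by blast
    then show False using k1(2) by blast
  qed
  have "\<exists>c. (\<forall>d\<in>D. c d \<ge> 0) \<and> t *\<^sub>R r - q = (\<Sum>d\<in>D. c d *\<^sub>R d)" if t: "t \<ge> real k1" for t
  proof (intro exI conjI ballI)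
    show "t *\<^sub>R r - q = (\<Sum>d\<in>D. (t * \<rho> r d - \<rho> q d) *\<^sub>R d)"
      by (simp add: scaleR_diff_left sum_subtractf rep[symmetric] flip: scaleR_scaleR scaleR_sum_right)
    fix d assume d: "d \<in> D"
    have "real k1 * \<rho> r d \<le> t * \<rho> r d"
      using t pos[OF d] by (rule mult_right_mono)
    then show "t * \<rho> r d - \<rho> q d \<ge> 0"
      using nonneg[OF k1(1) _ d] unfolding D_def by simp
  qed
  then show ?thesis
    using D K0(2)[OF k1(1)] by (intro exI[of _ D] exI[of _ "real k1"]) auto
qed

section \<open>A starting basis and its lexicographic order\<close>

lemma coeff_subset_sum:
  assumes "is_basis B" "U \<subseteq> B" "x \<in> B"
  shows "coeff B (\<Sum>y\<in>U. c y *\<^sub>R col y) x = (if x \<in> U then c x else 0)"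
proof (rule coeff_eqI[OF assms(1) _ assms(3)])
  show "(\<Sum>y\<in>B. (if y \<in> U then c y else 0) *\<^sub>R col y) = (\<Sum>y\<in>U. c y *\<^sub>R col y)"
    using assms(2) finite_vars by (intro sum.mono_neutral_cong_right) auto
qed

lemma coeff_col_other:
  assumes "is_basis B" "y \<in> B" "x \<in> B" "x \<noteq> y"
  shows "coeff B (col y) x = 0"
  using coeff_subset_sum[OF assms(1), of "{y}" x "\<lambda>_. 1"] assms by simp

lemma card_selection:
  assumes "selection S"
  shows "card (S - {Tvar}) = CARD('n) + card R"
proof -
  define index :: "('n, 'm) var \<Rightarrow> 'n + 'm" where
    "index x = (case x of Zvar j \<Rightarrow> Inl j | Wvar j \<Rightarrow> Inl j | Vvar j \<Rightarrow> Inl j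
      | Svar i \<Rightarrow> Inr i | Lvar i \<Rightarrow> Inr i | Tvar \<Rightarrow> undefined)"
    for x
  note tri = selectionD(1)[OF assms] and two = selectionD(2)[OF assms] and sub = selectionD(3)[OF assms]
  have "inj_on index (S - {Tvar})"
  proof (rule inj_onI)
    fix x y assume "x \<in> S - {Tvar}" "y \<in> S - {Tvar}" "index x = index y"
    moreover have "i \<in> R" if "Svar i \<in> S \<or> Lvar i \<in> S" for i
      using that sub by auto
    ultimately show "x = y"
      using tri two unfolding index_def by (cases x; cases y) auto
  qed
  moreover have "index ` (S - {Tvar}) = UNIV <+> R"
  proof (intro equalityI subsetI)
    fix v assume "v \<in> index ` (S - {Tvar})"
    then obtain x where "x \<in> S" "x \<noteq> Tvar" "v = index x" by blast
    then show "v \<in> UNIV <+> R"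
      using sub unfolding index_def by (cases x) auto
  next
    fix v :: "'n + 'm" assume v: "v \<in> UNIV <+> R"
    show "v \<in> index ` (S - {Tvar})"
    proof (cases v)
      case (Inl j)
      then have "v = index (Zvar j)" "v = index (Wvar j)" "v = index (Vvar j)"
        unfolding index_def by simp_all
      then show ?thesis using tri[of j] by blast
    next
      case (Inr i)
      then have "i \<in> R" "v = index (Svar i)" "v = index (Lvar i)"
        using v unfolding index_def by auto
      then show ?thesis using two[of i] by blast
    qed
  qed
  ultimately have "card (S - {Tvar}) = card (UNIV <+> R :: ('n + 'm) set)"
    by (metis card_image)
  then show ?thesis by (simp add: card_Plus)
qed

text \<open>In a vanishing combination the primal variables of constraints in \<open>D\<close> are
  nonbasic, so the z-part is orthogonal to all normals of \<open>D\<close> and vanishes. Then the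
  slacks vanish, and independence of the normals handles the multipliers.\<close>

lemma is_basis_of_normals:
  assumes D: "D \<subseteq> active" "inj_on normal D" "independent (normal ` D)" "span (normal ` D) = UNIV"
    and B: "B = D \<union> {Zvar j | j. Wvar j \<notin> D \<and> Vvar j \<notin> D} \<union> {Svar i | i. i \<in> R \<and> Lvar i \<notin> D}"
  shows "complementary_basis B"
proof -
  have not_both: "\<not> (l j = 0 \<and> u j = 0)" for j
    using l_less_u[of j] by auto
  have act: "Zvar j \<notin> D" "Svar i \<notin> D" "Tvar \<notin> D" "Wvar j \<in> D \<Longrightarrow> l j = 0" "Vvar j \<in> D \<Longrightarrow> u j = 0"
    "Lvar i \<in> D \<Longrightarrow> i \<in> R \<and> b $ i = 0" for i j
    using D(1) unfolding active_def by auto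
  have sub: "B \<subseteq> vars"
    using D(1) unfolding B active_def by auto
  have mem: "Zvar j \<in> B \<longleftrightarrow> Wvar j \<notin> D \<and> Vvar j \<notin> D" "Svar i \<in> B \<longleftrightarrow> i \<in> R \<and> Lvar i \<notin> D"
    "Wvar j \<in> B \<longleftrightarrow> Wvar j \<in> D" "Vvar j \<in> B \<longleftrightarrow> Vvar j \<in> D" "Lvar i \<in> B \<longleftrightarrow> Lvar i \<in> D" "Tvar \<notin> B" for i j
    using act unfolding B by auto
  have "\<not> (Wvar j \<in> D \<and> Vvar j \<in> D)" for j
    using act(4,5) not_both by blast
  then have sel: "selection (insert Tvar B)"
    unfolding selection_iff using sub mem by auto
  then have "card B = CARD('n) + card R"
    using card_selection[OF sel] mem(6) by simp
  then have "is_basis B"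
  proof (rule is_basisI[OF sub])
    fix c x assume c: "(\<Sum>x\<in>B. c x *\<^sub>R col x) = 0" and x: "x \<in> B"
    define X where "X x = (if x \<in> B then c x else 0)" for x
    have "system X = (\<Sum>x\<in>B. c x *\<^sub>R col x)"
      unfolding system_def X_def using sub finite_vars by (intro sum.mono_neutral_cong_right) auto
    moreover have "X x = 0" if "x \<notin> vars" for x
      using that sub unfolding X_def by auto
    then have "system X = (M *v zvec X - multiplier X - X Tvar *\<^sub>R r, A *v zvec X - svec X)"
      by (rule system_eq)
    ultimately have "(M *v zvec X - multiplier X - X Tvar *\<^sub>R r, A *v zvec X - svec X) = 0"
      using c by simp
    then have As: "A *v zvec X = svec X"
      by (simp add: zero_prod_def)
    have orth: "normal y \<bullet> zvec X = 0" if "y \<in> D" for y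
    proof (cases y)
      case (Lvar i)
      then have "X (Svar i) = 0" using that mem(2)[of i] unfolding X_def by simp
      then have "row i A \<bullet> zvec X = 0"
        using arg_cong[OF As, of "\<lambda>v. v $ i"] by (simp add: A_nth)
      then show ?thesis using Lvar by (simp add: normal_def)
    next
      case (Wvar j)
      then have "X (Zvar j) = 0" using that mem(1)[of j] unfolding X_def by simp
      then show ?thesis using Wvar by (simp add: normal_def inner_axis')
    next
      case (Vvar j)
      then have "X (Zvar j) = 0" using that mem(1)[of j] unfolding X_def by simp
      then show ?thesis using Vvar by (simp add: normal_def inner_axis')
    qed (use that act in auto)
    have "span (normal ` D) \<subseteq> {v. v \<bullet> zvec X = 0}"
      by (rule span_minimal) (use orth in \<open>auto simp: subspace_def inner_add_left\<close>)
    then have "zvec X \<bullet> zvec X = 0" using D(4) by blast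
    then have z: "zvec X = 0" by simp
    then have s: "svec X = 0" using As by simp
    have zs: "c (Zvar j) = 0 \<or> Zvar j \<notin> B" "c (Svar i) = 0 \<or> Svar i \<notin> B" for i j
      using arg_cong[OF z, of "\<lambda>v. v $ j"] arg_cong[OF s, of "\<lambda>v. v $ i"] unfolding X_def
      by (simp_all split: if_splits)
    have "(\<Sum>x\<in>B. c x *\<^sub>R col x) = (\<Sum>x\<in>D. c x *\<^sub>R col x)"
      by (rule sum.mono_neutral_right[OF finite_vars]) (use zs in \<open>auto simp: B\<close>)
    then have "(\<Sum>x\<in>D. (c x * sign x) *\<^sub>R normal x) = 0"
      using arg_cong[OF c, of fst] by (simp add: fst_sum fst_col)
    then have "(\<Sum>v\<in>normal ` D. (c (inv_into D normal v) * sign (inv_into D normal v)) *\<^sub>R v) = 0"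
      by (simp add: sum.reindex[OF D(2)] D(2))
    then have "c (inv_into D normal (normal y)) * sign (inv_into D normal (normal y)) = 0" if "y \<in> D" for y
      by (rule independentD[OF D(3) _ subset_refl _ imageI[OF that], rotated]) (simp add: finite_vars)
    then have "c y * sign y = 0" if "y \<in> D" for y
      using that D(2) by simp
    then have "c y = 0" if "y \<in> D" for y
      using that sign_sq[of y] by (metis mult_eq_0_iff zero_neq_one)
    then show "c x = 0"
      using x zs unfolding B by blast
  qed
  then show ?thesis
    unfolding complementary_basis_iff using mem(6) sel by blast
qed

text \<open>The first vector of each of the two blocks of the lexicographic order moves, respectively,
  the multipliers and the primal variables into the interior of their ranges.\<close>

lemma lex_order_exists:
  assumes B: "is_basis B" and D: "D \<subseteq> B" "card D = CARD('n)" "\<And>x. x \<in> D \<Longrightarrow> snd (col x) = 0"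
    and \<sigma>: "\<And>x. \<sigma> x \<noteq> (0::real)"
  shows "\<exists>xs ys. lex_order ((\<Sum>x\<in>D. \<sigma> x *\<^sub>R col x) # xs @ ys) \<and> length xs = CARD('n) - 1 \<and> set xs \<subseteq> col ` D \<and>
    (B - D \<noteq> {} \<longrightarrow> ys \<noteq> [] \<and> hd ys = (\<Sum>x\<in>B - D. \<sigma> x *\<^sub>R col x))"
proof -
  define p0 where "p0 = (\<Sum>x\<in>D. \<sigma> x *\<^sub>R col x)"
  define p1 where "p1 = (\<Sum>x\<in>B - D. \<sigma> x *\<^sub>R col x)"
  have Bv: "B \<subseteq> vars" "card B = CARD('n) + card R" "inj_on col B" "independent (col ` B)"
    using B unfolding is_basis_def by auto
  have es: "col x \<in> equation_space" if "x \<in> B" for x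
    using that Bv(1) col_in_equation_space by blast
  have "D \<noteq> {}" using D(2) by auto
  then obtain x0 where x0: "x0 \<in> D" by blast
  have p0: "p0 \<in> equation_space" "p1 \<in> equation_space" "snd p0 = 0"
    unfolding p0_def p1_def using D es
    by (auto intro!: subspace_sum subspace_scale subspace_equation_space simp: snd_sum)
  have p0c: "coeff B p0 x = (if x \<in> D then \<sigma> x else 0)"
    "coeff B p1 x = (if x \<in> B - D then \<sigma> x else 0)" if "x \<in> B" for x
    unfolding p0_def p1_def by (rule coeff_subset_sum[OF B]; use D(1) that in blast)+
  have col_x0: "coeff B p x0 = 0" if "p \<in> col ` (B - {x0})" for p
    using that coeff_col_other[OF B] x0 D(1) by blast
  \<comment> \<open>\<open>p0\<close> has a nonzero coordinate at \<open>x0\<close> and can replace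
    that column; \<open>p1\<close> replaces the column of \<open>y0\<close> below in the same
    way.\<close>
  have p0_notin: "p0 \<notin> span (col ` (B - {x0}))"
  proof
    assume "p0 \<in> span (col ` (B - {x0}))"
    then have "coeff B p0 x0 = 0"
      by (rule coeff_vanishing_on_span[OF B, rotated 3])
        (use x0 D(1) es col_x0 in blast)+
    then show False using p0c(1)[of x0] x0 D(1) \<sigma> by auto
  qed
  obtain xs where xs: "set xs = col ` (D - {x0})" "distinct xs"
    using finite_distinct_list[of "col ` (D - {x0})"] finite_vars by blast
  have "inj_on col D" by (rule inj_on_subset[OF Bv(3) D(1)])
  have len_xs: "length xs = CARD('n) - 1"
    using distinct_card[OF xs(2)] xs(1) x0 D(2)
      card_image[OF inj_on_subset[OF \<open>inj_on col D\<close>, of "D - {x0}"]] finite_vars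
    by (simp add: card_Diff_singleton)
  have Dsub: "D - {x0} \<subseteq> B - {x0}" using D(1) by blast
  define E where "E = insert p0 (col ` (D - {x0}))"
  have indep0: "independent (insert p0 (col ` (B - {x0})))"
    using independent_insert[of p0 "col ` (B - {x0})"] p0_notin
      independent_mono[OF Bv(4), of "col ` (B - {x0})"] by (auto split: if_splits)
  have p0_xs: "p0 \<notin> set xs"
    using p0_notin span_base[of p0 "col ` (B - {x0})"] Dsub unfolding xs(1) by blast
  have cardBD: "card (B - D) = card R"
    using D(1,2) Bv(2) finite_vars by (simp add: card_Diff_subset)
  have E_es: "set (p0 # xs) \<subseteq> equation_space"
    using p0(1) es D(1) by (auto simp: xs(1))
  have n1: "Suc (CARD('n) - 1) = CARD('n)" by simp
  have snd_first: "snd (((p0 # xs) @ ys) ! k) = 0" if "k < CARD('n)" for k ys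
  proof -
    have "k < length (p0 # xs)" using that len_xs by simp
    then have "((p0 # xs) @ ys) ! k = (p0 # xs) ! k" "(p0 # xs) ! k \<in> set (p0 # xs)"
      using nth_append[of "p0 # xs" ys k] nth_mem[of k "p0 # xs"] by simp_all
    then show ?thesis using p0(3) D(3) xs(1) by auto
  qed
  show ?thesis
  proof (cases "B - D = {}")
    case True
    then have "B = D" "card R = 0" using D(1) cardBD by auto
    have "lex_order (p0 # xs @ [])"
      unfolding lex_order_def
    proof (intro conjI)
      show "length (p0 # xs @ []) = CARD('n) + card R"
        using len_xs \<open>card R = 0\<close> by simp
      show "distinct (p0 # xs @ [])" using xs(2) p0_xs by simp
      show "independent (set (p0 # xs @ []))"
        using indep0 \<open>B = D\<close> by (simp add: xs(1))
      show "\<forall>p\<in>set (p0 # xs @ []). \<forall>i. i \<notin> R \<longrightarrow> snd p $ i = 0"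
        using E_es unfolding equation_space_def by auto
      show "\<forall>k<CARD('n). snd ((p0 # xs @ []) ! k) = 0"
        using snd_first[of _ "[]"] by simp
    qed
    then show ?thesis
      using True len_xs xs(1) unfolding p0_def by blast
  next
    case False
    then obtain y0 where y0: "y0 \<in> B - D" by blast
    let ?Q = "col ` (B - D - {y0})"
    let ?P = "insert p0 (col ` (D - {x0}) \<union> ?Q)"
    have col_y0: "coeff B p y0 = 0" if "p \<in> ?P" for p
    proof (cases "p = p0")
      case True
      then show ?thesis using p0c(1)[of y0] y0 by simp
    next
      case False
      then show ?thesis using that coeff_col_other[OF B] y0 D(1) by blast
    qed
    have P_es: "?P \<subseteq> equation_space"
      using p0(1) es D(1) by blast
    have p1_notin: "p1 \<notin> span ?P"
    proof
      assume "p1 \<in> span ?P"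
      then have "coeff B p1 y0 = 0"
        using coeff_vanishing_on_span[OF B _ P_es col_y0] y0 by blast
      then show False using p0c(2)[of y0] y0 \<sigma> by auto
    qed
    obtain ys where ys: "set ys = ?Q" "distinct ys"
      using finite_distinct_list[of ?Q] finite_vars by blast
    have "inj_on col (B - D - {y0})" by (rule inj_on_subset[OF Bv(3)]) blast
    then have len_ys: "Suc (length ys) = card R"
      using distinct_card[OF ys(2)] ys(1) y0 cardBD finite_vars card_image[of col "B - D - {y0}"]
      by (metis card_Suc_Diff1)
    have PQ: "?P \<subseteq> insert p0 (col ` (B - {x0}))"
      using D(1) x0 by blast
    have disj: "col ` (D - {x0}) \<inter> ?Q = {}"
      using Bv(3) D(1) unfolding inj_on_def by blast
    have "lex_order (p0 # xs @ (p1 # ys))"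
      unfolding lex_order_def
    proof (intro conjI)
      show "length (p0 # xs @ (p1 # ys)) = CARD('n) + card R"
        using len_xs len_ys by simp
      have "?Q \<subseteq> col ` (B - {x0})"
        using x0 by blast
      moreover have "p0 \<notin> col ` (B - {x0})"
        by (rule contrapos_nn[OF p0_notin span_base])
      ultimately have "p0 \<notin> ?Q"
        by (rule contra_subsetD)
      moreover have "p1 \<notin> ?P"
        by (rule contrapos_nn[OF p1_notin span_base])
      ultimately show "distinct (p0 # xs @ (p1 # ys))"
        using xs ys p0_xs disj by auto
      have "independent (insert p1 ?P)"
        using independent_insert[of p1 ?P] p1_notin independent_mono[OF indep0 PQ] by simp
      then show "independent (set (p0 # xs @ (p1 # ys)))"
        by (simp add: xs(1) ys(1) insert_commute)
      show "\<forall>p\<in>set (p0 # xs @ (p1 # ys)). \<forall>i. i \<notin> R \<longrightarrow> snd p $ i = 0"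
        using E_es p0(2) es ys(1) unfolding equation_space_def by auto
      show "\<forall>k<CARD('n). snd ((p0 # xs @ (p1 # ys)) ! k) = 0"
        using snd_first[of _ "p1 # ys"] by simp
    qed
    then show ?thesis
      using len_xs xs(1) unfolding p0_def[symmetric] p1_def[symmetric]
      by (intro exI[of _ xs] exI[of _ "p1 # ys"]) auto
  qed
qed

text \<open>The assignment with z = 0, slacks \<open>- b\<close> and the coefficients of the conic
  combination as multipliers solves the system and agrees with the starting values off
  \<open>B\<close>, which identifies it.\<close>

lemma start_state_val:
  assumes cb: "complementary_basis B" and D: "D \<subseteq> active"
    and B: "B = D \<union> {Zvar j | j. Wvar j \<notin> D \<and> Vvar j \<notin> D} \<union> {Svar i | i. i \<in> R \<and> Lvar i \<notin> D}"
    and c: "t *\<^sub>R r - q = (\<Sum>x\<in>D. c x *\<^sub>R normal x)"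
  shows "val (start_state B t) x =
    (case x of Tvar \<Rightarrow> t | Svar i \<Rightarrow> - b $ i | _ \<Rightarrow> if x \<in> D then sign x * c x else 0)"
proof -
  let ?s = "start_state B t"
  define X where "X x = (case x of Tvar \<Rightarrow> t | Svar i \<Rightarrow> - b $ i | _ \<Rightarrow> if x \<in> D then sign x * c x else 0)" for x
  have act: "Zvar j \<notin> D" "Svar i \<notin> D" "Tvar \<notin> D" "Wvar j \<in> D \<Longrightarrow> l j = 0" "Vvar j \<in> D \<Longrightarrow> u j = 0"
    "Lvar i \<in> D \<Longrightarrow> i \<in> R \<and> b $ i = 0" for i j
    using D unfolding active_def by auto
  have isb: "is_basis B" "Tvar \<notin> B" using cb unfolding complementary_basis_iff by auto
  have Dv: "D \<subseteq> vars" using D unfolding active_def by auto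
  have X0: "X x = 0" if "x \<notin> vars" for x
    using that Dv b_zero unfolding X_def by (cases x) auto
  have "(\<Sum>x\<in>vars. X x *\<^sub>R fst (col x)) = (\<Sum>x\<in>insert Tvar D. X x *\<^sub>R fst (col x))"
  proof (rule sum.mono_neutral_right[OF finite_vars])
    show "insert Tvar D \<subseteq> vars" using Dv by simp
    show "\<forall>x\<in>vars - insert Tvar D. X x *\<^sub>R fst (col x) = 0"
    proof
      fix x assume "x \<in> vars - insert Tvar D"
      then show "X x *\<^sub>R fst (col x) = 0"
        unfolding X_def by (cases x) simp_all
    qed
  qed
  also have "\<dots> = - (t *\<^sub>R r) + (\<Sum>x\<in>D. X x *\<^sub>R fst (col x))"
    using act(3) finite_vars by (simp add: X_def)
  also have "(\<Sum>x\<in>D. X x *\<^sub>R fst (col x)) = (\<Sum>x\<in>D. c x *\<^sub>R normal x)"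
  proof (rule sum.cong[OF refl])
    fix x assume x: "x \<in> D"
    then have "X x = sign x * c x"
      using act unfolding X_def by (cases x) auto
    then show "X x *\<^sub>R fst (col x) = c x *\<^sub>R normal x"
      using sign_sq[of x] by (simp add: fst_col mult.assoc mult.left_commute)
  qed
  finally have "fst (system X) = - q"
    unfolding system_def fst_sum fst_scaleR c[symmetric] by simp
  moreover have "snd (system X) = b"
  proof -
    have "zvec X = 0" "svec X = - b"
      using act(1) unfolding X_def by (simp_all add: vec_eq_iff)
    then show ?thesis
      using system_eq[OF X0] by simp
  qed
  ultimately have "system X = rhs"
    unfolding rhs_def by (simp add: prod_eq_iff)
  moreover have "system (val ?s) = rhs"
    using system_pval[of ?s "[]" 0] isb(1) val_pval[of ?s 0] by simp
  ultimately have "system (\<lambda>x. val ?s x - X x) = 0"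
    by (simp add: system_diff)
  moreover have "val ?s x - X x = 0" if "x \<notin> B" for x
  proof -
    have "val ?s x = start_val B t x" using that unfolding val_def by simp
    also have "\<dots> = X x"
    proof (cases x)
      case (Zvar j)
      then have "Wvar j \<in> D \<or> Vvar j \<in> D" using that unfolding B by auto
      moreover have "Wvar j \<in> B \<longleftrightarrow> Wvar j \<in> D" "Vvar j \<in> B \<longleftrightarrow> Vvar j \<in> D"
        unfolding B by auto
      ultimately show ?thesis
        using act(1,4,5) Zvar unfolding X_def by auto
    next
      case (Svar i)
      then have "i \<notin> R \<or> Lvar i \<in> D" using that unfolding B by auto
      then have "b $ i = 0" using act(6) b_zero by blast
      then show ?thesis using Svar unfolding X_def by simp
    qed (use that in \<open>auto simp: X_def B\<close>)
    finally show ?thesis by simp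
  qed
  ultimately have "(\<lambda>x. val ?s x - X x) = (\<lambda>x. 0)"
    by (intro system_zero_basis[OF isb(1)])
  from fun_cong[OF this, of x] show ?thesis
    unfolding X_def by simp
qed

text \<open>The simplicial cone gives multipliers of the right sign along a whole ray; variables
  standing at a bound are settled by the lexicographic order, whose leading vectors push them
  inwards.\<close>

lemma start_exists: "\<exists>ps s. start C 0 ps s"
proof -
  obtain D' \<tau> where D': "D' \<subseteq> normal ` active" "independent D'" "span D' = UNIV" "\<tau> > 0"
    "\<And>t. t \<ge> \<tau> \<Longrightarrow> \<exists>c. (\<forall>d\<in>D'. c d \<ge> 0) \<and> t *\<^sub>R r - q = (\<Sum>d\<in>D'. c d *\<^sub>R d)"
    using simplicial_cone_of_ray by blast
  obtain D where D: "D \<subseteq> active" "inj_on normal D" "D' = normal ` D"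
    using D'(1) unfolding subset_image_inj by blast
  have c: "\<exists>c. (\<forall>x\<in>D. c x \<ge> 0) \<and> t *\<^sub>R r - q = (\<Sum>x\<in>D. c x *\<^sub>R normal x)" if t: "t \<ge> \<tau>" for t
  proof -
    obtain c where "\<forall>d\<in>D'. c d \<ge> 0" "t *\<^sub>R r - q = (\<Sum>d\<in>D'. c d *\<^sub>R d)"
      using D'(5)[OF t] by blast
    then show ?thesis
      unfolding D(3) by (intro exI[of _ "\<lambda>x. c (normal x)"]) (simp add: sum.reindex[OF D(2)])
  qed
  have "card D' = dim (UNIV :: (real^'n) set)"
    using D'(2,3) by (intro basis_card_eq_dim) auto
  then have cardD: "card D = CARD('n)"
    unfolding D(3) by (simp add: card_image[OF D(2)])
  define B where "B = D \<union> {Zvar j | j. Wvar j \<notin> D \<and> Vvar j \<notin> D} \<union> {Svar i | i. i \<in> R \<and> Lvar i \<notin> D}"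
  have cb: "complementary_basis B"
    by (rule is_basis_of_normals[OF D(1,2) _ _ B_def]) (use D'(2,3) D(3) in auto)
  then have isb: "is_basis B" "Tvar \<notin> B" unfolding complementary_basis_iff by auto
  \<comment> \<open>The sign points away from a bound at which the variable may stand. A basic
    \<open>Zvar\<close> has value 0: it moves up if 0 is its lower bound, and otherwise a move down
    is safe.\<close>
  define \<sigma> :: "('n, 'm) var \<Rightarrow> real" where
    "\<sigma> x = (case x of Zvar j \<Rightarrow> if l j = 0 then 1 else -1
      | Svar i \<Rightarrow> if K i = Rminus then -1 else 1 | _ \<Rightarrow> sign x)" for x
  have \<sigma>: "\<sigma> x \<noteq> 0" for x
    unfolding \<sigma>_def sign_def by (cases x) auto
  have act: "Zvar j \<notin> D" "Svar i \<notin> D" "Tvar \<notin> D" "Lvar i \<in> D \<Longrightarrow> i \<in> R" for i j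
    using D(1) unfolding active_def by auto
  have snd0: "snd (col x) = 0" if "x \<in> D" for x
    using that D(1) unfolding active_def by auto
  have DB: "D \<subseteq> B" unfolding B_def by blast
  define p0 where "p0 = (\<Sum>x\<in>D. \<sigma> x *\<^sub>R col x)"
  define p1 where "p1 = (\<Sum>x\<in>B - D. \<sigma> x *\<^sub>R col x)"
  obtain xs ys where ps: "lex_order (p0 # xs @ ys)" and xs: "length xs = CARD('n) - 1" "set xs \<subseteq> col ` D"
    and ys: "B - D \<noteq> {} \<Longrightarrow> ys \<noteq> [] \<and> hd ys = p1"
    using lex_order_exists[of B D \<sigma>, OF isb(1) DB cardD snd0 \<sigma>] unfolding p0_def p1_def by blast
  define ps where "ps = p0 # xs @ ys"
  have coeffs: "coeff B p0 x = (if x \<in> D then \<sigma> x else 0)"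
    "coeff B p1 x = (if x \<in> B - D then \<sigma> x else 0)" if "x \<in> B" for x
    unfolding p0_def p1_def by (rule coeff_subset_sum[OF isb(1)]; use DB that in blast)+
  have lexf: "lex_feasible ps (start_state B t)" if t: "t \<ge> \<tau>" for t
  proof -
    obtain c where c: "\<forall>x\<in>D. c x \<ge> 0" "t *\<^sub>R r - q = (\<Sum>x\<in>D. c x *\<^sub>R normal x)"
      using c[OF t] by blast
    note val = start_state_val[OF cb D(1) B_def c(2)]
    show ?thesis
      unfolding lex_feasible_def
    proof (intro ballI allI)
      fix x \<beta> assume "x \<in> basis (start_state B t)"
      then have x: "x \<in> B" by simp
      show "(lo x = ereal \<beta> \<longrightarrow> lexordp_eq (lexreal ps \<beta>) (lexval ps (start_state B t) x)) \<and>
        (hi x = ereal \<beta> \<longrightarrow> lexordp_eq (lexval ps (start_state B t) x) (lexreal ps \<beta>))"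
      proof (cases "x \<in> D")
        case True
        have "val (start_state B t) x = sign x * c x"
          using True act unfolding val by (cases x) auto
        moreover have "coeff B p0 x = sign x"
          using coeffs(1)[OF x] True act unfolding \<sigma>_def by (cases x) auto
        moreover have "c x \<ge> 0" using c(1) True by blast
        moreover have "(lo x = ereal \<beta> \<longrightarrow> \<beta> = 0 \<and> sign x = 1) \<and> (hi x = ereal \<beta> \<longrightarrow> \<beta> = 0 \<and> sign x = -1)"
          using True act K_not_Rzero unfolding sign_def
          by (cases x) (auto simp: zero_ereal_def split: factor.splits)
        ultimately show ?thesis
          using x unfolding lexreal_def lexval_def ps_def by auto
      next
        case False
        then have "ys \<noteq> []" "hd ys = p1" using ys x by auto
        then obtain ys' where ys': "ys = p1 # ys'" by (cases ys) auto
        \<comment> \<open>Neither \<open>p0\<close> nor the columns of \<open>D\<close> affect a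
          primal basic variable; the first perturbation it feels is \<open>p1\<close>, with
          coefficient \<open>\<sigma> x\<close>.\<close>
        have "coeff B p x = 0" if "p \<in> set (p0 # xs)" for p
          using that coeffs(1)[OF x] False xs(2) coeff_col_other[OF isb(1) _ x] DB by auto
        then have "map (\<lambda>p. coeff B p x) (p0 # xs) = map (\<lambda>_. 0) (p0 # xs)"
          by (intro map_cong) auto
        also have "\<dots> = replicate CARD('n) 0"
          using xs(1) by (simp add: map_replicate_const flip: replicate_Suc)
        finally have "map (\<lambda>p. coeff B p x) ps = replicate CARD('n) 0 @ \<sigma> x # map (\<lambda>p. coeff B p x) ys'"
          using coeffs(2)[OF x] x False unfolding ps_def ys' by simp
        then have lv: "lexval ps (start_state B t) x =
            val (start_state B t) x # replicate CARD('n) 0 @ \<sigma> x # map (\<lambda>p. coeff B p x) ys'"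
          using x unfolding lexval_def by simp
        have lr: "lexreal ps \<beta> = \<beta> # replicate (CARD('n) + Suc (length ys')) 0"
          using xs(1) unfolding lexreal_def ps_def ys' by (simp add: map_replicate_const flip: replicate_Suc)
        have pos: "lexordp_eq (lexreal ps \<beta>) (lexval ps (start_state B t) x)"
          if "\<beta> < val (start_state B t) x \<or> \<beta> = val (start_state B t) x \<and> \<sigma> x > 0"
          using that lexordp_eq_zeros_pos(1)[of "\<sigma> x"] unfolding lv lr by auto
        have neg: "lexordp_eq (lexval ps (start_state B t) x) (lexreal ps \<beta>)"
          if "\<beta> > val (start_state B t) x \<or> \<beta> = val (start_state B t) x \<and> \<sigma> x < 0"
          using that lexordp_eq_zeros_pos(2)[of "\<sigma> x"] unfolding lv lr by auto
        consider j where "x = Zvar j" | i where "x = Svar i" "i \<in> R"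
          using x False unfolding B_def by blast
        then show ?thesis
        proof cases
          case 1
          have v: "val (start_state B t) x = 0" unfolding val 1 using act(1) by simp
          have "\<beta> < 0 \<or> \<beta> = 0 \<and> \<sigma> x > 0" if "lo x = ereal \<beta>"
            using that l_le[of j] unfolding 1 \<sigma>_def by (auto simp: zero_ereal_def)
          moreover have "\<beta> > 0 \<or> \<beta> = 0 \<and> \<sigma> x < 0" if "hi x = ereal \<beta>"
            using that u_ge[of j] l_less_u[of j] unfolding 1 \<sigma>_def by (auto simp: zero_ereal_def)
          ultimately show ?thesis
            using pos neg unfolding v by blast
        next
          case 2
          have v: "val (start_state B t) x = - b $ i" unfolding val 2 by simp
          have "- b $ i \<in> factor_set (K i)"
            using zero_in_C 2(2) unfolding mem_C by simp
          then have "\<beta> < - b $ i \<or> \<beta> = - b $ i \<and> \<sigma> x > 0" if "lo x = ereal \<beta>"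
            using that K_not_Rzero[OF 2(2)] unfolding 2 \<sigma>_def
            by (cases "K i") (auto simp: zero_ereal_def)
          moreover have "\<beta> > - b $ i \<or> \<beta> = - b $ i \<and> \<sigma> x < 0" if "hi x = ereal \<beta>"
            using that K_not_Rzero[OF 2(2)] \<open>- b $ i \<in> factor_set (K i)\<close> unfolding 2 \<sigma>_def
            by (cases "K i") (auto simp: zero_ereal_def)
          ultimately show ?thesis
            using pos neg unfolding v by blast
        qed
      qed
    qed
  qed
  have rest: "z_of (start_state B t) = 0 \<and> closest_point C (x_of (start_state B t)) = 0 \<and>
      G_map C M q r (x_of (start_state B t)) t = 0" if t: "t \<ge> \<tau>" for t
  proof -
    let ?s = "start_state B t"
    obtain c where c: "\<forall>x\<in>D. c x \<ge> 0" "t *\<^sub>R r - q = (\<Sum>x\<in>D. c x *\<^sub>R normal x)"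
      using c[OF t] by blast
    note val = start_state_val[OF cb D(1) B_def c(2)]
    have z: "z_of ?s = 0"
      unfolding z_of_def using act(1) by (simp add: val vec_eq_iff)
    have "x_of ?s = - multiplier (val ?s)"
      unfolding x_of_def z multiplier_def by simp
    moreover have "M *v zvec (val ?s) - multiplier (val ?s) - t *\<^sub>R r = - q"
      using system_start[OF cb, of "[]" 0 t] val_pval[of ?s 0] by (simp add: rhs_def)
    ultimately have x: "x_of ?s = t *\<^sub>R r - q"
      using z unfolding z_of_def by (simp add: algebra_simps)
    have "(\<Sum>x\<in>D. c x *\<^sub>R normal x) \<in> normal_cone C 0"
      unfolding normal_cone_def
    proof (intro CollectI ballI)
      fix v assume v: "v \<in> C"
      have "c x * (normal x \<bullet> v) \<le> 0" if "x \<in> D" for x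
        using c(1) that normal_in_normal_cone[of x] D(1) v unfolding normal_cone_def
        by (intro mult_nonneg_nonpos) auto
      then show "(\<Sum>x\<in>D. c x *\<^sub>R normal x) \<bullet> (v - 0) \<le> 0"
        by (simp add: inner_sum_left sum_nonpos)
    qed
    then have cp: "closest_point C (x_of ?s) = 0"
      using closest_point_normal[OF C_closed C_convex zero_in_C] unfolding x c(2) by fastforce
    then show ?thesis
      unfolding G_map_def using z x by simp
  qed
  have "start C 0 ps (start_state B \<tau>)"
    unfolding start_def using ps cb D'(4) lexf rest unfolding ps_def by blast
  then show ?thesis by blast
qed

end

section \<open>The theorem\<close>

lemma extreme_point_of_pointed_cone:
  assumes "convex C" "cone C" "C \<inter> uminus ` C = {0 :: 'a::real_vector}"
  shows "z extreme_point_of C \<longleftrightarrow> z = 0"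
proof
  have mult: "c *\<^sub>R x \<in> C" if "x \<in> C" "c \<ge> 0" for c x
    using assms(2) that by (simp add: mem_cone)
  assume z: "z extreme_point_of C"
  show "z = 0"
  proof (rule ccontr)
    assume "z \<noteq> 0"
    have "z \<in> C" using z unfolding extreme_point_of_def by blast
    then have "0 \<in> C" "2 *\<^sub>R z \<in> C" using mult[of z 0] mult[of z 2] by simp_all
    moreover have "z \<in> open_segment 0 (2 *\<^sub>R z)"
      unfolding in_segment using \<open>z \<noteq> 0\<close> by (auto intro!: exI[of _ "1/2"])
    ultimately show False
      using z unfolding extreme_point_of_def by blast
  qed
next
  have mult: "c *\<^sub>R x \<in> C" if "x \<in> C" "c \<ge> 0" for c x
    using assms(2) that by (simp add: mem_cone)
  assume "z = 0"
  have "0 \<notin> open_segment a b" if ab: "a \<in> C" "b \<in> C" for a b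
  proof
    assume "0 \<in> open_segment a b"
    then obtain u where u: "a \<noteq> b" "0 < u" "u < 1" "0 = (1 - u) *\<^sub>R a + u *\<^sub>R b"
      unfolding in_segment by blast
    have m: "(1 - u) *\<^sub>R a \<in> C" "u *\<^sub>R b \<in> C"
      using mult ab u(2,3) by simp_all
    moreover have eq: "(1 - u) *\<^sub>R a = - (u *\<^sub>R b)"
      using u(4) by (simp add: eq_neg_iff_add_eq_0)
    ultimately have "(1 - u) *\<^sub>R a \<in> C \<inter> uminus ` C" by blast
    then have "(1 - u) *\<^sub>R a = 0" using assms(3) by blast
    then have "a = 0" "b = 0" using u(2,3) eq by auto
    then show False using u(1) by simp
  qed
  moreover have "0 \<in> C" using assms(3) by blast
  ultimately show "z extreme_point_of C"
    using \<open>z = 0\<close> unfolding extreme_point_of_def by blast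
qed

theorem lemma3p2:
  fixes C :: "(real^'n) set" and q :: "real^'n" and M :: "real^'n^'n"
  assumes "polyhedron C" and "proper_cone C"
    and "copositive_on C M"
    and "\<And>z. z \<in> recession_cone C \<Longrightarrow> M *v z \<in> dual_cone (recession_cone C) \<Longrightarrow>
           z \<bullet> (M *v z) = 0 \<Longrightarrow> z \<bullet> q \<ge> 0"
  shows "(\<exists>z. solves_AVI C q M z) \<and>
    (\<forall>(R :: 'm::finite set) A b K l u. representation_of C R A b K l u \<longrightarrow>
       PathAVI_finds_solution C q M R A b K l u)"
proof -
  have C: "closed C" "convex C" "cone C" "C \<inter> uminus ` C = {0}"
    using assms(2) unfolding proper_cone_def by auto
  then have "0 \<in> C" by blast
  have imp: "\<forall>z\<in>C. M *v z \<in> dual_cone C \<longrightarrow> z \<bullet> (M *v z) = 0 \<longrightarrow> z \<bullet> q \<ge> 0"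
    using assms(4) unfolding recession_cone_of_convex_cone[OF C(2,3) \<open>0 \<in> C\<close>] by blast
  have "normal_cone C 0 \<noteq> {}"
    unfolding normal_cone_def by (auto intro: exI[of _ 0])
  \<comment> \<open>The negative of any such \<open>r\<close> is a linear functional that cuts
    bounded slices for the solvability argument.\<close>
  then obtain r where "r \<in> rel_interior (normal_cone C 0)"
    using rel_interior_eq_empty[OF convex_normal_cone] by blast
  then have "- r \<bullet> x > 0" if "x \<in> C" "x \<noteq> 0" for x
    using rel_interior_polar_negative[OF C _ that] by simp
  then have "\<exists>z. solves_AVI C q M z"
    using AVI_solution_exists[OF assms(1) C(1-3) \<open>0 \<in> C\<close> _ assms(3)] imp by blast
  moreover have "PathAVI_finds_solution C q M R A b K l u" if rep: "representation_of C R A b K l u"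
    for R :: "'m set" and A b K l u
    unfolding PathAVI_finds_solution_def extreme_point_of_pointed_cone[OF C(2-4)]
  proof (intro conjI allI impI)
    fix z r assume "z = 0 \<and> r \<in> rel_interior (normal_cone C z)"
    then have z: "z = 0" and r: "r \<in> rel_interior (normal_cone C 0)" by auto
    interpret pathavi_cone M q R A b K l u r C
      by unfold_locales (fact rep assms(2) r)+
    show "finds_solution C z"
      unfolding finds_solution_def z
      using start_exists start_finds_solution[OF _ assms(3) imp] by blast
  qed blast
  ultimately show ?thesis by blast
qed

end
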